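(* Let $1<p<\infty$, $0<s<1$ and let $\Omega\subsetneq\mathbb{R}^N$ be an open set. Then $$\mathfrak{h}_{s,p}(\Omega)=\sup\Big\{\lambda\ge 0\,:\, \text{the equation } (-\Delta_p)^s u=\lambda\,\frac{|u|^{p-2}\,u}{d_\Omega^{s\,p}} \text{ in } \Omega \text{ admits a positive local weak supersolution}\Big\}.$$
   Context: For an open set $\Omega\subsetneq\mathbb{R}^N$, $d_\Omega(x)=\min_{y\in\partial\Omega}|x-y|$ for $x\in\Omega$. $C^\infty_0(\Omega)$ is the space of smooth functions with compact support in $\Omega$, extended by $0$ to $\mathbb{R}^N$. Set $$[u]_{W^{s,p}(\mathbb{R}^N)}=\left(\iint_{\mathbb{R}^N\times\mathbb{R}^N}\frac{|u(x)-u(y)|^p}{|x-y|^{N+s\,p}}\,dx\,dy\right)^{1/p},$$ and let $W^{s,p}(\mathbb{R}^N)$ be the space of $u\in L^p(\mathbb{R}^N)$ with $[u]_{W^{s,p}(\mathbb{R}^N)}<+\infty$. The sharp fractional Hardy constant is $$\mathfrak{h}_{s,p}(\Omega)=\inf_{u\in C^\infty_0(\Omega)}\left\{[u]^p_{W^{s,p}(\mathbb{R}^N)}\,:\,\int_\Omega\frac{|u|^p}{d_\Omega^{s\,p}}\,dx=1\right\}.$$ The symbol $(-\Delta_p)^s$ stands for the fractional $p$-Laplacian of order $s$, defined in weak form by the first variation of the convex functional $u\mapsto\frac1p[u]^p_{W^{s,p}(\mathbb{R}^N)}$. For open sets $\Omega'\subset\Omega$, $\Omega'\Subset\Omega$ means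 that $\overline{\Omega'}$ is a compact set contained in $\Omega$. $W^{s,p}(\Omega')$ is the space of $u\in L^p(\Omega')$ with $\iint_{\Omega'\times\Omega'}\frac{|u(x)-u(y)|^p}{|x-y|^{N+s\,p}}\,dx\,dy<+\infty$. $W^{s,p}_{\rm loc}(\Omega)$ is the space of $u\in L^p_{\rm loc}(\Omega)$ with $u\in W^{s,p}(\Omega')$ for every $\Omega'\Subset\Omega$. For $0<\beta<\infty$, $L^\beta_{s\,p}(\mathbb{R}^N)$ is the space of $u\in L^\beta_{\rm loc}(\mathbb{R}^N)$ with $\int_{\mathbb{R}^N}\frac{|u(x)|^\beta}{(1+|x|)^{N+s\,p}}\,dx<+\infty$. Let $J_p:\mathbb{R}\to\mathbb{R}$ be the monotone increasing continuous function $J_p(t)=|t|^{p-2}\,t$. For $\lambda\ge0$, a local weak supersolution of $(-\Delta_p)^s u=\lambda\,|u|^{p-2}\,u/d_\Omega^{s\,p}$ in $\Omega$ is a function $u\in W^{s,p}_{\rm loc}(\Omega)\cap L^{p-1}_{s\,p}(\mathbb{R}^N)$ such that $$\iint_{\mathbb{R}^N\times\mathbb{R}^N}\frac{J_p(u(x)-u(y))\,(\varphi(x)-\varphi(y))}{|x-y|^{N+s\,p}}\,dx\,dy\ge\lambda\int_\Omega\frac{|u(x)|^{p-2}\,u(x)}{d_\Omega(x)^{s\,p}}\,\varphi(x)\,dx$$ for every non-negative $\varphi\in W^{s,p}(\mathbb{R}^N)$ with compact support in $\Omega$. *)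

theory Defs
  imports "HOL-Analysis.Analysis"
begin

text \<open>
  The space R^N is a Euclidean space of dimension N = DIM('a). Elements of Lebesgue and
  fractional Sobolev spaces are represented by Borel functions; every condition imposed on them
  below is invariant under modification on a null set.
\<close>

definition dist_bdry :: "'a::euclidean_space set \<Rightarrow> 'a \<Rightarrow> real" where
  "dist_bdry \<Omega> x = infdist x (frontier \<Omega>)"

primrec C_k :: "nat \<Rightarrow> ('a::euclidean_space \<Rightarrow> real) \<Rightarrow> bool" where
  "C_k 0 u \<longleftrightarrow> continuous_on UNIV u"
| "C_k (Suc k) u \<longleftrightarrow>
     (\<forall>x. u differentiable (at x)) \<and> (\<forall>v. C_k k (\<lambda>x. frechet_derivative u (at x) v))"

definition smooth_compact :: "'a::euclidean_space set \<Rightarrow> ('a \<Rightarrow> real) set" where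
  "smooth_compact \<Omega> =
     {u. (\<forall>k. C_k k u) \<and> compact (closure {x. u x \<noteq> 0}) \<and> closure {x. u x \<noteq> 0} \<subseteq> \<Omega>}"

text \<open>
  The p-th power of the Gagliardo seminorm on A; no p-th root is taken. On the null set x = y the
  integrand is 0, by the convention for division by zero.
\<close>

definition gagliardo_pow ::
  "real \<Rightarrow> real \<Rightarrow> 'a::euclidean_space set \<Rightarrow> ('a \<Rightarrow> real) \<Rightarrow> ennreal" where
  "gagliardo_pow s p A u =
     (\<integral>\<^sup>+(x, y)\<in>A \<times> A.
        ennreal (\<bar>u x - u y\<bar> powr p / norm (x - y) powr (real DIM('a) + s * p))
      \<partial>(lborel \<Otimes>\<^sub>M lborel))"

definition Leb :: "real \<Rightarrow> 'a::euclidean_space set \<Rightarrow> ('a \<Rightarrow> real) set" where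
  "Leb \<beta> A =
     {u. set_borel_measurable lborel A u \<and>
         (\<integral>\<^sup>+x\<in>A. ennreal (\<bar>u x\<bar> powr \<beta>) \<partial>lborel) < \<infinity>}"

definition Leb_loc :: "real \<Rightarrow> 'a::euclidean_space set \<Rightarrow> ('a \<Rightarrow> real) set" where
  "Leb_loc \<beta> \<Omega> = {u. \<forall>K. compact K \<and> K \<subseteq> \<Omega> \<longrightarrow> u \<in> Leb \<beta> K}"

definition Sobolev :: "real \<Rightarrow> real \<Rightarrow> 'a::euclidean_space set \<Rightarrow> ('a \<Rightarrow> real) set" where
  "Sobolev s p A = {u \<in> Leb p A. gagliardo_pow s p A u < \<infinity>}"

definition compactly_inside :: "'a::euclidean_space set \<Rightarrow> 'a set \<Rightarrow> bool" where
  "compactly_inside \<Omega>' \<Omega> \<longleftrightarrow> compact (closure \<Omega>') \<and> closure \<Omega>' \<subseteq> \<Omega>"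

definition Sobolev_loc :: "real \<Rightarrow> real \<Rightarrow> 'a::euclidean_space set \<Rightarrow> ('a \<Rightarrow> real) set" where
  "Sobolev_loc s p \<Omega> =
     {u \<in> Leb_loc p \<Omega>. \<forall>\<Omega>'. open \<Omega>' \<and> compactly_inside \<Omega>' \<Omega> \<longrightarrow> u \<in> Sobolev s p \<Omega>'}"

text \<open>The tail space; the parameter \<open>\<sigma>\<close> is the product s p.\<close>

definition Tail :: "real \<Rightarrow> real \<Rightarrow> ('a::euclidean_space \<Rightarrow> real) set" where
  "Tail \<beta> \<sigma> =
     {u \<in> Leb_loc \<beta> UNIV.
        (\<integral>\<^sup>+x. ennreal (\<bar>u x\<bar> powr \<beta> / (1 + norm x) powr (real DIM('a) + \<sigma>)) \<partial>lborel) < \<infinity>}"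

text \<open>The infimum is taken in \<open>[0, \<infinity>]\<close>; it is \<open>\<infinity>\<close> over the empty set.\<close>

definition hardy_const :: "real \<Rightarrow> real \<Rightarrow> 'a::euclidean_space set \<Rightarrow> ennreal" where
  "hardy_const s p \<Omega> =
     (INF u \<in> {u \<in> smooth_compact \<Omega>.
         (\<integral>\<^sup>+x\<in>\<Omega>. ennreal (\<bar>u x\<bar> powr p / dist_bdry \<Omega> x powr (s * p)) \<partial>lborel) = 1}.
       gagliardo_pow s p UNIV u)"

definition J :: "real \<Rightarrow> real \<Rightarrow> real" where
  "J p t = \<bar>t\<bar> powr (p - 2) * t"

definition frac_plap_form ::
  "real \<Rightarrow> real \<Rightarrow> ('a::euclidean_space \<Rightarrow> real) \<Rightarrow> ('a \<Rightarrow> real) \<Rightarrow> real" where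
  "frac_plap_form s p u \<phi> =
     (\<integral>(x, y). J p (u x - u y) * (\<phi> x - \<phi> y) / norm (x - y) powr (real DIM('a) + s * p)
      \<partial>(lborel \<Otimes>\<^sub>M lborel))"

text \<open>
  The support of an almost-everywhere class: the complement of the largest open set on which the
  function vanishes almost everywhere.
\<close>

definition ess_support :: "('a::euclidean_space \<Rightarrow> real) \<Rightarrow> 'a set" where
  "ess_support f = - \<Union>{U. open U \<and> (AE x in lborel. x \<in> U \<longrightarrow> f x = 0)}"

text \<open>
  Both integrals in the inequality converge absolutely for u and \<open>\<phi>\<close> in the stated classes,
  so the value 0 of the Bochner integral of a non-integrable function does not interfere.
\<close>

definition local_weak_supersolution ::
  "real \<Rightarrow> real \<Rightarrow> 'a::euclidean_space set \<Rightarrow> real \<Rightarrow> ('a \<Rightarrow> real) \<Rightarrow> bool" where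
  "local_weak_supersolution s p \<Omega> \<mu> u \<longleftrightarrow>
     u \<in> Sobolev_loc s p \<Omega> \<inter> Tail (p - 1) (s * p) \<and>
     (\<forall>\<phi> \<in> Sobolev s p UNIV.
        (AE x in lborel. 0 \<le> \<phi> x) \<and> compact (ess_support \<phi>) \<and> ess_support \<phi> \<subseteq> \<Omega> \<longrightarrow>
        frac_plap_form s p u \<phi> \<ge>
          \<mu> * (LINT x:\<Omega>|lborel. J p (u x) / dist_bdry \<Omega> x powr (s * p) * \<phi> x))"

text \<open>
  The equation is nonlocal, so the sign outside \<open>\<Omega>\<close> matters: a positive supersolution is
  positive in \<open>\<Omega>\<close> and non-negative in the whole space. It may vanish outside \<open>\<Omega>\<close>.
\<close>

definition positive_in :: "'a::euclidean_space set \<Rightarrow> ('a \<Rightarrow> real) \<Rightarrow> bool" where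
  "positive_in \<Omega> u \<longleftrightarrow>
     (AE x in lborel. 0 \<le> u x) \<and> (AE x in lborel. x \<in> \<Omega> \<longrightarrow> 0 < u x)"

end

theory Submission
  imports Defs
begin

text \<open>
  A positive supersolution is tested with the Picone quotient
  \<open>\<eta> powr p / (u + \<epsilon>) powr (p - 1)\<close>; the discrete Picone inequality bounds the form by the
  seminorm of \<open>\<eta>\<close>, and \<open>\<epsilon> \<rightarrow> 0\<close> gives the Hardy inequality with constant \<open>\<mu>\<close>.

  Conversely, let \<open>l\<close> be below the Hardy constant, \<open>E\<close> the p-th power of the seminorm and \<open>H\<close> the
  Hardy integral. Among non-negative admissible functions one minimizes
  \<open>E u - l * H u - \<integral> u / (1 + u) d\<kappa>\<close>, where \<open>\<kappa>\<close> is a finite measure with positive density.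
  Along the curves \<open>((u^p + w^p) / 2)^(1/p)\<close> the first term is convex, the second is affine, and the
  concave last term has an explicit quadratic gap; so a fast minimizing sequence is almost everywhere
  convergent without any compactness theorem. Approximate minimality alone yields the
  Euler--Lagrange inequality in the limit by Fatou's lemma, so neither lower semicontinuity nor the
  existence of a minimizer is needed. The derivative of the last term is a positive source, and testing
  again with Picone quotients turns it into positivity of the limit, which replaces a strong minimum
  principle.

  The Hardy inequality extends from smooth functions to test functions by mollification. Jensen's
  inequality shows that mollifying does not increase the seminorm, and finiteness of the seminorm
  itself controls the rate of convergence of the mollifications in the p-th mean.
\<close>

section \<open>Elementary inequalities\<close>

text \<open>Since the open set is arbitrary, neither boundary regularity nor an embedding is at
  hand, and the energy controls differences only. Everything is therefore extracted from the Hardy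
  inequality: \<open>l\<close> is kept strictly below a second admissible constant
  \<open>l'\<close>, and the gap \<open>1 - l / l'\<close> is the coercivity constant. The source u
  / (1 + u) is chosen because it is bounded, so it cannot spoil coercivity; increasing, so replacing
  the arithmetic mean by the larger power mean only helps; concave with a gap that is quadratic in
  the function itself; and of positive derivative 1 / (1 + u)^2. In the limit only an inequality
  must survive. For non-negative test functions the Hardy and source terms are non-negative and
  stand on the smaller side, where Fatou's lemma points the right way. The nonlocal form has no sign
  and stands on the larger side; it is completed by Young's inequality to a non-negative integrand
  with an arbitrarily small energy term.\<close>

lemma convex_on_powr_nonneg:
  fixes p :: real
  assumes "1 \<le> p"
  shows "convex_on {0..} (\<lambda>x. x powr p)"
proof (rule convex_onI)
  fix t x y :: real
  assume t: "0 < t" "t < 1" and "x \<in> {0..}" "y \<in> {0..}"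
  then have xy: "0 \<le> x" "0 \<le> y" by auto
  \<comment> \<open>With one endpoint at 0 the convexity inequality collapses to c^p <= c for a
    weight c in (0, 1).\<close>
  have le: "c powr p \<le> c" if "0 < c" "c < 1" for c :: real
    using powr_mono'[of 1 p c] assms that by simp
  consider "x = 0" | "y = 0" | "0 < x" "0 < y" using xy by linarith
  then show "((1 - t) *\<^sub>R x + t *\<^sub>R y) powr p \<le> (1 - t) * x powr p + t * y powr p"
  proof cases
    case 1
    then show ?thesis using assms t xy le[of t] by (simp add: powr_mult mult_right_mono)
  next
    case 2
    then show ?thesis using assms t xy le[of "1 - t"] by (simp add: powr_mult mult_right_mono)
  next
    case 3
    then show ?thesis using convex_onD[OF powr_convex[OF assms], of t x y] t by simp
  qed
qed simp

lemma powr_mean_le: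
  fixes p a b :: real
  assumes "1 \<le> p" "0 \<le> a" "0 \<le> b"
  shows "((a + b) / 2) powr p \<le> (a powr p + b powr p) / 2"
  using convex_onD[OF convex_on_powr_nonneg[OF assms(1)], of "1/2" a b] assms
  by (simp add: field_simps)

lemma abs_add_powr_le:
  fixes p a b :: real
  assumes "0 \<le> p"
  shows "\<bar>a + b\<bar> powr p \<le> 2 powr p * (\<bar>a\<bar> powr p + \<bar>b\<bar> powr p)"
proof -
  have "\<bar>a + b\<bar> powr p \<le> (2 * max \<bar>a\<bar> \<bar>b\<bar>) powr p"
    using assms by (intro powr_mono2) auto
  also have "\<dots> = 2 powr p * max \<bar>a\<bar> \<bar>b\<bar> powr p"
    by (simp add: powr_mult)
  also have "\<dots> \<le> 2 powr p * (\<bar>a\<bar> powr p + \<bar>b\<bar> powr p)"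
    by (intro mult_left_mono) (auto simp: max_def)
  finally show ?thesis .
qed

lemma J_mult_self: "J p t * t = \<bar>t\<bar> powr p"
proof (cases "t = 0")
  case False
  have "\<bar>t\<bar> powr p = \<bar>t\<bar> powr ((p - 2) + 2)" by simp
  also have "\<dots> = \<bar>t\<bar> powr (p - 2) * \<bar>t\<bar> powr 2" by (rule powr_add)
  also have "\<bar>t\<bar> powr 2 = t * t" using False by (simp add: powr_numeral power2_eq_square)
  finally show ?thesis by (simp add: J_def)
qed (simp add: J_def)

lemma abs_J: "\<bar>J p t\<bar> = \<bar>t\<bar> powr (p - 1)"
proof (cases "t = 0")
  case False
  have "\<bar>t\<bar> powr (p - 1) = \<bar>t\<bar> powr ((p - 2) + 1)" by simp
  also have "\<dots> = \<bar>t\<bar> powr (p - 2) * \<bar>t\<bar> powr 1" by (rule powr_add)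
  finally show ?thesis using False by (simp add: J_def abs_mult)
qed (simp add: J_def)

lemma J_nonneg: "0 \<le> t \<Longrightarrow> J p t = t powr (p - 1)"
  using abs_J[of p t] by (simp add: J_def)

lemma J_minus: "J p (- t) = - J p t"
  by (simp add: J_def)

lemma isCont_J:
  assumes "1 < p"
  shows "isCont (J p) t"
proof (cases "t = 0")
  case False
  then show ?thesis unfolding J_def by (intro continuous_intros) auto
next
  case True
  have "((\<lambda>x. \<bar>x\<bar> powr (p - 1)) \<longlongrightarrow> \<bar>0\<bar> powr (p - 1)) (at (0::real))"
    using assms by (intro tendsto_powr' tendsto_intros) auto
  then have "((\<lambda>x. \<bar>J p x\<bar>) \<longlongrightarrow> 0) (at (0::real))"
    using assms by (simp add: abs_J)
  then have "(J p \<longlongrightarrow> 0) (at 0)"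
    by (rule tendsto_rabs_zero_cancel)
  moreover have "J p 0 = 0" by (simp add: J_def)
  ultimately show ?thesis
    using True by (simp add: isCont_def)
qed

lemma borel_measurable_J [measurable]: "J p \<in> borel_measurable borel"
  unfolding J_def by measurable

text \<open>Compare |b| with \<epsilon> |z|: either b is absorbed into z, or |z| <= |b| / \<epsilon>
  and z is absorbed into b. The small factor stands on |z|^p, which later carries a quantity known
  only to be bounded; the large one stands on the fixed test function.\<close>

lemma J_young:
  assumes "1 < p" "0 < \<epsilon>"
  shows "\<bar>J p z * b\<bar> \<le> \<epsilon> * \<bar>z\<bar> powr p + \<epsilon> powr (1 - p) * \<bar>b\<bar> powr p"
proof (cases "\<bar>b\<bar> \<le> \<epsilon> * \<bar>z\<bar>")
  case True
  have "\<bar>J p z * b\<bar> \<le> \<bar>J p z\<bar> * (\<epsilon> * \<bar>z\<bar>)"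
    unfolding abs_mult using True by (intro mult_left_mono) auto
  also have "\<dots> = \<epsilon> * \<bar>J p z * z\<bar>" by (simp add: abs_mult)
  also have "\<dots> = \<epsilon> * \<bar>z\<bar> powr p" by (simp add: J_mult_self)
  finally show ?thesis by (simp add: add_increasing2)
next
  case False
  then have le: "\<bar>z\<bar> \<le> \<bar>b\<bar> / \<epsilon>" and b: "0 < \<bar>b\<bar>"
    using assms by (auto simp: field_simps intro: le_less_trans)
  have "\<bar>J p z * b\<bar> \<le> (\<bar>b\<bar> / \<epsilon>) powr (p - 1) * \<bar>b\<bar>"
    unfolding abs_mult abs_J using le assms by (intro mult_right_mono powr_mono2) auto
  also have "\<dots> = \<epsilon> powr (1 - p) * (\<bar>b\<bar> powr (p - 1) * \<bar>b\<bar> powr 1)"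
    using assms by (simp add: powr_divide powr_diff field_simps)
  also have "\<dots> = \<epsilon> powr (1 - p) * \<bar>b\<bar> powr p"
    unfolding powr_add[symmetric] by simp
  finally show ?thesis
    using assms by (simp add: add_increasing)
qed

lemma powr_tangent_nonneg:
  fixes p a c :: real
  assumes "1 < p" "0 \<le> a" "0 \<le> c"
  shows "c powr p + p * c powr (p - 1) * (a - c) \<le> a powr p"
proof (cases "c = 0")
  case False
  then have c: "0 < c" using assms by simp
  show ?thesis
  proof (cases "a = 0")
    case True
    have "c powr p = c powr (p - 1) * c powr 1"
      unfolding powr_add[symmetric] by simp
    then show ?thesis using True assms c by (simp add: mult_le_cancel_right1)
  next
    case a: False
    have "p * c powr (p - 1) * (a - c) \<le> a powr p - c powr p"
    proof (rule convex_on_imp_above_tangent[where A = "{0<..}"])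
      show "convex_on {0<..} (\<lambda>x. x powr p)" using assms by (intro powr_convex) simp
      show "((\<lambda>x. x powr p) has_real_derivative p * c powr (p - 1)) (at c within {0<..})"
        using c by (auto intro!: derivative_eq_intros)
    qed (use a c assms in \<open>auto simp: interior_open\<close>)
    then show ?thesis by simp
  qed
qed (use assms in auto)

text \<open>The derivative of |t|^p is p times \<open>J p t\<close>, so this is the supporting line
  of a convex function at c. It replaces differentiation: Jensen's inequality and both convex terms
  of the first variation come from it.\<close>

lemma J_tangent:
  assumes "1 < p"
  shows "\<bar>c\<bar> powr p + p * J p c * (a - c) \<le> \<bar>a\<bar> powr p"
proof -
  have "J p c * a \<le> \<bar>c\<bar> powr (p - 1) * \<bar>a\<bar>"
    using abs_ge_self[of "J p c * a"] by (simp add: abs_mult abs_J)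
  moreover have "\<bar>c\<bar> powr (p - 1) * \<bar>c\<bar> = J p c * c"
    using abs_J[of p c] J_mult_self[of p c]
    by (metis abs_mult abs_of_nonneg powr_ge_zero)
  ultimately have "J p c * (a - c) \<le> \<bar>c\<bar> powr (p - 1) * (\<bar>a\<bar> - \<bar>c\<bar>)"
    by (simp add: algebra_simps)
  then have "p * (J p c * (a - c)) \<le> p * (\<bar>c\<bar> powr (p - 1) * (\<bar>a\<bar> - \<bar>c\<bar>))"
    using assms by (intro mult_left_mono) auto
  then show ?thesis
    using powr_tangent_nonneg[OF assms, of "\<bar>a\<bar>" "\<bar>c\<bar>"] by (simp add: mult.assoc)
qed

text \<open>Minkowski's inequality for the two-point l^p norm: with A and B the norms of (a, b) and
  (c, d), the normalized sum is a convex combination with weights A / (A + B) and B / (A + B), and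
  convexity of the power is applied in each coordinate.\<close>

lemma powr_p_minkowski:
  fixes p a b c d :: real
  assumes p: "1 \<le> p" and nn: "0 \<le> a" "0 \<le> b" "0 \<le> c" "0 \<le> d"
  shows "((a + c) powr p + (b + d) powr p) powr (1 / p)
    \<le> (a powr p + b powr p) powr (1 / p) + (c powr p + d powr p) powr (1 / p)"
proof -
  define A where "A = (a powr p + b powr p) powr (1 / p)"
  define B where "B = (c powr p + d powr p) powr (1 / p)"
  have AB: "0 \<le> A" "0 \<le> B" by (auto simp: A_def B_def)
  have Ap: "A powr p = a powr p + b powr p" and Bp: "B powr p = c powr p + d powr p"
    using p by (simp_all add: A_def B_def powr_powr)
  have zero: "x = 0 \<and> y = 0" if "(x powr p + y powr p) powr (1 / p) = 0" "0 \<le> x" "0 \<le> y" for x y :: real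
    using that by (metis add_nonneg_eq_0_iff powr_eq_0_iff powr_ge_zero)
  consider "A = 0" | "B = 0" | "0 < A" "0 < B" using AB by linarith
  then show ?thesis
  proof cases
    case 1
    then show ?thesis using zero[of a b] nn by (simp add: A_def)
  next
    case 2
    then show ?thesis using zero[of c d] nn by (simp add: B_def)
  next
    case 3
    define t where "t = B / (A + B)"
    have t: "0 \<le> t" "t \<le> 1" using 3 by (auto simp: t_def)
    have *: "(x + y) powr p \<le> (A + B) powr p * ((1 - t) * (x powr p / A powr p) + t * (y powr p / B powr p))"
      if "0 \<le> x" "0 \<le> y" for x y
    proof -
      have "(x + y) / (A + B) = (1 - t) * (x / A) + t * (y / B)"
        using 3 by (simp add: t_def divide_simps)
      then have "((x + y) / (A + B)) powr p \<le> (1 - t) * (x / A) powr p + t * (y / B) powr p"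
        using convex_onD[OF convex_on_powr_nonneg[OF p], of t "x / A" "y / B"] t that 3 by simp
      then show ?thesis
        using 3 that by (simp add: powr_divide pos_divide_le_eq mult.commute)
    qed
    have "(a + c) powr p + (b + d) powr p
       \<le> (A + B) powr p * ((1 - t) * ((a powr p + b powr p) / A powr p)
            + t * ((c powr p + d powr p) / B powr p))"
      using add_mono[OF *[of a c] *[of b d]] nn by (simp add: algebra_simps add_divide_distrib)
    also have "\<dots> = (A + B) powr p"
      using 3 unfolding Ap[symmetric] Bp[symmetric] by simp
    finally have "((a + c) powr p + (b + d) powr p) powr (1 / p) \<le> ((A + B) powr p) powr (1 / p)"
      using p by (intro powr_mono2) auto
    also have "\<dots> = A + B" using p AB by (simp add: powr_powr)
    finally show ?thesis by (simp add: A_def B_def)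
  qed
qed

text \<open>The midpoint of the hidden-convexity curve: the p-th powers are averaged, not the
  values. For non-negative arguments it is, up to a constant factor, the l^p norm of (a, b).\<close>

definition pmean :: "real \<Rightarrow> real \<Rightarrow> real \<Rightarrow> real" where
  "pmean p a b = ((a powr p + b powr p) / 2) powr (1 / p)"

lemma pmean_nonneg [simp]: "0 \<le> pmean p a b"
  by (simp add: pmean_def)

lemma pmean_zero [simp]: "pmean p 0 0 = 0"
  by (simp add: pmean_def)

lemma pmean_powr: "1 < p \<Longrightarrow> pmean p a b powr p = (a powr p + b powr p) / 2"
  by (simp add: pmean_def powr_powr)

lemma pmean_ge:
  assumes "1 < p" "0 \<le> a" "0 \<le> b"
  shows "(a + b) / 2 \<le> pmean p a b"
proof -
  have "(((a + b) / 2) powr p) powr (1 / p) \<le> pmean p a b"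
    unfolding pmean_def using powr_mean_le[of p a b] assms by (intro powr_mono2) auto
  then show ?thesis using assms by (simp add: powr_powr)
qed

text \<open>Reverse triangle inequality for the l^p norm of pairs, raised to the power p. With a, b
  the values of two functions at x and c, d those at y, integration makes the energy convex along
  the curve.\<close>

lemma pmean_diff:
  assumes p: "1 < p" and nn: "0 \<le> a" "0 \<le> b" "0 \<le> c" "0 \<le> d"
  shows "\<bar>pmean p a b - pmean p c d\<bar> powr p \<le> (\<bar>a - c\<bar> powr p + \<bar>b - d\<bar> powr p) / 2"
proof -
  have pm: "pmean p x y = (1 / 2) powr (1 / p) * (x powr p + y powr p) powr (1 / p)" for x y
    unfolding pmean_def by (simp add: powr_divide powr_mult)
  have *: "pmean p x y \<le> pmean p z w + pmean p \<bar>x - z\<bar> \<bar>y - w\<bar>"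
    if "0 \<le> x" "0 \<le> y" "0 \<le> z" "0 \<le> w" for x y z w
  proof -
    have "pmean p x y \<le> pmean p (z + \<bar>x - z\<bar>) (w + \<bar>y - w\<bar>)"
      unfolding pmean_def using that p by (intro powr_mono2 divide_right_mono add_mono) auto
    also have "\<dots> \<le> pmean p z w + pmean p \<bar>x - z\<bar> \<bar>y - w\<bar>"
      unfolding pm distrib_left[symmetric]
      using that p by (intro mult_left_mono powr_p_minkowski) auto
    finally show ?thesis .
  qed
  have "\<bar>pmean p a b - pmean p c d\<bar> \<le> pmean p \<bar>a - c\<bar> \<bar>b - d\<bar>"
    using *[of a b c d] *[of c d a b] nn by (simp add: abs_minus_commute abs_le_iff)
  then have "\<bar>pmean p a b - pmean p c d\<bar> powr p \<le> pmean p \<bar>a - c\<bar> \<bar>b - d\<bar> powr p"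
    using p by (intro powr_mono2) auto
  then show ?thesis using p by (simp add: pmean_powr)
qed

definition sat :: "real \<Rightarrow> real" where
  "sat t = t / (1 + t)"

lemma borel_measurable_sat [measurable]: "sat \<in> borel_measurable borel"
  unfolding sat_def by measurable

lemma sat_zero [simp]: "sat 0 = 0"
  by (simp add: sat_def)

lemma sat_nonneg: "0 \<le> t \<Longrightarrow> 0 \<le> sat t"
  and sat_less_1: "0 \<le> t \<Longrightarrow> sat t < 1"
  by (simp_all add: sat_def)

lemma sat_mono: "0 \<le> a \<Longrightarrow> a \<le> b \<Longrightarrow> sat a \<le> sat b"
  by (simp add: sat_def field_simps)

text \<open>An exact increment rather than a derivative: the source can be varied by a finite step,
  and the denominator tends to (1 + a)^2 as the step vanishes.\<close>

lemma sat_add: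
  assumes "0 \<le> a" "0 \<le> b"
  shows "sat (a + b) - sat a = b / ((1 + a) * (1 + a + b))"
  using assms by (simp add: sat_def divide_simps add_nonneg_eq_0_iff) (simp add: algebra_simps)

text \<open>In A = 1 + a and B = 1 + b the function is 1 - 1 / A, and the concavity gap is (A - B)^2
  / (2 A B (A + B)). Since A, B >= 1 give A + B <= 2 A B, it dominates (1 / A - 1 / B)^2 / 4.
  Measuring the gap in \<open>sat\<close> itself keeps it uniform in a and b.\<close>

lemma sat_midpoint_gap:
  assumes "0 \<le> a" "0 \<le> b"
  shows "(sat a - sat b)\<^sup>2 / 4 \<le> sat ((a + b) / 2) - (sat a + sat b) / 2"
proof -
  define A B where "A = 1 + a" and "B = 1 + b"
  have AB: "1 \<le> A" "1 \<le> B" using assms by (auto simp: A_def B_def)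
  have sA: "sat a = 1 - 1 / A" and sB: "sat b = 1 - 1 / B" and sM: "sat ((a + b) / 2) = 1 - 2 / (A + B)"
    using assms by (simp_all add: sat_def A_def B_def field_simps)
  have 1: "sat ((a + b) / 2) - (sat a + sat b) / 2 = (A - B)\<^sup>2 / (2 * A * B * (A + B))"
    unfolding sA sB sM using AB by (simp add: divide_simps) (simp add: algebra_simps power2_eq_square)
  have 2: "(sat a - sat b)\<^sup>2 / 4 = (A - B)\<^sup>2 / (4 * A\<^sup>2 * B\<^sup>2)"
    unfolding sA sB using AB by (simp add: divide_simps power_mult_distrib) (simp add: algebra_simps power2_eq_square)
  have "A + B \<le> 2 * A * B"
    using AB mult_right_mono[of 1 A B] mult_left_mono[of 1 B A] by linarith
  then have "2 * A * B * (A + B) \<le> 2 * A * B * (2 * A * B)"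
    using AB by (intro mult_left_mono) auto
  also have "\<dots> = 4 * A\<^sup>2 * B\<^sup>2" by (simp add: power2_eq_square)
  finally show ?thesis unfolding 1 2 using AB by (intro divide_left_mono) (auto intro!: mult_pos_pos)
qed

text \<open>Only the ratio \<theta> = W / U matters. For b <= a, the point a is the convex
  combination of (a - b) / (1 - \<theta>) and b / \<theta> with weights 1 - \<theta> and \<theta>,
  and convexity of the power gives the claim; for a < b the left side is non-positive.\<close>

lemma picone_aux:
  fixes p a b U W :: real
  assumes p: "1 < p" and nn: "0 \<le> a" "0 \<le> b" and UW: "0 < W" "W \<le> U"
  shows "(U - W) powr (p - 1) * (a powr p / U powr (p - 1) - b powr p / W powr (p - 1)) \<le> \<bar>a - b\<bar> powr p"
proof (cases "U = W")
  case False
  define \<theta> where "\<theta> = W / U"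
  have \<theta>: "0 < \<theta>" "\<theta> < 1" using UW False by (auto simp: \<theta>_def)
  have U: "0 < U" and W: "W = \<theta> * U" using UW by (auto simp: \<theta>_def)
  have one: "U - W = (1 - \<theta>) * U" by (simp add: W algebra_simps)
  have lhs: "(U - W) powr (p - 1) * (a powr p / U powr (p - 1) - b powr p / W powr (p - 1))
     = (1 - \<theta>) powr (p - 1) * a powr p - (1 - \<theta>) powr (p - 1) * b powr p / \<theta> powr (p - 1)"
    unfolding one unfolding W using U \<theta> by (simp add: powr_mult right_diff_distrib)
  show ?thesis
  proof (cases "b \<le> a")
    case True
    define c where "c = 1 - \<theta>"
    have c: "0 < c" using \<theta> by (simp add: c_def)
    have "a = (1 - \<theta>) * ((a - b) / c) + \<theta> * (b / \<theta>)"
      using \<theta> c by (simp add: c_def)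
    then have "a powr p \<le> (1 - \<theta>) * ((a - b) / c) powr p + \<theta> * (b / \<theta>) powr p"
      using convex_onD[OF convex_on_powr_nonneg, of p \<theta> "(a - b) / c" "b / \<theta>"] p \<theta> c nn True by simp
    also have "\<dots> = (a - b) powr p / c powr (p - 1) + b powr p / \<theta> powr (p - 1)"
    proof -
      have h: "x * (y / x) powr p = y powr p / x powr (p - 1)" if "0 < x" "0 \<le> y" for x y :: real
        using that by (simp add: powr_divide powr_diff)
      show ?thesis using h[of c "a - b"] h[of \<theta> b] c \<theta> nn True by (simp add: c_def)
    qed
    finally have "c powr (p - 1) * a powr p
        \<le> c powr (p - 1) * ((a - b) powr p / c powr (p - 1) + b powr p / \<theta> powr (p - 1))"
      by (intro mult_left_mono) auto
    also have "\<dots> = (a - b) powr p + c powr (p - 1) * b powr p / \<theta> powr (p - 1)"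
      using c by (simp add: distrib_left)
    finally show ?thesis unfolding lhs using True by (simp add: c_def)
  next
    case False
    have "a powr p \<le> b powr p" using False nn p by (intro powr_mono2) auto
    also have "\<dots> \<le> b powr p / \<theta> powr (p - 1)"
      using \<theta> p powr_le_one_le[of \<theta>] by (simp add: le_divide_eq_1 field_simps mult_left_le powr_le1)
    finally have "(1 - \<theta>) powr (p - 1) * a powr p \<le> (1 - \<theta>) powr (p - 1) * (b powr p / \<theta> powr (p - 1))"
      by (intro mult_left_mono) auto
    then show ?thesis unfolding lhs by (simp add: order_trans[OF _ powr_ge_zero])
  qed
qed simp

text \<open>Exchanging (a, U) with (b, W) changes the sign of both factors because \<open>J\<close>
  is odd, so W <= U may be assumed.\<close>

lemma picone:
  fixes p a b U W :: real
  assumes p: "1 < p" and nn: "0 \<le> a" "0 \<le> b" and UW: "0 < W" "0 < U"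
  shows "J p (U - W) * (a powr p / U powr (p - 1) - b powr p / W powr (p - 1)) \<le> \<bar>a - b\<bar> powr p"
proof (cases "W \<le> U")
  case True
  then show ?thesis using picone_aux[OF p nn UW(1) True] by (simp add: J_nonneg)
next
  case False
  have "J p (U - W) * (a powr p / U powr (p - 1) - b powr p / W powr (p - 1))
     = J p (W - U) * (b powr p / W powr (p - 1) - a powr p / U powr (p - 1))"
    using J_minus[of p "W - U"] by (simp add: algebra_simps)
  then show ?thesis
    using picone_aux[OF p nn(2,1) UW(2), of W] False by (simp add: J_nonneg abs_minus_commute)
qed

lemma powr_diff_le:
  fixes q x y B :: real
  assumes "1 \<le> q" "0 \<le> x" "0 \<le> y" "x \<le> B" "y \<le> B"
  shows "\<bar>x powr q - y powr q\<bar> \<le> q * B powr (q - 1) * \<bar>x - y\<bar>"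
proof (cases "q = 1")
  case True
  then show ?thesis using assms by (cases "B = 0") auto
next
  case False
  have *: "z powr q - w powr q \<le> q * B powr (q - 1) * (z - w)" if "0 \<le> w" "w \<le> z" "z \<le> B" for z w
  proof -
    have "z powr q + q * z powr (q - 1) * (w - z) \<le> w powr q"
      using powr_tangent_nonneg[of q w z] assms that False by simp
    moreover have "q * z powr (q - 1) * (z - w) \<le> q * B powr (q - 1) * (z - w)"
      using that assms by (intro mult_right_mono mult_left_mono powr_mono2) auto
    ultimately show ?thesis by (simp add: algebra_simps)
  qed
  show ?thesis
  proof (cases "y \<le> x")
    case True
    then show ?thesis using *[of y x] assms powr_mono2[of q y x] by simp
  next
    case False
    then show ?thesis using *[of x y] assms powr_mono2[of q x y] by simp
  qed
qed

text \<open>For fixed \<epsilon> > 0 the map t -> (t + \<epsilon>)^(1 - p) is Lipschitz on the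
  half-line with constant (p - 1) / \<epsilon>^p. Splitting into a change of the numerator and a
  change of the denominator shows that a Picone quotient has finite energy where both functions
  do.\<close>

lemma picone_test_lipschitz:
  fixes p a b u w \<epsilon> B :: real
  assumes p: "1 < p" and e: "0 < \<epsilon>" and ab: "0 \<le> a" "a \<le> B" "0 \<le> b" "b \<le> B" and uw: "0 \<le> u" "0 \<le> w"
  shows "\<bar>a powr p / (u + \<epsilon>) powr (p - 1) - b powr p / (w + \<epsilon>) powr (p - 1)\<bar>
    \<le> p * B powr (p - 1) / \<epsilon> powr (p - 1) * \<bar>a - b\<bar> + (p - 1) * B powr p / \<epsilon> powr p * \<bar>u - w\<bar>"
proof -
  have inv: "1 / (x + \<epsilon>) powr (p - 1) = (x + \<epsilon>) powr (1 - p)" for x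
    by (simp add: powr_diff powr_minus)
  have d: "\<bar>1 / (u + \<epsilon>) powr (p - 1) - 1 / (w + \<epsilon>) powr (p - 1)\<bar> \<le> (p - 1) / \<epsilon> powr p * \<bar>u - w\<bar>"
  proof -
    have "norm ((\<lambda>x. x powr (1 - p)) (u + \<epsilon>) - (\<lambda>x. x powr (1 - p)) (w + \<epsilon>)) \<le> (p - 1) / \<epsilon> powr p * norm ((u + \<epsilon>) - (w + \<epsilon>))"
    proof (rule field_differentiable_bound[where S = "{\<epsilon>..}"])
      fix z assume z: "z \<in> {\<epsilon>..}"
      then show "((\<lambda>x. x powr (1 - p)) has_field_derivative (1 - p) * z powr (- p)) (at z within {\<epsilon>..})"
        using e by (auto intro!: derivative_eq_intros)
      have "z powr (- p) \<le> \<epsilon> powr (- p)" using z e p by (intro powr_mono2') auto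
      then show "norm ((1 - p) * z powr - p) \<le> (p - 1) / \<epsilon> powr p"
        using p by (simp add: abs_mult powr_minus divide_inverse mult_left_mono)
    qed (use uw in auto)
    then show ?thesis unfolding inv by simp
  qed
  have "a powr p / (u + \<epsilon>) powr (p - 1) - b powr p / (w + \<epsilon>) powr (p - 1)
      = (a powr p - b powr p) * (1 / (u + \<epsilon>) powr (p - 1))
        + b powr p * (1 / (u + \<epsilon>) powr (p - 1) - 1 / (w + \<epsilon>) powr (p - 1))"
    by (simp add: algebra_simps diff_divide_distrib)
  also have "\<bar>\<dots>\<bar> \<le> \<bar>a powr p - b powr p\<bar> * (1 / (u + \<epsilon>) powr (p - 1))
        + b powr p * \<bar>1 / (u + \<epsilon>) powr (p - 1) - 1 / (w + \<epsilon>) powr (p - 1)\<bar>"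
    by (rule order_trans[OF abs_triangle_ineq]) (simp add: abs_mult)
  also have "\<dots> \<le> (p * B powr (p - 1) * \<bar>a - b\<bar>) * (1 / \<epsilon> powr (p - 1))
        + B powr p * ((p - 1) / \<epsilon> powr p * \<bar>u - w\<bar>)"
    using p e ab uw d
    by (intro add_mono mult_mono powr_diff_le divide_left_mono powr_mono2 mult_pos_pos) auto
  finally show ?thesis by (simp add: mult_ac)
qed

section \<open>The Gagliardo measure\<close>

lemma nn_integral_lborel_translate:
  fixes f :: "'a::euclidean_space \<Rightarrow> ennreal"
  assumes [measurable]: "f \<in> borel_measurable borel"
  shows "(\<integral>\<^sup>+x. f (c + x) \<partial>lborel) = (\<integral>\<^sup>+x. f x \<partial>lborel)"
proof -
  have "(\<integral>\<^sup>+x. f x \<partial>distr lborel borel ((+) c)) = (\<integral>\<^sup>+x. f (c + x) \<partial>lborel)"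
    by (rule nn_integral_distr) measurable
  then show ?thesis by (simp only: lborel_distr_plus)
qed

lemma lborel_distr_reflect:
  fixes c :: "'a::euclidean_space"
  shows "distr lborel borel (\<lambda>x. c - x) = lborel"
  using lborel_affine[of "-1" c] by (simp add: density_1)

lemma nn_integral_lborel_reflect:
  fixes f :: "'a::euclidean_space \<Rightarrow> ennreal"
  assumes [measurable]: "f \<in> borel_measurable borel"
  shows "(\<integral>\<^sup>+x. f (c - x) \<partial>lborel) = (\<integral>\<^sup>+x. f x \<partial>lborel)"
proof -
  have "(\<integral>\<^sup>+x. f x \<partial>distr lborel borel (\<lambda>x. c - x)) = (\<integral>\<^sup>+x. f (c - x) \<partial>lborel)"
    by (rule nn_integral_distr) measurable
  then show ?thesis by (simp only: lborel_distr_reflect)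
qed

lemma integral_lborel_reflect:
  fixes f :: "'a::euclidean_space \<Rightarrow> real"
  assumes [measurable]: "f \<in> borel_measurable borel"
  shows "(\<integral>x. f (c - x) \<partial>lborel) = (\<integral>x. f x \<partial>lborel)"
proof -
  have "(\<integral>x. f x \<partial>distr lborel borel (\<lambda>x. c - x)) = (\<integral>x. f (c - x) \<partial>lborel)"
    by (rule integral_distr) measurable
  then show ?thesis by (simp only: lborel_distr_reflect)
qed

text \<open>Putting the singular kernel into a measure turns the seminorm into an L^p norm of
  differences and the form into an ordinary integral, so Fatou, Fubini and integrability bounds
  apply directly. On the diagonal the density is 1 / 0 = 0.\<close>

definition gagliardo_measure :: "real \<Rightarrow> real \<Rightarrow> ('a::euclidean_space \<times> 'a) measure" where
  "gagliardo_measure s p =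
     density (lborel \<Otimes>\<^sub>M lborel) (\<lambda>(x, y). ennreal (1 / norm (x - y) powr (real DIM('a) + s * p)))"

lemma sets_gagliardo_measure [measurable_cong]:
  "sets (gagliardo_measure s p) = sets (borel \<Otimes>\<^sub>M borel)"
  unfolding gagliardo_measure_def sets_density by (rule sets_pair_measure_cong) simp_all

lemma space_gagliardo_measure [simp]: "space (gagliardo_measure s p) = UNIV"
  unfolding gagliardo_measure_def by (simp add: space_pair_measure)

lemma nn_integral_gagliardo_measure:
  fixes f :: "'a::euclidean_space \<times> 'a \<Rightarrow> ennreal"
  assumes [measurable]: "f \<in> borel_measurable (borel \<Otimes>\<^sub>M borel)"
  shows "(\<integral>\<^sup>+z. f z \<partial>gagliardo_measure s p) =
    (\<integral>\<^sup>+x. \<integral>\<^sup>+y. ennreal (1 / norm (x - y) powr (real DIM('a) + s * p)) * f (x, y) \<partial>lborel \<partial>lborel)"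
  unfolding gagliardo_measure_def
  by (subst nn_integral_density, simp_all add: lborel.nn_integral_fst[symmetric])

lemma gagliardo_pow_eq:
  fixes u :: "'a::euclidean_space \<Rightarrow> real"
  assumes [measurable]: "u \<in> borel_measurable borel"
  shows "gagliardo_pow s p UNIV u = (\<integral>\<^sup>+(x, y). ennreal (\<bar>u x - u y\<bar> powr p) \<partial>gagliardo_measure s p)"
proof -
  have "(\<integral>\<^sup>+(x, y). ennreal (\<bar>u x - u y\<bar> powr p) \<partial>gagliardo_measure s p)
    = (\<integral>\<^sup>+z. (case z of (x, y) \<Rightarrow> ennreal (1 / norm (x - y) powr (real DIM('a) + s * p))) *
        (case z of (x, y) \<Rightarrow> ennreal (\<bar>u x - u y\<bar> powr p)) \<partial>(lborel \<Otimes>\<^sub>M lborel))"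
    unfolding gagliardo_measure_def by (rule nn_integral_density) measurable
  then show ?thesis
    unfolding gagliardo_pow_def
    by (simp, intro nn_integral_cong) (auto simp: ennreal_mult[symmetric])
qed

lemma frac_plap_form_eq:
  fixes u \<phi> :: "'a::euclidean_space \<Rightarrow> real"
  assumes [measurable]: "u \<in> borel_measurable borel" "\<phi> \<in> borel_measurable borel"
  shows "frac_plap_form s p u \<phi> = (\<integral>(x, y). J p (u x - u y) * (\<phi> x - \<phi> y) \<partial>gagliardo_measure s p)"
proof -
  let ?k = "\<lambda>z :: 'a \<times> 'a. case z of (x, y) \<Rightarrow> 1 / norm (x - y) powr (real DIM('a) + s * p)"
  have "gagliardo_measure s p = density (lborel \<Otimes>\<^sub>M lborel) (\<lambda>z. ennreal (?k z))"
    unfolding gagliardo_measure_def by (rule arg_cong[where f = "density _"]) auto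
  then have "(\<integral>(x, y). J p (u x - u y) * (\<phi> x - \<phi> y) \<partial>gagliardo_measure s p)
    = (\<integral>z. ?k z *\<^sub>R (case z of (x, y) \<Rightarrow> J p (u x - u y) * (\<phi> x - \<phi> y)) \<partial>(lborel \<Otimes>\<^sub>M lborel))"
    by (simp only:) (rule integral_density, measurable, auto)
  then show ?thesis
    unfolding frac_plap_form_def
    by (simp only:) (intro Bochner_Integration.integral_cong, auto)
qed

lemma nn_integral_gagliardo_translate:
  fixes f :: "'a::euclidean_space \<times> 'a \<Rightarrow> ennreal"
  assumes [measurable]: "f \<in> borel_measurable (borel \<Otimes>\<^sub>M borel)"
  shows "(\<integral>\<^sup>+(x, y). f (c + x, c + y) \<partial>gagliardo_measure s p) = (\<integral>\<^sup>+z. f z \<partial>gagliardo_measure s p)"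
proof -
  let ?k = "\<lambda>x y :: 'a. ennreal (1 / norm (x - y) powr (real DIM('a) + s * p))"
  have "(\<integral>\<^sup>+(x, y). f (c + x, c + y) \<partial>gagliardo_measure s p)
      = (\<integral>\<^sup>+x. \<integral>\<^sup>+y. ?k (c + x) (c + y) * f (c + x, c + y) \<partial>lborel \<partial>lborel)"
    by (subst nn_integral_gagliardo_measure) simp_all
  also have "\<dots> = (\<integral>\<^sup>+x. \<integral>\<^sup>+y. ?k (c + x) y * f (c + x, y) \<partial>lborel \<partial>lborel)"
    by (intro nn_integral_cong nn_integral_lborel_translate[where f = "\<lambda>y. ?k (c + _) y * f (c + _, y)"]) measurable
  also have "\<dots> = (\<integral>\<^sup>+x. \<integral>\<^sup>+y. ?k x y * f (x, y) \<partial>lborel \<partial>lborel)"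
    by (rule nn_integral_lborel_translate[where f = "\<lambda>x. \<integral>\<^sup>+y. ?k x y * f (x, y) \<partial>lborel"]) measurable
  finally show ?thesis by (subst nn_integral_gagliardo_measure) simp_all
qed

lemma nn_integral_gagliardo_swap:
  fixes f :: "'a::euclidean_space \<times> 'a \<Rightarrow> ennreal"
  assumes [measurable]: "f \<in> borel_measurable (borel \<Otimes>\<^sub>M borel)"
  shows "(\<integral>\<^sup>+(x, y). f (y, x) \<partial>gagliardo_measure s p) = (\<integral>\<^sup>+z. f z \<partial>gagliardo_measure s p)"
proof -
  let ?k = "\<lambda>x y :: 'a. ennreal (1 / norm (x - y) powr (real DIM('a) + s * p))"
  have "(\<integral>\<^sup>+(x, y). f (y, x) \<partial>gagliardo_measure s p) = (\<integral>\<^sup>+x. \<integral>\<^sup>+y. ?k x y * f (y, x) \<partial>lborel \<partial>lborel)"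
    by (subst nn_integral_gagliardo_measure) simp_all
  also have "\<dots> = (\<integral>\<^sup>+y. \<integral>\<^sup>+x. ?k x y * f (y, x) \<partial>lborel \<partial>lborel)"
    by (rule lborel_pair.Fubini'[symmetric]) measurable
  also have "\<dots> = (\<integral>\<^sup>+z. f z \<partial>gagliardo_measure s p)"
    by (subst nn_integral_gagliardo_measure) (simp_all add: norm_minus_commute)
  finally show ?thesis .
qed

text \<open>The measure is absolutely continuous with respect to the product Lebesgue measure, for
  which a null set times the whole space is null in either coordinate.\<close>

lemma AE_gagliardo_measure:
  assumes "AE x in lborel. P x"
  shows "AE z in gagliardo_measure s p. P (fst z) \<and> P (snd z)"
proof -
  obtain N where N: "N \<in> null_sets lborel" "{x. \<not> P x} \<subseteq> N"
    using assms by (auto simp: eventually_ae_filter)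
  have "N \<times> UNIV \<in> null_sets (lborel \<Otimes>\<^sub>M lborel)" "UNIV \<times> N \<in> null_sets (lborel \<Otimes>\<^sub>M lborel)"
    using N(1) by (auto simp: null_sets_def lborel.emeasure_pair_measure_Times)
  then have "AE z in lborel \<Otimes>\<^sub>M lborel. z \<notin> N \<times> UNIV" "AE z in lborel \<Otimes>\<^sub>M lborel. z \<notin> UNIV \<times> N"
    by (auto intro: AE_not_in)
  then have "AE z in lborel \<Otimes>\<^sub>M lborel. P (fst z) \<and> P (snd z)"
    by eventually_elim (use N(2) in auto)
  then show ?thesis
    unfolding gagliardo_measure_def by (subst AE_density) (auto elim: eventually_mono)
qed

text \<open>The majorant that remains when the difference of a bounded Lipschitz function is raised
  to the power p: near 0 it behaves like |z|^(p - N - s p), at infinity like |z|^(-N - s p).\<close>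

definition levy_kernel :: "real \<Rightarrow> real \<Rightarrow> 'a::euclidean_space \<Rightarrow> real" where
  "levy_kernel s p z = min 1 (norm z powr p) / norm z powr (real DIM('a) + s * p)"

lemma borel_measurable_levy_kernel [measurable]: "levy_kernel s p \<in> borel_measurable borel"
  unfolding levy_kernel_def by measurable

section \<open>Integrability of the Levy kernel and of the tail weight\<close>

lemma emeasure_ball_le:
  fixes r :: real
  assumes "0 \<le> r"
  shows "emeasure lborel (ball (0::'a::euclidean_space) r)
    = ennreal (r powr real DIM('a) * measure lborel (ball (0::'a) 1))"
proof (cases "r = 0")
  case False
  have "emeasure lborel (ball (0::'a) r) = ennreal (measure lborel (ball (0::'a) r))"
    using emeasure_bounded_finite[of "ball (0::'a) r"] by (intro emeasure_eq_ennreal_measure) auto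
  then show ?thesis
    using content_ball_conv_unit_ball[OF assms, of "0::'a"] assms False by (simp add: powr_realpow)
qed simp

lemma ball_borel [measurable]: "ball (a::'a::euclidean_space) r \<in> sets borel"
  by (rule borel_open) simp

text \<open>Overlapping balls replace annuli: the integral of the sum is the series of a_k r_k^N
  times the volume of the unit ball, dominated by a geometric series of ratio 2^(-q).\<close>

lemma nn_integral_dyadic_balls_finite:
  fixes c q :: real and r a :: "nat \<Rightarrow> real"
  assumes c: "0 \<le> c" and q: "0 < q"
    and r: "\<And>k. 0 \<le> r k" and a: "\<And>k. 0 \<le> a k"
    and le: "\<And>k::nat. a k * r k powr real DIM('a) \<le> c * 2 powr (- q * k)"
  shows "(\<integral>\<^sup>+z. (\<Sum>k. ennreal (a k) * indicator (ball (0::'a::euclidean_space) (r k)) z) \<partial>lborel) < \<infinity>"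
proof -
  define V where "V = measure lborel (ball (0::'a) 1)"
  have V: "0 \<le> V" by (simp add: V_def)
  have "(\<integral>\<^sup>+z. (\<Sum>k. ennreal (a k) * indicator (ball (0::'a) (r k)) z) \<partial>lborel)
      = (\<Sum>k. ennreal (a k) * emeasure lborel (ball (0::'a) (r k)))"
    by (subst nn_integral_suminf) (auto simp: nn_integral_cmult_indicator)
  also have "\<dots> \<le> (\<Sum>k. ennreal (c * V * (2 powr (- q)) ^ k))"
  proof (intro suminf_le allI)
    fix k
    have "ennreal (a k) * emeasure lborel (ball (0::'a) (r k)) = ennreal (a k * r k powr real DIM('a) * V)"
      using emeasure_ball_le[OF r[of k], where 'a='a] a[of k] V by (simp add: V_def ennreal_mult[symmetric] mult.assoc)
    also have "\<dots> \<le> ennreal (c * 2 powr (- q * k) * V)"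
      using le[of k] V by (intro ennreal_leI mult_right_mono) auto
    also have "c * 2 powr (- q * k) * V = c * V * (2 powr (- q)) ^ k"
      by (simp add: powr_power mult_ac)
    finally show "ennreal (a k) * emeasure lborel (ball (0::'a) (r k)) \<le> ennreal (c * V * (2 powr (- q)) ^ k)" .
  qed auto
  also have "\<dots> < \<infinity>"
  proof -
    have "(2::real) powr (- q) < 1" using q powr_less_mono[of "- q" 0 2] by simp
    then have "summable (\<lambda>k. c * V * (2 powr (- q)) ^ k)"
      by (intro summable_mult summable_geometric) simp
    then show ?thesis
      using c V by (subst suminf_ennreal2) auto
  qed
  finally show ?thesis .
qed

lemma ennreal_term_le_suminf:
  fixes f :: "nat \<Rightarrow> ennreal"
  shows "f k \<le> (\<Sum>k. f k)"
  using sum_le_suminf[of f "{k}"] by simp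

lemma nn_integral_levy_kernel_finite:
  fixes s p :: real
  assumes p: "1 < p" and s: "0 < s" "s < 1"
  shows "(\<integral>\<^sup>+z. ennreal (levy_kernel s p (z::'a::euclidean_space)) \<partial>lborel) < \<infinity>"
proof -
  define N where "N = real DIM('a)"
  have N: "0 \<le> N" by (simp add: N_def)
  have sp: "0 < s * p" "s * p < p" using assms by auto
  \<comment> \<open>\<open>f\<close> dominates the kernel for |z| >= 1, where 2^k <= |z| < 2^(k +
    1), and its series decays like 2^(-s p k); \<open>g\<close> dominates it for 0 < |z| < 1, with
    decay 2^(-(p - s p) k). Both rates are positive since 0 < s < 1.\<close>
  define f where "f z = (\<Sum>k::nat. ennreal (2 powr (- (N + s * p) * k)) * indicator (ball (0::'a) (2 powr (real k + 1))) z)" for z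
  define g where "g z = (\<Sum>k::nat. ennreal (2 powr (N + s * p) * 2 powr ((N + s * p - p) * k)) * indicator (ball (0::'a) (2 powr (1 - real k))) z)" for z
  have [measurable]: "f \<in> borel_measurable borel" "g \<in> borel_measurable borel"
    unfolding f_def g_def by measurable
  have 1: "(\<integral>\<^sup>+z. f z \<partial>lborel) < \<infinity>"
    unfolding f_def
  proof (rule nn_integral_dyadic_balls_finite[where c = "2 powr N" and q = "s * p"])
    fix k :: nat
    show "2 powr (- (N + s * p) * k) * (2 powr (real k + 1)) powr real DIM('a) \<le> 2 powr N * 2 powr (- (s * p) * k)"
      unfolding N_def[symmetric] powr_powr powr_add[symmetric]
      by (intro powr_mono) (simp_all add: algebra_simps)
  qed (use sp in auto)
  have 2: "(\<integral>\<^sup>+z. g z \<partial>lborel) < \<infinity>"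
    unfolding g_def
  proof (rule nn_integral_dyadic_balls_finite[where c = "2 powr (N + N + s * p)" and q = "p - s * p"])
    fix k :: nat
    show "2 powr (N + s * p) * 2 powr ((N + s * p - p) * k) * (2 powr (1 - real k)) powr real DIM('a)
        \<le> 2 powr (N + N + s * p) * 2 powr (- (p - s * p) * k)"
      unfolding N_def[symmetric] powr_powr powr_add[symmetric]
      by (intro powr_mono) (simp_all add: algebra_simps)
  qed (use sp in auto)
  have "ennreal (levy_kernel s p z) \<le> f z + g z" for z :: 'a
  proof (cases "z = 0")
    case False
    define r where "r = norm z"
    have r: "0 < r" using False by (simp add: r_def)
    show ?thesis
    proof (cases "1 \<le> r")
      case True
      define k where "k = nat \<lfloor>log 2 r\<rfloor>"
      have k: "real k \<le> log 2 r" "log 2 r < k + 1"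
        using True unfolding k_def by (auto simp: of_nat_nat) linarith+
      have "2 powr k \<le> r" "r < 2 powr (real k + 1)"
        using k r by (auto simp: le_log_iff log_less_iff add.commute)
      then have "r powr - (N + s * p) \<le> (2 powr k) powr - (N + s * p)"
        using N sp r by (intro powr_mono2') auto
      moreover have "levy_kernel s p z \<le> r powr - (N + s * p)"
        unfolding levy_kernel_def N_def[symmetric] r_def[symmetric] powr_minus divide_inverse
        using mult_right_mono[of "min 1 (r powr p)" 1 "inverse (r powr (N + s * p))"] by simp
      ultimately have "ennreal (levy_kernel s p z) \<le> ennreal (2 powr (- (N + s * p) * k))"
        by (intro ennreal_leI) (simp add: powr_powr mult.commute)
      also have "\<dots> = ennreal (2 powr (- (N + s * p) * k)) * indicator (ball (0::'a) (2 powr (real k + 1))) z"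
        using \<open>r < 2 powr (real k + 1)\<close> by (simp add: r_def)
      also have "\<dots> \<le> f z" unfolding f_def by (rule ennreal_term_le_suminf)
      finally show ?thesis by (simp add: add_increasing2)
    next
      case False
      define q where "q = 1 / r"
      define k where "k = nat \<lfloor>log 2 q\<rfloor>"
      have q: "1 < q" using False r by (simp add: q_def)
      then have "0 < log 2 q" by simp
      then have k: "real k \<le> log 2 q" "log 2 q < k + 1"
        unfolding k_def by (auto simp: of_nat_nat) linarith+
      have "2 powr k \<le> q" "q < 2 powr (real k + 1)"
        using k q by (auto simp: le_log_iff log_less_iff add.commute)
      \<comment> \<open>Here |z| may equal 2^(-k), while the balls are open; this is why
        \<open>g\<close> uses the radius 2^(1 - k).\<close>
      then have rk: "r \<le> 2 powr (- real k)" "2 powr (- real k) < 2 * r"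
        using r by (auto simp: q_def powr_minus powr_add field_simps)
      have "levy_kernel s p z \<le> r powr p / r powr (N + s * p)"
        unfolding levy_kernel_def N_def[symmetric] r_def[symmetric]
        by (intro divide_right_mono) auto
      also have "\<dots> \<le> (2 powr (- real k)) powr p / (2 powr (- real k) / 2) powr (N + s * p)"
        using rk r p N sp by (intro frac_le powr_mono2) auto
      also have "\<dots> = 2 powr (N + s * p) * 2 powr ((N + s * p - p) * k)"
      proof -
        have half: "2 powr (- real k) / 2 = 2 powr (- real k - 1)"
          by (simp add: powr_diff)
        show ?thesis
          unfolding half powr_powr powr_diff[symmetric] powr_add[symmetric]
          by (rule arg_cong[where f = "(powr) 2"]) (simp add: algebra_simps)
      qed
      finally have "ennreal (levy_kernel s p z) \<le> ennreal (2 powr (N + s * p) * 2 powr ((N + s * p - p) * k))"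
        by (intro ennreal_leI)
      also have "\<dots> = ennreal (2 powr (N + s * p) * 2 powr ((N + s * p - p) * k)) * indicator (ball (0::'a) (2 powr (1 - real k))) z"
      proof -
        have "r < 2 powr (1 - real k)"
          by (rule le_less_trans[OF rk(1) powr_less_mono]) auto
        then show ?thesis by (simp add: r_def)
      qed
      also have "\<dots> \<le> g z" unfolding g_def by (rule ennreal_term_le_suminf)
      finally show ?thesis by (simp add: add_increasing)
    qed
  qed (simp add: levy_kernel_def)
  then have "(\<integral>\<^sup>+z. ennreal (levy_kernel s p (z::'a)) \<partial>lborel) \<le> (\<integral>\<^sup>+z. f z + g z \<partial>lborel)"
    by (intro nn_integral_mono) auto
  also have "\<dots> = (\<integral>\<^sup>+z. f z \<partial>lborel) + (\<integral>\<^sup>+z. g z \<partial>lborel)"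
    by (intro nn_integral_add) auto
  also have "\<dots> < \<infinity>" using 1 2 by simp
  finally show ?thesis .
qed

text \<open>Besides being the weight of the tail space, it is the density of the finite measure
  behind the source term.\<close>

definition tail_weight :: "real \<Rightarrow> real \<Rightarrow> 'a::euclidean_space \<Rightarrow> real" where
  "tail_weight s p x = 1 / (1 + norm x) powr (real DIM('a) + s * p)"

lemma tail_weight_pos: "0 < tail_weight s p x"
proof -
  have "1 + norm x \<noteq> 0" using norm_ge_zero[of x] by linarith
  then show ?thesis by (simp add: tail_weight_def)
qed

lemma tail_weight_le_1:
  fixes x :: "'a::euclidean_space"
  assumes "0 < s" "0 < p"
  shows "tail_weight s p x \<le> 1"
proof -
  have "1 \<le> (1 + norm x) powr (real DIM('a) + s * p)"
    using assms by (intro ge_one_powr_ge_zero) auto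
  then show ?thesis by (simp add: tail_weight_def divide_le_eq_1)
qed

lemma borel_measurable_tail_weight [measurable]: "tail_weight s p \<in> borel_measurable borel"
  unfolding tail_weight_def by measurable

lemma nn_integral_tail_weight_finite:
  fixes s p :: real
  assumes p: "1 < p" and s: "0 < s" "s < 1"
  shows "(\<integral>\<^sup>+z. ennreal (tail_weight s p (z::'a::euclidean_space)) \<partial>lborel) < \<infinity>"
proof -
  \<comment> \<open>The weight is at most 1 on the unit ball; outside, the factor min(1, |z|^p) is 1
    and the weight lies below the Levy kernel.\<close>
  have "ennreal (tail_weight s p z) \<le> indicator (ball 0 1) z + ennreal (levy_kernel s p z)" for z :: 'a
  proof (cases "norm z < 1")
    case True
    then show ?thesis
      using tail_weight_le_1[of s p z] p s by (simp add: add_increasing2)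
  next
    case False
    then have "1 \<le> norm z powr p" using p by (intro ge_one_powr_ge_zero) auto
    moreover have "norm z powr (real DIM('a) + s * p) \<le> (1 + norm z) powr (real DIM('a) + s * p)"
      using p s by (intro powr_mono2) auto
    ultimately have "tail_weight s p z \<le> levy_kernel s p z"
      using False unfolding tail_weight_def levy_kernel_def
      by (intro frac_le) (auto simp: not_less)
    then show ?thesis by (simp add: add_increasing ennreal_leI)
  qed
  then have "(\<integral>\<^sup>+z. ennreal (tail_weight s p (z::'a)) \<partial>lborel)
      \<le> (\<integral>\<^sup>+z. indicator (ball 0 1) z + ennreal (levy_kernel s p (z::'a)) \<partial>lborel)"
    by (intro nn_integral_mono) auto
  also have "\<dots> = emeasure lborel (ball (0::'a) 1) + (\<integral>\<^sup>+z. ennreal (levy_kernel s p (z::'a)) \<partial>lborel)"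
    by (subst nn_integral_add) auto
  also have "\<dots> < \<infinity>"
    using nn_integral_levy_kernel_finite[OF assms, where 'a='a] emeasure_bounded_finite[of "ball (0::'a) 1"] by simp
  finally show ?thesis .
qed

text \<open>For fixed x in K the integral over y sees only x - y and equals the integral of the Levy
  kernel; what remains is the volume of K. The energy of a function supported in K involves only
  pairs that meet K, so this is its natural majorant.\<close>

lemma gagliardo_near_finite:
  fixes K :: "'a::euclidean_space set"
  assumes p: "1 < p" and s: "0 < s" "s < 1" and K [measurable]: "K \<in> sets borel" and b: "bounded K"
  shows "(\<integral>\<^sup>+(x, y). ennreal ((indicator K x + indicator K y) * min 1 (norm (x - y) powr p)) \<partial>gagliardo_measure s p) < \<infinity>"
proof -
  let ?f = "\<lambda>(x, y). ennreal (indicator K x * min 1 (norm (x - y) powr p))"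
  have "(\<integral>\<^sup>+z. ?f z \<partial>gagliardo_measure s p) = (\<integral>\<^sup>+x. \<integral>\<^sup>+y. indicator K x * ennreal (levy_kernel s p (x - y)) \<partial>lborel \<partial>lborel)"
    by (subst nn_integral_gagliardo_measure)
       (auto intro!: nn_integral_cong simp: levy_kernel_def ennreal_mult[symmetric] split: split_indicator)
  also have "\<dots> = (\<integral>\<^sup>+x. indicator K x * (\<integral>\<^sup>+z. ennreal (levy_kernel s p (z::'a)) \<partial>lborel) \<partial>lborel)"
    by (subst nn_integral_cmult, measurable)
       (simp add: nn_integral_lborel_reflect[where f = "\<lambda>z. ennreal (levy_kernel s p z)"])
  also have "\<dots> = emeasure lborel K * (\<integral>\<^sup>+z. ennreal (levy_kernel s p (z::'a)) \<partial>lborel)"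
    by (subst nn_integral_multc) auto
  also have "\<dots> < \<infinity>"
    using nn_integral_levy_kernel_finite[OF p s, where 'a='a] emeasure_bounded_finite[OF b]
    by (simp add: ennreal_mult_less_top)
  finally have fin: "(\<integral>\<^sup>+z. ?f z \<partial>gagliardo_measure s p) < \<infinity>" .
  have swap: "(\<integral>\<^sup>+(x, y). ?f (y, x) \<partial>gagliardo_measure s p) = (\<integral>\<^sup>+z. ?f z \<partial>gagliardo_measure s p)"
    by (rule nn_integral_gagliardo_swap) measurable
  have "(\<integral>\<^sup>+(x, y). ennreal ((indicator K x + indicator K y) * min 1 (norm (x - y) powr p)) \<partial>gagliardo_measure s p)
      = (\<integral>\<^sup>+z. ?f z + (case z of (x, y) \<Rightarrow> ?f (y, x)) \<partial>gagliardo_measure s p)"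
    by (intro nn_integral_cong)
       (auto simp: ennreal_plus[symmetric] norm_minus_commute algebra_simps simp del: ennreal_plus split: split_indicator)
  also have "\<dots> = (\<integral>\<^sup>+z. ?f z \<partial>gagliardo_measure s p) + (\<integral>\<^sup>+(x, y). ?f (y, x) \<partial>gagliardo_measure s p)"
    by (rule nn_integral_add) measurable
  finally show ?thesis using fin swap by simp
qed

section \<open>Test functions\<close>

definition dq :: "('a \<Rightarrow> real) \<Rightarrow> 'a \<times> 'a \<Rightarrow> real" where
  "dq u z = u (fst z) - u (snd z)"

lemma borel_measurable_dq [measurable]:
  fixes u :: "'a::euclidean_space \<Rightarrow> real"
  assumes [measurable]: "u \<in> borel_measurable borel"
  shows "dq u \<in> borel_measurable (borel \<Otimes>\<^sub>M borel)"
  unfolding dq_def by measurable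

definition hardy_measure :: "real \<Rightarrow> real \<Rightarrow> 'a::euclidean_space set \<Rightarrow> 'a measure" where
  "hardy_measure s p \<Omega> =
     density lborel (\<lambda>x. ennreal (indicator \<Omega> x / dist_bdry \<Omega> x powr (s * p)))"

lemma sets_hardy_measure [measurable_cong, simp]: "sets (hardy_measure s p \<Omega>) = sets borel"
  by (simp add: hardy_measure_def)

text \<open>Representatives vanish everywhere off a compact subset of \<Omega>, not just almost
  everywhere: sums, multiples, power means and Picone quotients then stay in the class by pointwise
  arguments. The translation to and from essential supports is made separately.\<close>

definition test_class :: "real \<Rightarrow> real \<Rightarrow> 'a::euclidean_space set \<Rightarrow> ('a \<Rightarrow> real) set" where
  "test_class s p \<Omega> = {\<phi> \<in> borel_measurable borel.
     (\<exists>K. compact K \<and> K \<subseteq> \<Omega> \<and> (\<forall>x. x \<notin> K \<longrightarrow> \<phi> x = 0)) \<and>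
     integrable lborel (\<lambda>x. \<bar>\<phi> x\<bar> powr p) \<and>
     integrable (gagliardo_measure s p) (\<lambda>z. \<bar>dq \<phi> z\<bar> powr p)}"

section \<open>Closure properties of test functions\<close>

lemma integrable_powr_abs_iff:
  fixes f :: "'b \<Rightarrow> real"
  assumes "f \<in> borel_measurable M"
  shows "integrable M (\<lambda>x. \<bar>f x\<bar> powr p) \<longleftrightarrow> (\<integral>\<^sup>+x. ennreal (\<bar>f x\<bar> powr p) \<partial>M) < \<infinity>"
  using assms by (simp add: integrable_iff_bounded)

lemma integrable_powr_add:
  fixes f g :: "'b \<Rightarrow> real"
  assumes "0 \<le> p" and [measurable]: "f \<in> borel_measurable M" "g \<in> borel_measurable M"
    and "integrable M (\<lambda>x. \<bar>f x\<bar> powr p)" "integrable M (\<lambda>x. \<bar>g x\<bar> powr p)"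
  shows "integrable M (\<lambda>x. \<bar>f x + g x\<bar> powr p)"
proof (rule Bochner_Integration.integrable_bound)
  show "integrable M (\<lambda>x. 2 powr p * (\<bar>f x\<bar> powr p + \<bar>g x\<bar> powr p))"
    using assms by (intro integrable_mult_right Bochner_Integration.integrable_add)
  show "AE x in M. norm (\<bar>f x + g x\<bar> powr p) \<le> norm (2 powr p * (\<bar>f x\<bar> powr p + \<bar>g x\<bar> powr p))"
    using abs_add_powr_le[OF assms(1)] by (auto simp: abs_mult intro!: AE_I2)
qed measurable

lemma integrable_powr_cmult:
  fixes f :: "'b \<Rightarrow> real"
  assumes "integrable M (\<lambda>x. \<bar>f x\<bar> powr p)"
  shows "integrable M (\<lambda>x. \<bar>c * f x\<bar> powr p)"
  using assms by (simp add: abs_mult powr_mult)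

lemma integrable_J_mult:
  fixes f g :: "'b \<Rightarrow> real"
  assumes p: "1 < p" and [measurable]: "f \<in> borel_measurable M" "g \<in> borel_measurable M"
    and "integrable M (\<lambda>x. \<bar>f x\<bar> powr p)" "integrable M (\<lambda>x. \<bar>g x\<bar> powr p)"
  shows "integrable M (\<lambda>x. J p (f x) * g x)"
proof (rule Bochner_Integration.integrable_bound)
  show "integrable M (\<lambda>x. \<bar>f x\<bar> powr p + \<bar>g x\<bar> powr p)"
    using assms by (intro Bochner_Integration.integrable_add)
  show "AE x in M. norm (J p (f x) * g x) \<le> norm (\<bar>f x\<bar> powr p + \<bar>g x\<bar> powr p)"
    using J_young[OF p, of 1] by (auto intro!: AE_I2)
qed measurable

lemma test_classD:
  assumes "\<phi> \<in> test_class s p \<Omega>"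
  shows "\<phi> \<in> borel_measurable borel" "integrable lborel (\<lambda>x. \<bar>\<phi> x\<bar> powr p)"
    "integrable (gagliardo_measure s p) (\<lambda>z. \<bar>dq \<phi> z\<bar> powr p)"
  using assms by (auto simp: test_class_def)

lemma test_class_support:
  assumes "\<phi> \<in> test_class s p \<Omega>"
  obtains K where "compact K" "K \<subseteq> \<Omega>" "\<And>x. x \<notin> K \<Longrightarrow> \<phi> x = 0"
  using assms by (auto simp: test_class_def)

lemma test_class_zero: "(\<lambda>x. 0) \<in> test_class s p \<Omega>"
  by (auto simp: test_class_def dq_def intro!: exI[of _ "{}"])

lemma test_class_cmult:
  assumes "\<phi> \<in> test_class s p \<Omega>"
  shows "(\<lambda>x. c * \<phi> x) \<in> test_class s p \<Omega>"
proof -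
  note [measurable] = test_classD(1)[OF assms]
  have "dq (\<lambda>x. c * \<phi> x) z = c * dq \<phi> z" for z by (simp add: dq_def algebra_simps)
  then show ?thesis
    using test_classD(2,3)[OF assms, THEN integrable_powr_cmult, of c] assms
    by (auto simp: test_class_def)
qed

lemma test_class_add:
  assumes "0 \<le> p" "\<phi> \<in> test_class s p \<Omega>" "\<psi> \<in> test_class s p \<Omega>"
  shows "(\<lambda>x. \<phi> x + \<psi> x) \<in> test_class s p \<Omega>"
proof -
  note [measurable] = test_classD(1)[OF assms(2)] test_classD(1)[OF assms(3)]
  obtain K L where "compact K" "K \<subseteq> \<Omega>" "\<And>x. x \<notin> K \<Longrightarrow> \<phi> x = 0"
    "compact L" "L \<subseteq> \<Omega>" "\<And>x. x \<notin> L \<Longrightarrow> \<psi> x = 0"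
    using assms by (metis test_class_support)
  then have "\<exists>K. compact K \<and> K \<subseteq> \<Omega> \<and> (\<forall>x. x \<notin> K \<longrightarrow> \<phi> x + \<psi> x = 0)"
    by (intro exI[of _ "K \<union> L"]) auto
  moreover have "integrable lborel (\<lambda>x. \<bar>\<phi> x + \<psi> x\<bar> powr p)"
    using assms by (intro integrable_powr_add test_classD) (auto intro: test_classD)
  moreover have "integrable (gagliardo_measure s p) (\<lambda>z. \<bar>dq \<phi> z + dq \<psi> z\<bar> powr p)"
    using assms by (intro integrable_powr_add test_classD) (auto intro: test_classD)
  moreover have "dq (\<lambda>x. \<phi> x + \<psi> x) z = dq \<phi> z + dq \<psi> z" for z by (simp add: dq_def)
  ultimately show ?thesis by (simp add: test_class_def)
qed

lemma dq_pmean_le: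
  assumes "1 < p" "\<And>x. 0 \<le> u x" "\<And>x. 0 \<le> w x"
  shows "\<bar>dq (\<lambda>x. pmean p (u x) (w x)) z\<bar> powr p \<le> (\<bar>dq u z\<bar> powr p + \<bar>dq w z\<bar> powr p) / 2"
  unfolding dq_def using assms by (intro pmean_diff)

lemma test_class_pmean:
  assumes p: "1 < p" and uw: "u \<in> test_class s p \<Omega>" "w \<in> test_class s p \<Omega>"
    and nn: "\<And>x. 0 \<le> u x" "\<And>x. 0 \<le> w x"
  shows "(\<lambda>x. pmean p (u x) (w x)) \<in> test_class s p \<Omega>"
proof -
  note [measurable] = test_classD(1)[OF uw(1)] test_classD(1)[OF uw(2)]
  have [measurable]: "(\<lambda>x. pmean p (u x) (w x)) \<in> borel_measurable borel"
    unfolding pmean_def by measurable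
  obtain K L where "compact K" "K \<subseteq> \<Omega>" "\<And>x. x \<notin> K \<Longrightarrow> u x = 0"
    "compact L" "L \<subseteq> \<Omega>" "\<And>x. x \<notin> L \<Longrightarrow> w x = 0"
    using uw by (metis test_class_support)
  then have "\<exists>K. compact K \<and> K \<subseteq> \<Omega> \<and> (\<forall>x. x \<notin> K \<longrightarrow> pmean p (u x) (w x) = 0)"
    by (intro exI[of _ "K \<union> L"]) auto
  moreover have "integrable lborel (\<lambda>x. \<bar>pmean p (u x) (w x)\<bar> powr p)"
    using test_classD(2)[OF uw(1)] test_classD(2)[OF uw(2)] p nn by (simp add: pmean_powr)
  moreover have "integrable (gagliardo_measure s p) (\<lambda>z. \<bar>dq (\<lambda>x. pmean p (u x) (w x)) z\<bar> powr p)"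
  proof (rule Bochner_Integration.integrable_bound)
    show "integrable (gagliardo_measure s p) (\<lambda>z. (\<bar>dq u z\<bar> powr p + \<bar>dq w z\<bar> powr p) / 2)"
      using test_classD(3)[OF uw(1)] test_classD(3)[OF uw(2)] by simp
  qed (use dq_pmean_le[where u = u and w = w, OF p nn] in \<open>auto intro!: AE_I2\<close>)
  ultimately show ?thesis by (simp add: test_class_def)
qed

lemma gagliardo_pow_dq:
  assumes [measurable]: "u \<in> borel_measurable borel"
  shows "gagliardo_pow s p UNIV u = (\<integral>\<^sup>+z. ennreal (\<bar>dq u z\<bar> powr p) \<partial>gagliardo_measure s p)"
  by (simp add: gagliardo_pow_eq dq_def case_prod_beta')

lemma Sobolev_UNIV_iff:
  "\<phi> \<in> Sobolev s p UNIV \<longleftrightarrow> \<phi> \<in> borel_measurable borel \<and> integrable lborel (\<lambda>x. \<bar>\<phi> x\<bar> powr p)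
     \<and> integrable (gagliardo_measure s p) (\<lambda>z. \<bar>dq \<phi> z\<bar> powr p)"
proof (cases "\<phi> \<in> borel_measurable borel")
  case True
  note [measurable] = True
  show ?thesis
    by (subst (1 2) integrable_powr_abs_iff)
       (auto simp: Sobolev_def Leb_def set_borel_measurable_def gagliardo_pow_dq)
qed (auto simp: Sobolev_def Leb_def set_borel_measurable_def)

section \<open>Essential supports versus compact supports\<close>

lemma ess_support_subset:
  assumes "closed K" "\<And>x. x \<notin> K \<Longrightarrow> f x = 0"
  shows "ess_support f \<subseteq> K"
  using assms by (auto simp: ess_support_def intro!: exI[of _ "- K"])

lemma closed_ess_support: "closed (ess_support f)"
  unfolding ess_support_def by (intro closed_Compl open_Union) auto

text \<open>The defining union may be uncountable; by Lindelof's theorem countably many of its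
  members already cover it, and countably many null sets form a null set.\<close>

lemma AE_ess_support:
  fixes f :: "'a::euclidean_space \<Rightarrow> real"
  shows "AE x in lborel. x \<notin> ess_support f \<longrightarrow> f x = 0"
proof -
  define \<F> where "\<F> = {U. open U \<and> (AE x in lborel. x \<in> U \<longrightarrow> f x = 0)}"
  obtain \<G> where G: "\<G> \<subseteq> \<F>" "countable \<G>" "\<Union>\<G> = \<Union>\<F>"
    using Lindelof[of \<F>] by (auto simp: \<F>_def)
  have "AE x in lborel. \<forall>U\<in>\<G>. x \<in> U \<longrightarrow> f x = 0"
    using G by (subst AE_ball_countable) (auto simp: \<F>_def)
  then have "AE x in lborel. x \<in> \<Union>\<F> \<longrightarrow> f x = 0"
    by eventually_elim (auto simp: G(3)[symmetric])
  moreover have "ess_support f = - \<Union>\<F>" unfolding ess_support_def \<F>_def ..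
  ultimately show ?thesis by simp
qed

lemma test_class_imp_admissible:
  assumes "\<phi> \<in> test_class s p \<Omega>"
  shows "\<phi> \<in> Sobolev s p UNIV" "compact (ess_support \<phi>)" "ess_support \<phi> \<subseteq> \<Omega>"
proof -
  obtain K where K: "compact K" "K \<subseteq> \<Omega>" "\<And>x. x \<notin> K \<Longrightarrow> \<phi> x = 0"
    using assms by (metis test_class_support)
  then have sub: "ess_support \<phi> \<subseteq> K"
    by (intro ess_support_subset compact_imp_closed)
  show "compact (ess_support \<phi>)"
    using closed_ess_support compact_Int_closed[OF K(1)] sub by (metis inf.absorb_iff2)
  show "ess_support \<phi> \<subseteq> \<Omega>" using sub K by auto
  show "\<phi> \<in> Sobolev s p UNIV" using assms by (auto simp: Sobolev_UNIV_iff test_class_def)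
qed

text \<open>Cutting off to the essential support and taking the positive part changes the function
  only on a null set. Neither side of the weak inequality sees such a change, so testing with
  \<open>test_class\<close> suffices.\<close>

lemma admissible_AE_test_class:
  assumes \<phi>: "\<phi> \<in> Sobolev s p UNIV" and supp: "compact (ess_support \<phi>)" "ess_support \<phi> \<subseteq> \<Omega>"
    and nn: "AE x in lborel. 0 \<le> \<phi> x"
  obtains \<psi> where "\<psi> \<in> test_class s p \<Omega>" "AE x in lborel. \<phi> x = \<psi> x" "\<And>x. 0 \<le> \<psi> x"
proof -
  define K where "K = ess_support \<phi>"
  define \<psi> where "\<psi> x = indicator K x * max 0 (\<phi> x)" for x
  have K [measurable]: "K \<in> sets borel" using supp(1) by (auto simp: K_def borel_compact)
  have [measurable]: "\<phi> \<in> borel_measurable borel" using \<phi> by (simp add: Sobolev_UNIV_iff)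
  have [measurable]: "\<psi> \<in> borel_measurable borel" unfolding \<psi>_def by measurable
  have AE: "AE x in lborel. \<phi> x = \<psi> x"
    using AE_ess_support[of \<phi>] nn
    by eventually_elim (auto simp: \<psi>_def K_def split: split_indicator)
  have "AE z in gagliardo_measure s p. dq \<phi> z = dq \<psi> z"
    using AE_gagliardo_measure[OF AE] by eventually_elim (simp add: dq_def)
  then have 1: "AE z in gagliardo_measure s p. \<bar>dq \<phi> z\<bar> powr p = \<bar>dq \<psi> z\<bar> powr p"
    by eventually_elim simp
  have 2: "AE x in lborel. \<bar>\<phi> x\<bar> powr p = \<bar>\<psi> x\<bar> powr p"
    using AE by eventually_elim simp
  have "integrable (gagliardo_measure s p) (\<lambda>z. \<bar>dq \<psi> z\<bar> powr p)" "integrable lborel (\<lambda>x. \<bar>\<psi> x\<bar> powr p)"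
    using integrable_cong_AE[THEN iffD1, OF _ _ 1] integrable_cong_AE[THEN iffD1, OF _ _ 2] \<phi>
    by (simp_all add: Sobolev_UNIV_iff)
  moreover have "\<forall>x. x \<notin> K \<longrightarrow> \<psi> x = 0" by (simp add: \<psi>_def)
  ultimately have "\<psi> \<in> test_class s p \<Omega>"
    using supp by (auto simp: test_class_def K_def)
  moreover have "0 \<le> \<psi> x" for x by (simp add: \<psi>_def)
  ultimately show ?thesis using AE that by blast
qed

lemma compact_neighbourhood:
  fixes K :: "'a::euclidean_space set"
  assumes "compact K" "open \<Omega>" "K \<subseteq> \<Omega>"
  obtains \<delta> where "0 < \<delta>" "compact (\<Union>x\<in>K. cball x \<delta>)" "(\<Union>x\<in>K. cball x \<delta>) \<subseteq> \<Omega>"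
  using compact_subset_open_imp_cball_epsilon_subset[OF assms] compact_minkowski_sum_cball[OF assms(1)]
  by metis

lemma min_one_powr:
  fixes r p :: real
  assumes "0 \<le> r" "0 < p"
  shows "(min 1 r) powr p = min 1 (r powr p)"
proof (cases "r \<le> 1")
  case True
  then show ?thesis using assms powr_le1[of p r] by simp
next
  case False
  then show ?thesis using assms ge_one_powr_ge_zero[of r p] by simp
qed

lemma integrable_near:
  fixes K :: "'a::euclidean_space set"
  assumes p: "1 < p" and s: "0 < s" "s < 1" and K: "compact K"
  shows "integrable (gagliardo_measure s p)
    (\<lambda>z. (indicator K (fst z) + indicator K (snd z)) * min 1 (norm (fst z - snd z) powr p))"
proof -
  have [measurable]: "K \<in> sets borel" using K by (rule borel_compact)
  show ?thesis
    using gagliardo_near_finite[OF p s _ compact_imp_bounded[OF K]]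
    by (intro integrableI_nonneg) (auto simp: case_prod_beta' intro!: AE_I2)
qed

lemma integrable_powr_bounded_support:
  fixes f :: "'a::euclidean_space \<Rightarrow> real"
  assumes p: "0 \<le> p" and K: "compact K" "\<And>x. x \<notin> K \<Longrightarrow> f x = 0"
    and B: "\<And>x. \<bar>f x\<bar> \<le> B" and [measurable]: "f \<in> borel_measurable borel"
  shows "integrable lborel (\<lambda>x. \<bar>f x\<bar> powr p)"
proof (rule Bochner_Integration.integrable_bound)
  show "integrable lborel (\<lambda>x. B powr p * indicator K x)"
    using emeasure_bounded_finite[OF compact_imp_bounded[OF K(1)]] borel_compact[OF K(1)] by simp
  show "AE x in lborel. norm (\<bar>f x\<bar> powr p) \<le> norm (B powr p * indicator K x)"
    using B K(2) p by (auto intro!: AE_I2 powr_mono2 split: split_indicator)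
qed measurable

text \<open>A bounded Lipschitz function satisfies |\<eta>(x) - \<eta>(y)| <= C min(1, |x - y|),
  where C is the larger of the Lipschitz constant and twice the bound. The difference is 0 unless
  the pair meets K, so the integrand of \<open>integrable_near\<close> dominates.\<close>

lemma test_class_lipschitz:
  fixes \<eta> :: "'a::euclidean_space \<Rightarrow> real"
  assumes p: "1 < p" and s: "0 < s" "s < 1"
    and K: "compact K" "K \<subseteq> \<Omega>" "\<And>x. x \<notin> K \<Longrightarrow> \<eta> x = 0"
    and L: "\<And>x y. \<bar>\<eta> x - \<eta> y\<bar> \<le> L * norm (x - y)"
    and B: "\<And>x. \<bar>\<eta> x\<bar> \<le> B"
  shows "\<eta> \<in> test_class s p \<Omega>"
proof -
  have [measurable]: "K \<in> sets borel" using K(1) by (rule borel_compact)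
  have "continuous_on UNIV \<eta>"
    using order_trans[OF L mult_right_mono[OF abs_ge_self norm_ge_zero]]
    by (intro lipschitz_on_continuous_on[where L = "\<bar>L\<bar>"] lipschitz_onI) (auto simp: dist_norm)
  then have [measurable]: "\<eta> \<in> borel_measurable borel" by (rule borel_measurable_continuous_onI)
  have B0: "0 \<le> B" using B[of 0] by linarith
  define C where "C = max \<bar>L\<bar> (2 * B)"
  have C: "0 \<le> C" by (simp add: C_def)
  have le: "\<bar>dq \<eta> z\<bar> powr p \<le> C powr p * ((indicator K (fst z) + indicator K (snd z)) * min 1 (norm (fst z - snd z) powr p))" for z
  proof (cases "fst z \<in> K \<or> snd z \<in> K")
    case True
    let ?r = "norm (fst z - snd z)"
    have "\<bar>dq \<eta> z\<bar> \<le> C * ?r"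
    proof -
      have "L \<le> C" by (simp add: C_def)
      then have "L * ?r \<le> C * ?r" by (intro mult_right_mono) auto
      then show ?thesis using L[of "fst z" "snd z"] by (simp add: dq_def)
    qed
    moreover have "\<bar>dq \<eta> z\<bar> \<le> C"
      using B[of "fst z"] B[of "snd z"] unfolding dq_def C_def by linarith
    ultimately have "\<bar>dq \<eta> z\<bar> \<le> C * min 1 ?r" using C by (simp add: min_def)
    then have "\<bar>dq \<eta> z\<bar> powr p \<le> (C * min 1 ?r) powr p"
      using p by (intro powr_mono2) auto
    also have "\<dots> = C powr p * min 1 (?r powr p)"
      using C p by (simp add: powr_mult min_one_powr)
    also have "\<dots> \<le> C powr p * ((indicator K (fst z) + indicator K (snd z)) * min 1 (?r powr p))"
    proof (intro mult_left_mono)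
      have "1 * min 1 (?r powr p) \<le> (indicator K (fst z) + indicator K (snd z)) * min 1 (?r powr p)"
        using True by (intro mult_right_mono) (auto split: split_indicator)
      then show "min 1 (?r powr p) \<le> (indicator K (fst z) + indicator K (snd z)) * min 1 (?r powr p)" by simp
    qed simp
    finally show ?thesis .
  qed (use K(3) in \<open>simp add: dq_def\<close>)
  have "integrable (gagliardo_measure s p) (\<lambda>z. \<bar>dq \<eta> z\<bar> powr p)"
    by (rule Bochner_Integration.integrable_bound[OF integrable_mult_right[OF integrable_near[OF p s K(1)], of "C powr p"]])
       (measurable, use le in \<open>auto intro!: AE_I2 order_trans[OF _ abs_ge_self]\<close>)
  moreover have "integrable lborel (\<lambda>x. \<bar>\<eta> x\<bar> powr p)"
    using p by (intro integrable_powr_bounded_support[OF _ K(1,3) B]) auto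
  ultimately show ?thesis using K by (auto simp: test_class_def)
qed

lemma gagliardo_pow_indicator:
  fixes u :: "'a::euclidean_space \<Rightarrow> real"
  assumes [measurable]: "u \<in> borel_measurable borel" "A \<in> sets borel"
  shows "gagliardo_pow s p A u = (\<integral>\<^sup>+z. ennreal (indicator (A \<times> A) z * \<bar>dq u z\<bar> powr p) \<partial>gagliardo_measure s p)"
proof -
  have "(\<integral>\<^sup>+z. ennreal (indicator (A \<times> A) z * \<bar>dq u z\<bar> powr p) \<partial>gagliardo_measure s p)
    = (\<integral>\<^sup>+z. (case z of (x, y) \<Rightarrow> ennreal (1 / norm (x - y) powr (real DIM('a) + s * p))) *
        ennreal (indicator (A \<times> A) z * \<bar>dq u z\<bar> powr p) \<partial>(lborel \<Otimes>\<^sub>M lborel))"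
    unfolding gagliardo_measure_def by (rule nn_integral_density) measurable
  then show ?thesis
    unfolding gagliardo_pow_def
    by (simp, intro nn_integral_cong) (auto simp: ennreal_mult[symmetric] dq_def split: split_indicator)
qed

lemma gagliardo_pow_finite:
  fixes u :: "'a::euclidean_space \<Rightarrow> real"
  assumes [measurable]: "u \<in> borel_measurable borel" "A \<in> sets borel"
    and E: "integrable (gagliardo_measure s p) (\<lambda>z. \<bar>dq u z\<bar> powr p)"
  shows "gagliardo_pow s p A u < \<infinity>"
proof -
  have "gagliardo_pow s p A u \<le> (\<integral>\<^sup>+z. ennreal (\<bar>dq u z\<bar> powr p) \<partial>gagliardo_measure s p)"
    by (subst gagliardo_pow_indicator, simp, simp)
      (auto intro!: nn_integral_mono ennreal_leI split: split_indicator)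
  also have "\<dots> < \<infinity>" using E by (subst (asm) integrable_powr_abs_iff) auto
  finally show ?thesis .
qed

text \<open>The obstacle is that u has finite seminorm only on sets compactly inside \<Omega>. For
  pairs inside a neighbourhood A of the support the Lipschitz estimate uses the seminorm of u on A;
  a pair with one point in the support and the other off A is at distance at least \<delta>, so
  boundedness of the quotient suffices there; pairs missing the support contribute 0.\<close>

lemma test_class_picone:
  fixes \<eta> u :: "'a::euclidean_space \<Rightarrow> real"
  assumes p: "1 < p" and s: "0 < s" "s < 1" and om: "open \<Omega>" and e: "0 < \<epsilon>"
    and eta: "\<eta> \<in> test_class s p \<Omega>" "\<And>x. 0 \<le> \<eta> x" "\<And>x. \<eta> x \<le> B"
    and u [measurable]: "u \<in> borel_measurable borel"
    and loc: "\<And>\<Omega>'. open \<Omega>' \<Longrightarrow> compactly_inside \<Omega>' \<Omega> \<Longrightarrow> gagliardo_pow s p \<Omega>' u < \<infinity>"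
  shows "(\<lambda>x. \<eta> x powr p / (max 0 (u x) + \<epsilon>) powr (p - 1)) \<in> test_class s p \<Omega>" (is "?\<psi> \<in> _")
proof -
  note [measurable] = test_classD(1)[OF eta(1)]
  obtain K where K: "compact K" "K \<subseteq> \<Omega>" "\<And>x. x \<notin> K \<Longrightarrow> \<eta> x = 0"
    using eta by (metis test_class_support)
  have [measurable]: "K \<in> sets borel" using K(1) by (rule borel_compact)
  have B0: "0 \<le> B" using eta(2,3)[of 0] by linarith
  obtain \<delta> where \<delta>: "0 < \<delta>" "compact (\<Union>x\<in>K. cball x \<delta>)" "(\<Union>x\<in>K. cball x \<delta>) \<subseteq> \<Omega>"
    using compact_neighbourhood[OF K(1) om K(2)] by blast
  define A where "A = (\<Union>x\<in>K. ball x \<delta>)"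
  have A: "open A" by (auto simp: A_def)
  then have [measurable]: "A \<in> sets borel" by (rule borel_open)
  have "closure A \<subseteq> (\<Union>x\<in>K. cball x \<delta>)"
    unfolding A_def using \<delta>(2) by (intro closure_minimal compact_imp_closed) auto
  then have "compactly_inside A \<Omega>"
    unfolding compactly_inside_def using \<delta> compact_Int_closed[OF \<delta>(2) closed_closure[of A]]
    by (auto simp: inf.absorb2)
  then have "integrable (gagliardo_measure s p) (\<lambda>z. indicator (A \<times> A) z * \<bar>dq u z\<bar> powr p)"
    using loc[OF A] by (intro integrableI_nonneg) (auto simp: gagliardo_pow_indicator)
  note int_u = this
  \<comment> \<open>\<open>M\<close> bounds the quotient, \<open>C1\<close> and \<open>C2\<close>
    are the constants of \<open>picone_test_lipschitz\<close>, and \<open>m\<close> is a lower bound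
    of min(1, |x - y|^p) at distance \<delta> or more.\<close>
  define M where "M = B powr p / \<epsilon> powr (p - 1)"
  define C1 where "C1 = p * B powr (p - 1) / \<epsilon> powr (p - 1)"
  define C2 where "C2 = (p - 1) * B powr p / \<epsilon> powr p"
  define m where "m = min 1 (\<delta> powr p)"
  have m: "0 < m" using \<delta> by (simp add: m_def)
  have C: "0 \<le> C1" "0 \<le> C2" "0 \<le> M" using p B0 by (auto simp: C1_def C2_def M_def)
  have psi_nn: "0 \<le> ?\<psi> x" for x by simp
  have psi_le: "?\<psi> x \<le> M" for x
    unfolding M_def using p e eta by (intro frac_le powr_mono2) auto
  define G where "G z = 2 powr p * (\<bar>C1 * dq \<eta> z\<bar> powr p + C2 powr p * (indicator (A \<times> A) z * \<bar>dq u z\<bar> powr p))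
     + M powr p / m * ((indicator K (fst z) + indicator K (snd z)) * min 1 (norm (fst z - snd z) powr p))" for z
  have intG: "integrable (gagliardo_measure s p) G"
    unfolding G_def
    by (intro Bochner_Integration.integrable_add integrable_mult_right integrable_near[OF p s K(1)] int_u
        integrable_powr_cmult test_classD(3)[OF eta(1)])
  have far: "\<bar>dq ?\<psi> z\<bar> powr p \<le> G z" if z: "fst z \<in> K \<and> snd z \<notin> A \<or> fst z \<notin> A \<and> snd z \<in> K" for z
  proof -
    have KA: "K \<subseteq> A" using \<delta>(1) by (force simp: A_def)
    have ind: "(indicator K (fst z) + indicator K (snd z) :: real) = 1"
      using z KA by (auto split: split_indicator)
    have "\<delta> \<le> norm (fst z - snd z)"
      using z unfolding A_def by (auto simp: dist_norm norm_minus_commute not_less)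
    then have "\<delta> powr p \<le> norm (fst z - snd z) powr p"
      using \<delta> p by (intro powr_mono2) auto
    then have mm: "m \<le> min 1 (norm (fst z - snd z) powr p)" by (auto simp: m_def)
    have "?\<psi> x = 0" if "x \<notin> K" for x using K(3)[OF that] by simp
    then have "\<bar>dq ?\<psi> z\<bar> \<le> M"
      using z KA psi_le[of "fst z"] psi_le[of "snd z"] psi_nn[of "fst z"] psi_nn[of "snd z"]
      unfolding dq_def by (smt (verit) subsetD)
    then have "\<bar>dq ?\<psi> z\<bar> powr p \<le> M powr p" using p by (intro powr_mono2) auto
    also have "\<dots> = M powr p / m * m" using m by simp
    also have "\<dots> \<le> M powr p / m * min 1 (norm (fst z - snd z) powr p)"
      using mm m by (intro mult_left_mono) auto
    also have "\<dots> \<le> G z"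
      unfolding G_def ind by (auto intro!: add_nonneg_nonneg mult_nonneg_nonneg)
    finally show ?thesis .
  qed
  have near: "\<bar>dq ?\<psi> z\<bar> powr p \<le> G z" if z: "fst z \<in> A" "snd z \<in> A" for z
  proof -
    let ?v = "\<lambda>x. max 0 (u x)"
    have "\<bar>dq ?\<psi> z\<bar> \<le> C1 * \<bar>dq \<eta> z\<bar> + C2 * \<bar>dq ?v z\<bar>"
      unfolding dq_def C1_def C2_def using p e eta by (intro picone_test_lipschitz) auto
    also have "\<dots> \<le> C1 * \<bar>dq \<eta> z\<bar> + C2 * \<bar>dq u z\<bar>"
      using C by (intro add_left_mono mult_left_mono) (auto simp: dq_def)
    finally have "\<bar>dq ?\<psi> z\<bar> powr p \<le> \<bar>C1 * \<bar>dq \<eta> z\<bar> + C2 * \<bar>dq u z\<bar>\<bar> powr p"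
      using p by (intro powr_mono2) auto
    also have "\<dots> \<le> 2 powr p * (\<bar>C1 * \<bar>dq \<eta> z\<bar>\<bar> powr p + \<bar>C2 * \<bar>dq u z\<bar>\<bar> powr p)"
      using p by (intro abs_add_powr_le) auto
    also have "\<dots> = 2 powr p * (\<bar>C1 * dq \<eta> z\<bar> powr p + C2 powr p * (indicator (A \<times> A) z * \<bar>dq u z\<bar> powr p))"
      using z C by (simp add: abs_mult powr_mult indicator_times)
    also have "\<dots> \<le> G z"
      unfolding G_def using m by (auto intro!: mult_nonneg_nonneg)
    finally show ?thesis .
  qed
  have "\<bar>dq ?\<psi> z\<bar> powr p \<le> G z" for z
  proof (cases "fst z \<in> K \<or> snd z \<in> K")
    case True
    moreover have "K \<subseteq> A" using \<delta>(1) by (force simp: A_def)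
    ultimately show ?thesis using far[of z] near[of z] by blast
  next
    case False
    then have "dq ?\<psi> z = 0" using K(3) by (simp add: dq_def)
    moreover have "0 \<le> G z" unfolding G_def using m by (auto intro!: add_nonneg_nonneg mult_nonneg_nonneg)
    ultimately show ?thesis by simp
  qed
  then have "integrable (gagliardo_measure s p) (\<lambda>z. \<bar>dq ?\<psi> z\<bar> powr p)"
    by (intro Bochner_Integration.integrable_bound[OF intG]) (auto intro!: AE_I2 order_trans[OF _ abs_ge_self])
  moreover have "integrable lborel (\<lambda>x. \<bar>?\<psi> x\<bar> powr p)"
    using p psi_le psi_nn K(3) by (intro integrable_powr_bounded_support[OF _ K(1), where B = M]) auto
  moreover have "\<exists>K. compact K \<and> K \<subseteq> \<Omega> \<and> (\<forall>x. x \<notin> K \<longrightarrow> ?\<psi> x = 0)"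
    using K by (intro exI[of _ K]) auto
  ultimately show ?thesis unfolding test_class_def by simp
qed

section \<open>Distance to the boundary\<close>

lemma dist_bdry_pos:
  assumes "open \<Omega>" "\<Omega> \<noteq> UNIV" "x \<in> \<Omega>"
  shows "0 < dist_bdry \<Omega> x"
proof -
  have "frontier \<Omega> \<noteq> {}" using assms by (metis empty_iff frontier_eq_empty)
  moreover have "x \<notin> frontier \<Omega>" using assms by (simp add: frontier_def interior_open)
  ultimately show ?thesis
    unfolding dist_bdry_def by (intro infdist_pos_not_in_closed frontier_closed)
qed

lemma borel_measurable_dist_bdry [measurable]: "dist_bdry \<Omega> \<in> borel_measurable borel"
  unfolding dist_bdry_def by (intro borel_measurable_continuous_onI continuous_intros)

lemma dist_bdry_bounds:
  assumes "open \<Omega>" "\<Omega> \<noteq> UNIV" "compact K" "K \<subseteq> \<Omega>"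
  obtains c d where "0 < c" "\<And>x. x \<in> K \<Longrightarrow> c \<le> dist_bdry \<Omega> x" "\<And>x. x \<in> K \<Longrightarrow> dist_bdry \<Omega> x \<le> d" "0 < d"
proof (cases "K = {}")
  case False
  have cont: "continuous_on K (dist_bdry \<Omega>)"
    unfolding dist_bdry_def by (intro continuous_intros)
  obtain a where a: "a \<in> K" "\<And>x. x \<in> K \<Longrightarrow> dist_bdry \<Omega> a \<le> dist_bdry \<Omega> x"
    using continuous_attains_inf[OF assms(3) False cont] by blast
  obtain b where b: "b \<in> K" "\<And>x. x \<in> K \<Longrightarrow> dist_bdry \<Omega> x \<le> dist_bdry \<Omega> b"
    using continuous_attains_sup[OF assms(3) False cont] by blast
  show ?thesis
    using that[of "dist_bdry \<Omega> a" "dist_bdry \<Omega> b"] a b dist_bdry_pos[OF assms(1,2)] assms(4) by blast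
qed (use that[of 1 1] in auto)

text \<open>The density is strictly positive throughout \<Omega>, so inside \<Omega> the null sets
  are those of Lebesgue measure.\<close>

lemma AE_hardy_measure_iff:
  assumes "open \<Omega>" "\<Omega> \<noteq> UNIV"
  shows "(AE x in hardy_measure s p \<Omega>. P x) \<longleftrightarrow> (AE x in lborel. x \<in> \<Omega> \<longrightarrow> P x)"
proof -
  have [measurable]: "\<Omega> \<in> sets borel" using assms(1) by (rule borel_open)
  have "0 < indicator \<Omega> x / dist_bdry \<Omega> x powr (s * p) \<longleftrightarrow> x \<in> \<Omega>" for x
    using dist_bdry_pos[OF assms, of x] by (auto split: split_indicator)
  then show ?thesis
    unfolding hardy_measure_def by (subst AE_density) (simp_all add: ennreal_less_zero_iff)
qed

section \<open>Smooth kernels\<close>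

text \<open>The function t^(-j) exp(-1 / t), extended by 0. The index j makes the family closed
  under differentiation up to linear combinations, starting from the standard flat function at j =
  0.\<close>

definition bump :: "nat \<Rightarrow> real \<Rightarrow> real" where
  "bump j t = (if 0 < t then (1 / t) ^ j * exp (- (1 / t)) else 0)"

lemma bump_nonneg: "0 \<le> bump j t"
  by (simp add: bump_def)

lemma power_div_fact_le_exp:
  fixes x :: real
  assumes "0 \<le> x"
  shows "x ^ n / fact n \<le> exp x"
proof -
  have "(\<lambda>n. x ^ n / fact n) sums exp x"
    using exp_converges[of x] by (simp add: scaleR_conv_of_real field_simps)
  then show ?thesis
    using sum_le_suminf[of "\<lambda>n. x ^ n / fact n" "{n}"] assms by (simp add: sums_iff)
qed

text \<open>With x = 1 / t this is x^(j + k) <= (j + k)! exp x, a single term of the exponential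
  series. It expresses flatness to every order at 0.\<close>

lemma bump_le_power:
  assumes "0 \<le> t"
  shows "bump j t \<le> fact (j + k) * t ^ k"
proof (cases "0 < t")
  case True
  define x where "x = 1 / t"
  have x: "0 < x" using True by (simp add: x_def)
  have "x ^ (j + k) \<le> fact (j + k) * exp x"
    using power_div_fact_le_exp[of x "j + k"] x by (simp add: field_simps)
  then have "x ^ j * x ^ k * exp (- x) \<le> fact (j + k)"
    by (simp add: exp_minus power_add field_simps)
  moreover have "x ^ k * t ^ k = 1"
    using True by (simp add: x_def power_mult_distrib[symmetric])
  ultimately have "x ^ j * exp (- x) \<le> fact (j + k) * t ^ k"
    using mult_right_mono[of "x ^ j * x ^ k * exp (- x)" "fact (j + k)" "t ^ k"] True
    by (simp add: mult.assoc mult.left_commute[of _ "exp (- x)"])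
  moreover have "bump j t = x ^ j * exp (- x)"
    using True by (simp add: bump_def x_def)
  ultimately show ?thesis by simp
qed (use assms in \<open>simp add: bump_def\<close>)

lemma DERIV_bump:
  "(bump j has_real_derivative (bump (j + 2) t - j * bump (j + 1) t)) (at t)"
proof -
  consider "t < 0" | "t = 0" | "0 < t" by linarith
  then show ?thesis
  proof cases
    case 1
    have "((\<lambda>x. 0) has_real_derivative 0) (at t)" by simp
    then have "(bump j has_real_derivative 0) (at t)"
      by (rule has_field_derivative_transform_within_open[where S = "{..<0}"]) (use 1 in \<open>auto simp: bump_def\<close>)
    then show ?thesis using 1 by (simp add: bump_def)
  next
    case 2
    \<comment> \<open>Taking k = 2 in \<open>bump_le_power\<close> bounds the difference quotient at
      0 by a multiple of |h|, so the derivative there is 0, in agreement with the formula.\<close>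
    have "((\<lambda>h. (bump j (0 + h) - bump j 0) / h) \<longlongrightarrow> 0) (at 0)"
    proof (rule Lim_null_comparison)
      show "\<forall>\<^sub>F h in at 0. norm ((bump j (0 + h) - bump j 0) / h) \<le> fact (j + 2) * \<bar>h\<bar>"
      proof (rule always_eventually, rule allI)
        fix h :: real
        show "norm ((bump j (0 + h) - bump j 0) / h) \<le> fact (j + 2) * \<bar>h\<bar>"
        proof (cases "0 < h")
          case True
          then show ?thesis
            using bump_le_power[of h j 2] bump_nonneg[of j h]
            by (simp add: bump_def[of j 0] divide_le_eq power2_eq_square mult_ac)
        next
          case False
          then have "norm ((bump j (0 + h) - bump j 0) / h) = 0" by (simp add: bump_def)
          then show ?thesis by (simp only: mult_nonneg_nonneg fact_ge_zero abs_ge_zero)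
        qed
      qed
      show "((\<lambda>h. fact (j + 2) * \<bar>h\<bar>) \<longlongrightarrow> 0) (at (0::real))"
        by (auto intro!: tendsto_eq_intros)
    qed
    then show ?thesis using 2 by (simp add: DERIV_def bump_def)
  next
    case 3
    have "((\<lambda>x. (1 / x) ^ j * exp (- (1 / x))) has_real_derivative (bump (j + 2) t - j * bump (j + 1) t)) (at t)"
    proof (cases j)
      case 0
      then show ?thesis using 3
        by (auto intro!: derivative_eq_intros simp: bump_def power2_eq_square divide_simps)
    next
      case (Suc i)
      then show ?thesis using 3
        by (auto intro!: derivative_eq_intros simp: bump_def power2_eq_square divide_simps)
          (cases i; simp add: algebra_simps)
    qed
    then show ?thesis
      by (rule has_field_derivative_transform_within_open[where S = "{0<..}"]) (use 3 in \<open>auto simp: bump_def\<close>)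
  qed
qed

text \<open>Closed under directional derivatives, so that membership implies smoothness of every order.\<close>

inductive smooth_alg :: "real \<Rightarrow> ('a::euclidean_space \<Rightarrow> real) \<Rightarrow> bool" for c where
  const: "smooth_alg c (\<lambda>x. a)"
| inner: "smooth_alg c (\<lambda>x. x \<bullet> v)"
| bump: "smooth_alg c (\<lambda>x. bump j (1 - c * (x \<bullet> x)))"
| add: "smooth_alg c f \<Longrightarrow> smooth_alg c g \<Longrightarrow> smooth_alg c (\<lambda>x. f x + g x)"
| mult: "smooth_alg c f \<Longrightarrow> smooth_alg c g \<Longrightarrow> smooth_alg c (\<lambda>x. f x * g x)"

text \<open>The derivative is recorded direction by direction so that every directional derivative
  is again a member; this matches the recursion of \<open>C_k\<close>.\<close>

lemma smooth_alg_has_derivative: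
  assumes "smooth_alg c g"
  obtains g' where "\<And>x. (g has_derivative (\<lambda>v. g' v x)) (at x)" "\<And>v. smooth_alg c (g' v)"
proof -
  have "\<exists>g'. (\<forall>x. (g has_derivative (\<lambda>v. g' v x)) (at x)) \<and> (\<forall>v. smooth_alg c (g' v))"
    using assms
  proof induction
    case (const a)
    show ?case by (intro exI[of _ "\<lambda>v x. 0"]) (auto intro: smooth_alg.const)
  next
    case (inner w)
    have "smooth_alg c (\<lambda>x :: 'a. v \<bullet> w)" for v by (rule smooth_alg.const)
    then show ?case by (intro exI[of _ "\<lambda>v x. v \<bullet> w"]) (auto intro!: derivative_eq_intros)
  next
    case (bump j)
    let ?q = "\<lambda>x :: 'a. 1 - c * (x \<bullet> x)"
    let ?g' = "\<lambda>v x. (bump (j + 2) (?q x) + (- real j) * bump (j + 1) (?q x)) * ((- 2 * c) * (x \<bullet> v))"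
    have "((\<lambda>x. bump j (?q x)) has_derivative (\<lambda>v. ?g' v x)) (at x)" for x
    proof -
      have q: "(?q has_derivative (\<lambda>v. - 2 * c * (x \<bullet> v))) (at x)"
        by (auto intro!: derivative_eq_intros simp: inner_commute)
      have "(bump j has_derivative (*) (bump (j + 2) (?q x) - j * bump (j + 1) (?q x))) (at (?q x))"
        using DERIV_bump[of j "?q x"] by (simp add: has_field_derivative_def)
      from has_derivative_compose[OF q this] show ?thesis by simp
    qed
    moreover have "smooth_alg c (?g' v)" for v
      by (intro smooth_alg.intros)
    ultimately show ?case by (intro exI[of _ ?g'] conjI allI)
  next
    case (add f g)
    then obtain f' g' where "\<And>x. (f has_derivative (\<lambda>v. f' v x)) (at x)" "\<And>v. smooth_alg c (f' v)"
      "\<And>x. (g has_derivative (\<lambda>v. g' v x)) (at x)" "\<And>v. smooth_alg c (g' v)"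
      by blast
    then show ?case
      by (intro exI[of _ "\<lambda>v x. f' v x + g' v x"]) (auto intro!: has_derivative_add smooth_alg.add)
  next
    case (mult f g)
    then obtain f' g' where *: "\<And>x. (f has_derivative (\<lambda>v. f' v x)) (at x)" "\<And>v. smooth_alg c (f' v)"
      "\<And>x. (g has_derivative (\<lambda>v. g' v x)) (at x)" "\<And>v. smooth_alg c (g' v)"
      by blast
    have "((\<lambda>x. f x * g x) has_derivative (\<lambda>v. f x * g' v x + f' v x * g x)) (at x)" for x
      by (rule has_derivative_mult[OF *(1,3)])
    then show ?case
      using * mult.hyps by (intro exI[of _ "\<lambda>v x. f x * g' v x + f' v x * g x"]) (auto intro!: smooth_alg.intros)
  qed
  then show ?thesis using that by blast
qed

text \<open>A self-reproducing certificate of smoothness: boundedness of all iterated directional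
  derivatives is contained in the closure condition, so uniform Lipschitz and Taylor bounds hold for
  every member without tracking orders.\<close>

definition deriv_closed :: "('a::euclidean_space \<Rightarrow> real) set \<Rightarrow> bool" where
  "deriv_closed S \<longleftrightarrow> (\<forall>g\<in>S. (\<exists>B. \<forall>x. \<bar>g x\<bar> \<le> B) \<and> (\<forall>x. g differentiable (at x))
     \<and> (\<forall>v. (\<lambda>x. frechet_derivative g (at x) v) \<in> S))"

definition smooth_kernels :: "real \<Rightarrow> real \<Rightarrow> ('a::euclidean_space \<Rightarrow> real) set" where
  "smooth_kernels c r = {g. smooth_alg c g \<and> (\<forall>x. r < norm x \<longrightarrow> g x = 0)}"

text \<open>The complement of the closed ball is open and the function vanishes on it, hence so do
  its derivatives; on the ball itself continuity gives the bound.\<close>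

lemma deriv_closed_smooth_kernels: "deriv_closed (smooth_kernels c r)"
  unfolding deriv_closed_def
proof (intro ballI conjI allI)
  fix g :: "'a \<Rightarrow> real" assume "g \<in> smooth_kernels c r"
  then have g: "smooth_alg c g" and supp: "\<And>x. r < norm x \<Longrightarrow> g x = 0"
    by (auto simp: smooth_kernels_def)
  obtain g' where g': "\<And>x. (g has_derivative (\<lambda>v. g' v x)) (at x)" "\<And>v. smooth_alg c (g' v)"
    using smooth_alg_has_derivative[OF g] by blast
  show diff: "g differentiable (at x)" for x using g'(1) by (auto simp: differentiable_def)
  have fd: "frechet_derivative g (at x) v = g' v x" for x v
    using frechet_derivative_at[OF g'(1)[of x]] by (metis (full_types))
  have "g' v x = 0" if "r < norm x" for v x
  proof -
    have "open {x :: 'a. r < norm x}" by (intro open_Collect_less continuous_intros)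
    moreover have "((\<lambda>x. 0) has_derivative (\<lambda>v. 0)) (at x)" by simp
    ultimately have "(g has_derivative (\<lambda>v. 0)) (at x)"
      using has_derivative_transform_within_open[of "\<lambda>x. 0" "\<lambda>v. 0" x UNIV "{x. r < norm x}" g] that supp
      by simp
    from has_derivative_unique[OF this g'(1)] show ?thesis by metis
  qed
  then show "(\<lambda>x. frechet_derivative g (at x) v) \<in> smooth_kernels c r" for v
    unfolding fd using g'(2) by (auto simp: smooth_kernels_def)
  have "continuous_on (cball 0 r) g"
    using diff by (intro continuous_at_imp_continuous_on ballI differentiable_imp_continuous_within)
  then have "bounded (g ` cball 0 r)"
    by (intro compact_imp_bounded compact_continuous_image) auto
  then obtain B where "\<forall>x\<in>cball 0 r. \<bar>g x\<bar> \<le> B"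
    unfolding bounded_iff by auto
  then have B: "\<And>x. norm x \<le> r \<Longrightarrow> \<bar>g x\<bar> \<le> B" by simp
  show "\<exists>B. \<forall>x. \<bar>g x\<bar> \<le> B"
    using B supp by (intro exI[of _ "max B 0"]) (metis abs_zero max.coboundedI1 max.cobounded2 not_less)
qed

lemma linear_functional_bound:
  fixes f :: "'a::euclidean_space \<Rightarrow> real"
  assumes "linear f"
  shows "\<bar>f v\<bar> \<le> (\<Sum>b\<in>Basis. \<bar>f b\<bar>) * norm v"
proof -
  have "f v = f (\<Sum>b\<in>Basis. (v \<bullet> b) *\<^sub>R b)" by (simp add: euclidean_representation)
  also have "\<dots> = (\<Sum>b\<in>Basis. (v \<bullet> b) * f b)"
    using assms by (simp add: linear_sum linear_cmul)
  also have "\<bar>\<dots>\<bar> \<le> (\<Sum>b\<in>Basis. \<bar>f b\<bar> * norm v)"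
    by (intro order_trans[OF sum_abs] sum_mono) (subst mult.commute, auto simp: abs_mult Basis_le_norm intro!: mult_left_mono)
  finally show ?thesis by (simp add: sum_distrib_right)
qed

text \<open>The bound on a directional derivative depends on the direction; expanding the direction
  in the finite basis makes it uniform.\<close>

lemma deriv_closed_lipschitz:
  assumes S: "deriv_closed S" and g: "g \<in> S"
  obtains L where "0 \<le> L" "\<And>x y. \<bar>g x - g y\<bar> \<le> L * norm (x - y)"
proof -
  have d: "(g has_derivative frechet_derivative g (at x)) (at x)" for x
    using S g by (auto simp: deriv_closed_def frechet_derivative_works)
  have "\<exists>B. \<forall>x. \<bar>frechet_derivative g (at x) v\<bar> \<le> B" for v
    using S g by (auto simp: deriv_closed_def)
  then obtain B where B: "\<And>v x. \<bar>frechet_derivative g (at x) v\<bar> \<le> B v" by metis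
  let ?L = "\<Sum>b\<in>Basis. B b"
  have B0: "0 \<le> B v" for v using B[of 0 v] by linarith
  have "\<bar>frechet_derivative g (at x) v\<bar> \<le> ?L * norm v" for x v
  proof -
    have "\<bar>frechet_derivative g (at x) v\<bar> \<le> (\<Sum>b\<in>Basis. \<bar>frechet_derivative g (at x) b\<bar>) * norm v"
      using d by (intro linear_functional_bound has_derivative_linear)
    also have "\<dots> \<le> ?L * norm v" using B by (intro mult_right_mono sum_mono) auto
    finally show ?thesis .
  qed
  then have "norm (g x - g y) \<le> ?L * norm (x - y)" for x y
    using d by (intro differentiable_bound[where S = UNIV]) (auto intro!: onorm_le)
  then show ?thesis using that[of ?L] B0 by (auto intro: sum_nonneg)
qed

text \<open>Each partial derivative is a member of \<open>S\<close> and therefore Lipschitz. The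
  derivative is then Lipschitz with the sum M of these constants, and the mean value inequality for
  the linearization gives a quadratic remainder uniform in x.\<close>

lemma deriv_closed_taylor:
  assumes S: "deriv_closed S" and g: "g \<in> S"
  obtains M where "0 \<le> M"
    "\<And>x w. \<bar>g (x + w) - g x - frechet_derivative g (at x) w\<bar> \<le> M * (norm w)\<^sup>2"
proof -
  let ?D = "\<lambda>x. frechet_derivative g (at x)"
  have d: "(g has_derivative ?D x) (at x)" for x
    using S g by (auto simp: deriv_closed_def frechet_derivative_works)
  have "\<exists>L\<ge>0. \<forall>x y. \<bar>?D x b - ?D y b\<bar> \<le> L * norm (x - y)" for b
    using deriv_closed_lipschitz[OF S, of "\<lambda>x. ?D x b"] S g by (metis deriv_closed_def)
  then obtain L where L: "\<And>b. 0 \<le> L b" "\<And>b x y. \<bar>?D x b - ?D y b\<bar> \<le> L b * norm (x - y)" by metis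
  define M where "M = (\<Sum>b\<in>Basis. L b)"
  have M: "0 \<le> M" using L by (auto simp: M_def intro: sum_nonneg)
  have *: "\<bar>?D x v - ?D y v\<bar> \<le> M * norm (x - y) * norm v" for x y v
  proof -
    have "linear (\<lambda>v. ?D x v - ?D y v)"
      using d by (intro linear_compose_sub has_derivative_linear)
    then have "\<bar>?D x v - ?D y v\<bar> \<le> (\<Sum>b\<in>Basis. \<bar>?D x b - ?D y b\<bar>) * norm v"
      by (rule linear_functional_bound)
    also have "\<dots> \<le> (\<Sum>b\<in>Basis. L b * norm (x - y)) * norm v"
      using L by (intro mult_right_mono sum_mono) auto
    finally show ?thesis by (simp add: M_def sum_distrib_right)
  qed
  have "\<bar>g (x + w) - g x - ?D x w\<bar> \<le> M * (norm w)\<^sup>2" for x w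
  proof -
    have "norm (g (x + w) - g x - ?D x ((x + w) - x)) \<le> norm ((x + w) - x) * (M * norm w)"
    proof (rule differentiable_bound_linearization[where S = "cball x (norm w)"])
      fix y assume "y \<in> cball x (norm w)"
      then have "norm (y - x) \<le> norm w" by (simp add: dist_norm norm_minus_commute)
      then have "M * norm (y - x) \<le> M * norm w" using M by (intro mult_left_mono)
      then have "norm (?D y v - ?D x v) \<le> M * norm w * norm v" for v
        using *[of y v x] mult_right_mono[of "M * norm (y - x)" "M * norm w" "norm v"] by simp
      then show "onorm (?D y - ?D x) \<le> M * norm w" by (intro onorm_le) simp
    qed (use d in \<open>auto intro: has_derivative_at_withinI simp: dist_norm mult_left_le_one_le\<close>)
    then show ?thesis by (simp add: power2_eq_square mult_ac)
  qed
  then show ?thesis using that M by blast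
qed

lemma deriv_closed_integrable:
  fixes \<phi> :: "'a::euclidean_space \<Rightarrow> real"
  assumes S: "deriv_closed S" and g: "g \<in> S" and \<phi>: "integrable lborel \<phi>"
  shows "integrable lborel (\<lambda>y. g (x - y) * \<phi> y)"
proof -
  obtain B where B: "\<And>x. \<bar>g x\<bar> \<le> B" using S g unfolding deriv_closed_def by metis
  have "continuous_on UNIV g"
    using S g by (auto simp: deriv_closed_def intro!: continuous_at_imp_continuous_on differentiable_imp_continuous_within)
  then have [measurable]: "g \<in> borel_measurable borel" by (rule borel_measurable_continuous_onI)
  have [measurable]: "\<phi> \<in> borel_measurable borel" using \<phi> by auto
  show ?thesis
  proof (rule Bochner_Integration.integrable_bound)
    show "integrable lborel (\<lambda>y. B * \<phi> y)" using \<phi> by simp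
    show "AE y in lborel. norm (g (x - y) * \<phi> y) \<le> norm (B * \<phi> y)"
      using B by (auto intro!: AE_I2 mult_right_mono order_trans[OF B] simp: abs_mult)
  qed measurable
qed

text \<open>The uniform Taylor remainder is integrated against |\<phi>|: the error is at most M
  |h|^2 times the L^1 norm of \<phi>. All regularity comes from the kernel.\<close>

lemma convolution_has_derivative:
  fixes \<phi> :: "'a::euclidean_space \<Rightarrow> real"
  assumes S: "deriv_closed S" and g: "g \<in> S" and \<phi>: "integrable lborel \<phi>"
  shows "((\<lambda>x. \<integral>y. g (x - y) * \<phi> y \<partial>lborel) has_derivative
    (\<lambda>v. \<integral>y. frechet_derivative g (at (x - y)) v * \<phi> y \<partial>lborel)) (at x)"
proof -
  let ?D = "\<lambda>x. frechet_derivative g (at x)"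
  have d: "(g has_derivative ?D x) (at x)" for x
    using S g by (auto simp: deriv_closed_def frechet_derivative_works)
  have lin: "linear (?D x)" for x using d by (rule has_derivative_linear)
  have DS: "(\<lambda>x. ?D x v) \<in> S" for v using S g by (auto simp: deriv_closed_def)
  have intD: "integrable lborel (\<lambda>y. ?D (x - y) v * \<phi> y)" for v
    by (rule deriv_closed_integrable[OF S DS \<phi>])
  have intg: "integrable lborel (\<lambda>y. g (x - y) * \<phi> y)" for x
    by (rule deriv_closed_integrable[OF S g \<phi>])
  obtain M where M: "0 \<le> M" "\<And>x w. \<bar>g (x + w) - g x - ?D x w\<bar> \<le> M * (norm w)\<^sup>2"
    using deriv_closed_taylor[OF S g] by blast
  define I where "I = (\<integral>y. \<bar>\<phi> y\<bar> \<partial>lborel)"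
  have "linear (\<lambda>v. \<integral>y. ?D (x - y) v * \<phi> y \<partial>lborel)"
    by (rule linearI)
      (simp_all add: linear_add[OF lin] linear_cmul[OF lin] distrib_right intD mult.assoc)
  then have bl: "bounded_linear (\<lambda>v. \<integral>y. ?D (x - y) v * \<phi> y \<partial>lborel)"
    by (simp add: linear_conv_bounded_linear)
  have est: "norm ((\<integral>y. g (x + h - y) * \<phi> y \<partial>lborel) - (\<integral>y. g (x - y) * \<phi> y \<partial>lborel)
      - (\<integral>y. ?D (x - y) h * \<phi> y \<partial>lborel)) \<le> M * (norm h)\<^sup>2 * I" for h
  proof -
    define R where "R y = g (x + h - y) * \<phi> y - g (x - y) * \<phi> y - ?D (x - y) h * \<phi> y" for y
    have R: "\<bar>R y\<bar> \<le> M * (norm h)\<^sup>2 * \<bar>\<phi> y\<bar>" for y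
    proof -
      have shift: "(x - y) + h = x + h - y" by (simp add: algebra_simps)
      have "R y = (g ((x - y) + h) - g (x - y) - ?D (x - y) h) * \<phi> y"
        unfolding R_def shift by (simp only: left_diff_distrib)
      then have "\<bar>R y\<bar> = \<bar>g ((x - y) + h) - g (x - y) - ?D (x - y) h\<bar> * \<bar>\<phi> y\<bar>"
        by (simp only: abs_mult)
      also have "\<dots> \<le> M * (norm h)\<^sup>2 * \<bar>\<phi> y\<bar>" by (rule mult_right_mono[OF M(2) abs_ge_zero])
      finally show ?thesis .
    qed
    have intR: "integrable lborel R"
      unfolding R_def using intg intD by (intro Bochner_Integration.integrable_diff)
    have "(\<integral>y. g (x + h - y) * \<phi> y \<partial>lborel) - (\<integral>y. g (x - y) * \<phi> y \<partial>lborel) - (\<integral>y. ?D (x - y) h * \<phi> y \<partial>lborel)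
      = (\<integral>y. R y \<partial>lborel)"
      unfolding R_def using intg intD by simp
    also have "norm \<dots> \<le> (\<integral>y. \<bar>R y\<bar> \<partial>lborel)"
      using integral_norm_bound[of lborel R] by simp
    also have "\<dots> \<le> (\<integral>y. M * (norm h)\<^sup>2 * \<bar>\<phi> y\<bar> \<partial>lborel)"
      using intR \<phi> R by (intro integral_mono integrable_mult_right integrable_abs) auto
    finally show ?thesis by (simp add: I_def)
  qed
  show ?thesis
    unfolding has_derivative_at
  proof (intro conjI bl, rule Lim_null_comparison)
    show "\<forall>\<^sub>F h in at 0. norm (norm ((\<integral>y. g (x + h - y) * \<phi> y \<partial>lborel) - (\<integral>y. g (x - y) * \<phi> y \<partial>lborel)
      - (\<integral>y. ?D (x - y) h * \<phi> y \<partial>lborel)) / norm h) \<le> M * I * norm h"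
    proof (rule always_eventually, rule allI)
      fix h :: 'a
      show "norm (norm ((\<integral>y. g (x + h - y) * \<phi> y \<partial>lborel) - (\<integral>y. g (x - y) * \<phi> y \<partial>lborel)
        - (\<integral>y. ?D (x - y) h * \<phi> y \<partial>lborel)) / norm h) \<le> M * I * norm h"
        using est[of h] by (cases "h = 0") (simp_all add: divide_le_eq power2_eq_square mult_ac)
    qed
    show "((\<lambda>h. M * I * norm h) \<longlongrightarrow> 0) (at (0::'a))"
      by (auto intro!: tendsto_eq_intros)
  qed
qed

text \<open>Differentiation falls on the kernel, which stays in \<open>S\<close>; the induction
  therefore runs over all kernels at once.\<close>

lemma convolution_C_k:
  fixes \<phi> :: "'a::euclidean_space \<Rightarrow> real"
  assumes S: "deriv_closed S" and \<phi>: "integrable lborel \<phi>"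
  shows "g \<in> S \<Longrightarrow> C_k k (\<lambda>x. \<integral>y. g (x - y) * \<phi> y \<partial>lborel)"
proof (induction k arbitrary: g)
  case 0
  have "(\<lambda>x. \<integral>y. g (x - y) * \<phi> y \<partial>lborel) differentiable (at x)" for x
    using convolution_has_derivative[OF S 0 \<phi>] by (auto simp: differentiable_def)
  then show ?case
    by (auto intro!: continuous_at_imp_continuous_on differentiable_imp_continuous_within)
next
  case (Suc k)
  let ?c = "\<lambda>g x. \<integral>y. g (x - y) * \<phi> y \<partial>lborel"
  note d = convolution_has_derivative[OF S Suc.prems \<phi>]
  have "frechet_derivative (?c g) (at x) v = ?c (\<lambda>z. frechet_derivative g (at z) v) x" for x v
    using frechet_derivative_at[OF d[of x]] by (metis (no_types, lifting))
  moreover have "(\<lambda>z. frechet_derivative g (at z) v) \<in> S" for v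
    using S Suc.prems by (auto simp: deriv_closed_def)
  moreover have "?c g differentiable (at x)" for x
    using d by (auto simp: differentiable_def)
  ultimately show ?case
    using Suc.IH[where g = "\<lambda>z. frechet_derivative g (at z) v" for v]
    by (simp only: C_k.simps) blast
qed

section \<open>Mollification\<close>

lemma sigma_finite_gagliardo_measure:
  "sigma_finite_measure (gagliardo_measure s p :: ('a::euclidean_space \<times> 'a) measure)"
proof -
  have "sigma_finite_measure (lborel \<Otimes>\<^sub>M lborel :: ('a \<times> 'a) measure)"
    unfolding lborel_prod by (rule lborel.sigma_finite_measure_axioms)
  then show ?thesis
    unfolding gagliardo_measure_def
    by (subst sigma_finite_measure.sigma_finite_iff_density_finite') auto
qed

text \<open>The supporting line of |t|^p at the mean m is integrated against the probability density
  \<rho>, and its linear term integrates to 0. An infinite right side is trivial.\<close>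

lemma weighted_jensen:
  fixes \<rho> f :: "'b \<Rightarrow> real"
  assumes p: "1 < p" and [measurable]: "\<rho> \<in> borel_measurable M" "f \<in> borel_measurable M"
    and \<rho>: "\<And>z. 0 \<le> \<rho> z" "integrable M \<rho>" "(\<integral>z. \<rho> z \<partial>M) = 1"
    and f: "integrable M (\<lambda>z. \<rho> z * f z)"
  shows "ennreal (\<bar>\<integral>z. \<rho> z * f z \<partial>M\<bar> powr p) \<le> (\<integral>\<^sup>+z. ennreal (\<rho> z * \<bar>f z\<bar> powr p) \<partial>M)"
proof (cases "(\<integral>\<^sup>+z. ennreal (\<rho> z * \<bar>f z\<bar> powr p) \<partial>M) = \<infinity>")
  case False
  then have int: "integrable M (\<lambda>z. \<rho> z * \<bar>f z\<bar> powr p)"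
    using \<rho> by (intro integrableI_nonneg) (auto simp: less_top[symmetric])
  define m where "m = (\<integral>z. \<rho> z * f z \<partial>M)"
  have "(\<integral>z. \<bar>m\<bar> powr p * \<rho> z + p * J p m * (\<rho> z * f z - m * \<rho> z) \<partial>M) \<le> (\<integral>z. \<rho> z * \<bar>f z\<bar> powr p \<partial>M)"
  proof (rule integral_mono)
    show "integrable M (\<lambda>z. \<bar>m\<bar> powr p * \<rho> z + p * J p m * (\<rho> z * f z - m * \<rho> z))"
      using \<rho> f by simp
    fix z
    have "\<rho> z * (\<bar>m\<bar> powr p + p * J p m * (f z - m)) \<le> \<rho> z * \<bar>f z\<bar> powr p"
      using J_tangent[OF p] \<rho> by (intro mult_left_mono) auto
    then show "\<bar>m\<bar> powr p * \<rho> z + p * J p m * (\<rho> z * f z - m * \<rho> z) \<le> \<rho> z * \<bar>f z\<bar> powr p"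
      by (simp add: algebra_simps)
  qed (rule int)
  also have "(\<integral>z. \<bar>m\<bar> powr p * \<rho> z + p * J p m * (\<rho> z * f z - m * \<rho> z) \<partial>M) = \<bar>m\<bar> powr p"
    using \<rho> f by (simp add: m_def[symmetric])
  finally show ?thesis
    using \<rho> by (subst nn_integral_eq_integral[OF int]) (auto simp: m_def intro: ennreal_leI)
qed (auto simp: top_unique)

text \<open>The point is that A does not depend on r. Normalizing the profile exp(-1 / (1 - |x|^2 /
  r^2)) requires a lower bound of order r^N for its integral; on the half ball the profile is at
  least exp(-4 / 3), because 1 - |x|^2 / r^2 >= 3 / 4 there.\<close>

lemma mollifier_exists:
  obtains A :: real where "0 < A"
    "\<And>r. 0 < r \<Longrightarrow> \<exists>\<rho> \<in> smooth_kernels (1 / r\<^sup>2) r. (\<forall>x :: 'a::euclidean_space. 0 \<le> \<rho> x)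
       \<and> (\<integral>x. \<rho> x \<partial>lborel) = 1 \<and> integrable lborel \<rho> \<and> (\<forall>x. \<rho> x \<le> A / r powr real DIM('a))"
proof -
  define V where "V = measure lborel (ball (0::'a) 1)"
  have V: "0 < V" unfolding V_def using content_ball_pos[of 1 "0::'a"] by simp
  define c where "c = exp (- (4 / 3)) * (1 / 2) powr real DIM('a) * V"
  have c: "0 < c" using V by (simp add: c_def)
  have "\<exists>\<rho> \<in> smooth_kernels (1 / r\<^sup>2) r. (\<forall>x :: 'a. 0 \<le> \<rho> x)
       \<and> (\<integral>x. \<rho> x \<partial>lborel) = 1 \<and> integrable lborel \<rho> \<and> (\<forall>x. \<rho> x \<le> (1 / c) / r powr real DIM('a))"
    if r: "0 < r" for r
  proof -
    define g where "g x = bump 0 (1 - 1 / r\<^sup>2 * (x \<bullet> x))" for x :: 'a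
    have q: "1 - 1 / r\<^sup>2 * (x \<bullet> x) = 1 - (norm x / r)\<^sup>2" for x :: 'a
      by (simp add: power_divide power2_norm_eq_inner)
    have g_nn: "0 \<le> g x" and g_le: "g x \<le> 1" for x
      by (auto simp: g_def bump_def)
    have g_supp: "g x = 0" if "r < norm x" for x
    proof -
      have "1 \<le> norm x / r" using that r by simp
      then have "1 \<le> (norm x / r)\<^sup>2" by simp
      then show ?thesis unfolding g_def q by (simp add: bump_def)
    qed
    have g_ge: "exp (- (4 / 3)) \<le> g x" if "x \<in> ball 0 (r / 2)" for x
    proof -
      have "norm x / r \<le> 1 / 2" using that r by (simp add: field_simps)
      then have "(norm x / r)\<^sup>2 \<le> (1 / 2)\<^sup>2" using r by (intro power_mono) auto
      then have t: "3 / 4 \<le> 1 - (norm x / r)\<^sup>2" by (simp add: power2_eq_square)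
      then have "1 / (1 - (norm x / r)\<^sup>2) \<le> 4 / 3" by (simp add: divide_le_eq)
      then show ?thesis unfolding g_def q using t by (simp add: bump_def)
    qed
    have gS: "g \<in> smooth_kernels (1 / r\<^sup>2) r"
    proof -
      have "smooth_alg (1 / r\<^sup>2) g" unfolding g_def by (rule smooth_alg.bump)
      then show ?thesis using g_supp by (simp add: smooth_kernels_def)
    qed
    have "continuous_on UNIV g"
      using deriv_closed_smooth_kernels[of "1 / r\<^sup>2" r] gS
      by (auto simp: deriv_closed_def intro!: continuous_at_imp_continuous_on differentiable_imp_continuous_within)
    then have [measurable]: "g \<in> borel_measurable borel" by (rule borel_measurable_continuous_onI)
    have int_g: "integrable lborel g"
    proof (rule Bochner_Integration.integrable_bound)
      show "integrable lborel (indicator (cball (0::'a) r) :: 'a \<Rightarrow> real)"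
        using emeasure_bounded_finite[of "cball (0::'a) r"] by simp
      show "AE x in lborel. norm (g x) \<le> norm (indicator (cball (0::'a) r) x :: real)"
        using g_nn g_le g_supp by (auto intro!: AE_I2 split: split_indicator simp: not_le)
    qed simp
    define I where "I = (\<integral>x. g x \<partial>lborel)"
    have "c * r powr real DIM('a) = exp (- (4 / 3)) * measure lborel (ball (0::'a) (r / 2))"
      using content_ball_conv_unit_ball[of "r / 2" "0::'a"] r
      by (simp add: c_def V_def powr_realpow power_divide)
    also have "\<dots> = (\<integral>x. exp (- (4 / 3)) * indicator (ball (0::'a) (r / 2)) x \<partial>lborel)"
      by simp
    also have "\<dots> \<le> I"
      unfolding I_def
    proof (rule integral_mono)
      show "integrable lborel (\<lambda>x. exp (- (4 / 3)) * indicator (ball (0::'a) (r / 2)) x :: real)"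
        using emeasure_bounded_finite[of "ball (0::'a) (r / 2)"] by simp
      show "exp (- (4 / 3)) * indicator (ball (0::'a) (r / 2)) x \<le> g x" for x
        using g_ge[of x] g_nn[of x] by (auto split: split_indicator)
    qed (rule int_g)
    finally have I: "c * r powr real DIM('a) \<le> I" .
    then have I0: "0 < I" using c r by (intro less_le_trans[OF _ I]) auto
    show ?thesis
    proof (intro bexI[of _ "\<lambda>x. 1 / I * g x"] conjI allI)
      show "0 \<le> 1 / I * g x" for x using I0 g_nn by simp
      show "(\<integral>x. 1 / I * g x \<partial>lborel) = 1" using I0 by (simp add: I_def)
      show "integrable lborel (\<lambda>x. 1 / I * g x)" using int_g by simp
      show "1 / I * g x \<le> 1 / c / r powr real DIM('a)" for x
      proof -
        have "1 / I * g x \<le> 1 / I" using g_le[of x] I0 by (simp add: divide_le_cancel)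
        also have "\<dots> \<le> 1 / (c * r powr real DIM('a))" using I I0 c r by (intro divide_left_mono) auto
        finally show ?thesis by simp
      qed
      show "(\<lambda>x. 1 / I * g x) \<in> smooth_kernels (1 / r\<^sup>2) r"
        using gS smooth_alg.mult[OF smooth_alg.const[of "1 / r\<^sup>2" "1 / I"], of g]
        unfolding smooth_kernels_def by simp
    qed
  qed
  then show ?thesis using that[of "1 / c"] c by simp
qed

lemma test_class_integrable:
  assumes p: "1 < p" and "\<phi> \<in> test_class s p \<Omega>"
  shows "integrable lborel \<phi>"
proof -
  note [measurable] = test_classD(1)[OF assms(2)]
  obtain K where K: "compact K" "\<And>x. x \<notin> K \<Longrightarrow> \<phi> x = 0"
    using assms(2) by (metis test_class_support)
  show ?thesis
  proof (rule Bochner_Integration.integrable_bound)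
    show "integrable lborel (\<lambda>x. indicator K x + \<bar>\<phi> x\<bar> powr p)"
      using emeasure_bounded_finite[OF compact_imp_bounded[OF K(1)]] borel_compact[OF K(1)] test_classD(2)[OF assms(2)]
      by (intro Bochner_Integration.integrable_add) auto
    have "\<bar>t\<bar> \<le> 1 + \<bar>t\<bar> powr p" for t :: real
      using powr_mono[of 1 p "\<bar>t\<bar>"] p by (cases "\<bar>t\<bar> \<le> 1") (auto simp: add_increasing2)
    then show "AE x in lborel. norm (\<phi> x) \<le> norm (indicator K x + \<bar>\<phi> x\<bar> powr p)"
      using K(2) by (auto intro!: AE_I2 split: split_indicator)
  qed simp
qed

text \<open>For 0 < |z| <= r the kernel satisfies \<rho>(z) <= A r^(s p) / |z|^(N + s p), and it
  vanishes beyond; Jensen's inequality thus bounds |\<psi> - \<phi>|^p by A r^(s p) times the inner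
  Gagliardo integral. For the seminorm, Jensen is combined with invariance of the Gagliardo measure
  under translating both points.\<close>

lemma mollification:
  fixes \<phi> :: "'a::euclidean_space \<Rightarrow> real"
  assumes p: "1 < p" and s: "0 < s" and om: "open \<Omega>" and \<phi>: "\<phi> \<in> test_class s p \<Omega>"
  shows "\<exists>A \<delta> :: real. 0 \<le> A \<and> 0 < \<delta> \<and> (\<forall>r. 0 < r \<and> r \<le> \<delta> \<longrightarrow> (\<exists>\<psi> \<in> smooth_compact \<Omega>.
       gagliardo_pow s p UNIV \<psi> \<le> gagliardo_pow s p UNIV \<phi> \<and>
       (\<integral>\<^sup>+x. ennreal (\<bar>\<psi> x - \<phi> x\<bar> powr p) \<partial>lborel) \<le> ennreal (A * r powr (s * p)) * gagliardo_pow s p UNIV \<phi>))"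
proof -
  obtain A where A: "0 < A" and moll: "\<And>r. 0 < r \<Longrightarrow> \<exists>\<rho> \<in> smooth_kernels (1 / r\<^sup>2) r. (\<forall>x :: 'a. 0 \<le> \<rho> x)
       \<and> (\<integral>x. \<rho> x \<partial>lborel) = 1 \<and> integrable lborel \<rho> \<and> (\<forall>x. \<rho> x \<le> A / r powr real DIM('a))"
    using mollifier_exists by metis
  note [measurable] = test_classD(1)[OF \<phi>]
  obtain K where K: "compact K" "K \<subseteq> \<Omega>" "\<And>x. x \<notin> K \<Longrightarrow> \<phi> x = 0"
    using \<phi> by (metis test_class_support)
  obtain \<delta> where \<delta>: "0 < \<delta>" "compact (\<Union>x\<in>K. cball x \<delta>)" "(\<Union>x\<in>K. cball x \<delta>) \<subseteq> \<Omega>"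
    using compact_neighbourhood[OF K(1) om K(2)] by blast
  have int\<phi>: "integrable lborel \<phi>" by (rule test_class_integrable[OF p \<phi>])
  let ?\<nu> = "gagliardo_measure s p :: ('a \<times> 'a) measure"
  have "\<exists>\<psi> \<in> smooth_compact \<Omega>.
       gagliardo_pow s p UNIV \<psi> \<le> gagliardo_pow s p UNIV \<phi> \<and>
       (\<integral>\<^sup>+x. ennreal (\<bar>\<psi> x - \<phi> x\<bar> powr p) \<partial>lborel) \<le> ennreal (A * r powr (s * p)) * gagliardo_pow s p UNIV \<phi>"
    if r: "0 < r" "r \<le> \<delta>" for r
  proof -
    obtain \<rho> where \<rho>: "\<rho> \<in> smooth_kernels (1 / r\<^sup>2) r" "\<And>x :: 'a. 0 \<le> \<rho> x"
      "(\<integral>x. \<rho> x \<partial>lborel) = 1" "integrable lborel \<rho>" "\<And>x. \<rho> x \<le> A / r powr real DIM('a)"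
      using moll[OF r(1)] by blast
    note dc = deriv_closed_smooth_kernels[of "1 / r\<^sup>2" r, where 'a='a]
    have [measurable]: "\<rho> \<in> borel_measurable borel" using \<rho>(4) by auto
    have \<rho>_supp: "\<rho> x = 0" if "r < norm x" for x using \<rho>(1) that by (simp add: smooth_kernels_def)
    define \<psi> where "\<psi> x = (\<integral>y. \<rho> (x - y) * \<phi> y \<partial>lborel)" for x
    have \<psi>_eq: "\<psi> x = (\<integral>z. \<rho> z * \<phi> (x - z) \<partial>lborel)" for x
      unfolding \<psi>_def using integral_lborel_reflect[of "\<lambda>z. \<rho> z * \<phi> (x - z)" x] by simp
    have int1: "integrable lborel (\<lambda>z. \<rho> z * \<phi> (x - z))" for x
    proof -
      have "integrable (distr lborel borel (\<lambda>z. x - z)) (\<lambda>z. \<rho> z * \<phi> (x - z))"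
        using deriv_closed_integrable[OF dc \<rho>(1) int\<phi>, of x]
        by (subst integrable_distr_eq) simp_all
      then show ?thesis by (simp only: lborel_distr_reflect)
    qed
    have smooth: "C_k k \<psi>" for k
      unfolding \<psi>_def by (rule convolution_C_k[OF dc int\<phi> \<rho>(1)])
    have [measurable]: "\<psi> \<in> borel_measurable borel"
      using smooth[of 0] by (simp add: borel_measurable_continuous_onI)
    have supp: "{x. \<psi> x \<noteq> 0} \<subseteq> (\<Union>x\<in>K. cball x \<delta>)"
    proof
      fix x assume "x \<in> {x. \<psi> x \<noteq> 0}"
      then have "\<exists>y. \<rho> (x - y) * \<phi> y \<noteq> 0"
        unfolding \<psi>_def by (metis (mono_tags, lifting) integral_zero mem_Collect_eq Bochner_Integration.integral_cong)
      then obtain y where "\<rho> (x - y) \<noteq> 0" "\<phi> y \<noteq> 0" by auto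
      then have "norm (x - y) \<le> r" "y \<in> K" using \<rho>_supp[of "x - y"] K(3)[of y] by (auto simp: not_less[symmetric])
      then show "x \<in> (\<Union>x\<in>K. cball x \<delta>)"
        using r by (intro UN_I[of y]) (auto simp: dist_norm norm_minus_commute)
    qed
    then have "closure {x. \<psi> x \<noteq> 0} \<subseteq> (\<Union>x\<in>K. cball x \<delta>)"
      using \<delta>(2) by (intro closure_minimal compact_imp_closed)
    then have "\<psi> \<in> smooth_compact \<Omega>"
      unfolding smooth_compact_def using smooth \<delta> compact_Int_closed[OF \<delta>(2) closed_closure[of "{x. \<psi> x \<noteq> 0}"]]
      by (auto simp: inf.absorb2)
    moreover have "gagliardo_pow s p UNIV \<psi> \<le> gagliardo_pow s p UNIV \<phi>"
    proof -
      interpret \<nu>: sigma_finite_measure ?\<nu> by (rule sigma_finite_gagliardo_measure)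
      interpret pair_sigma_finite ?\<nu> lborel by standard
      have "gagliardo_pow s p UNIV \<psi> = (\<integral>\<^sup>+w. ennreal (\<bar>dq \<psi> w\<bar> powr p) \<partial>?\<nu>)"
        by (rule gagliardo_pow_dq) simp
      also have "\<dots> \<le> (\<integral>\<^sup>+w. \<integral>\<^sup>+z. ennreal (\<rho> z * \<bar>\<phi> (fst w - z) - \<phi> (snd w - z)\<bar> powr p) \<partial>lborel \<partial>?\<nu>)"
      proof (rule nn_integral_mono)
        fix w :: "'a \<times> 'a"
        have "dq \<psi> w = (\<integral>z. \<rho> z * (\<phi> (fst w - z) - \<phi> (snd w - z)) \<partial>lborel)"
          unfolding dq_def \<psi>_eq using int1 by (simp add: right_diff_distrib)
        then show "ennreal (\<bar>dq \<psi> w\<bar> powr p) \<le> (\<integral>\<^sup>+z. ennreal (\<rho> z * \<bar>\<phi> (fst w - z) - \<phi> (snd w - z)\<bar> powr p) \<partial>lborel)"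
          using weighted_jensen[OF p _ _ \<rho>(2,4,3), of "\<lambda>z. \<phi> (fst w - z) - \<phi> (snd w - z)"] int1
          by (simp add: right_diff_distrib)
      qed
      also have "\<dots> = (\<integral>\<^sup>+z. \<integral>\<^sup>+w. ennreal (\<rho> z * \<bar>\<phi> (fst w - z) - \<phi> (snd w - z)\<bar> powr p) \<partial>?\<nu> \<partial>lborel)"
        by (rule Fubini'[symmetric]) measurable
      also have "\<dots> = (\<integral>\<^sup>+z. ennreal (\<rho> z) * gagliardo_pow s p UNIV \<phi> \<partial>lborel)"
      proof (rule nn_integral_cong)
        fix z
        have "(\<integral>\<^sup>+w. ennreal (\<rho> z * \<bar>\<phi> (fst w - z) - \<phi> (snd w - z)\<bar> powr p) \<partial>?\<nu>)
          = (\<integral>\<^sup>+w. ennreal (\<rho> z) * ennreal (\<bar>\<phi> (fst w - z) - \<phi> (snd w - z)\<bar> powr p) \<partial>?\<nu>)"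
          using \<rho>(2) by (simp add: ennreal_mult)
        also have "\<dots> = ennreal (\<rho> z) * (\<integral>\<^sup>+w. ennreal (\<bar>\<phi> (fst w - z) - \<phi> (snd w - z)\<bar> powr p) \<partial>?\<nu>)"
          by (rule nn_integral_cmult) measurable
        also have "(\<integral>\<^sup>+w. ennreal (\<bar>\<phi> (fst w - z) - \<phi> (snd w - z)\<bar> powr p) \<partial>?\<nu>)
          = (\<integral>\<^sup>+(x, y). ennreal (\<bar>dq \<phi> (- z + x, - z + y)\<bar> powr p) \<partial>?\<nu>)"
          by (simp add: dq_def case_prod_beta')
        also have "\<dots> = (\<integral>\<^sup>+w. ennreal (\<bar>dq \<phi> w\<bar> powr p) \<partial>?\<nu>)"
          by (rule nn_integral_gagliardo_translate) measurable
        also have "\<dots> = gagliardo_pow s p UNIV \<phi>" by (simp add: gagliardo_pow_dq)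
        finally show "(\<integral>\<^sup>+w. ennreal (\<rho> z * \<bar>\<phi> (fst w - z) - \<phi> (snd w - z)\<bar> powr p) \<partial>?\<nu>)
          = ennreal (\<rho> z) * gagliardo_pow s p UNIV \<phi>" .
      qed
      also have "\<dots> = (\<integral>\<^sup>+z. ennreal (\<rho> z) \<partial>lborel) * gagliardo_pow s p UNIV \<phi>"
        by (rule nn_integral_multc) measurable
      also have "(\<integral>\<^sup>+z. ennreal (\<rho> z) \<partial>lborel) = 1"
        using \<rho> by (subst nn_integral_eq_integral) auto
      finally show ?thesis by simp
    qed
    moreover have "(\<integral>\<^sup>+x. ennreal (\<bar>\<psi> x - \<phi> x\<bar> powr p) \<partial>lborel) \<le> ennreal (A * r powr (s * p)) * gagliardo_pow s p UNIV \<phi>"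
    proof -
      let ?k = "\<lambda>x y :: 'a. 1 / norm (x - y) powr (real DIM('a) + s * p)"
      have "(\<integral>\<^sup>+x. ennreal (\<bar>\<psi> x - \<phi> x\<bar> powr p) \<partial>lborel)
        \<le> (\<integral>\<^sup>+x. \<integral>\<^sup>+y. ennreal (A * r powr (s * p)) * (ennreal (?k x y) * ennreal (\<bar>dq \<phi> (x, y)\<bar> powr p)) \<partial>lborel \<partial>lborel)"
      proof (rule nn_integral_mono)
        fix x
        have "\<psi> x - \<phi> x = (\<integral>z. \<rho> z * \<phi> (x - z) \<partial>lborel) - (\<integral>z. \<rho> z * \<phi> x \<partial>lborel)"
          unfolding \<psi>_eq using \<rho>(3) by simp
        also have "\<dots> = (\<integral>z. \<rho> z * (\<phi> (x - z) - \<phi> x) \<partial>lborel)"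
          using int1 \<rho>(4) by (simp add: right_diff_distrib)
        finally have "ennreal (\<bar>\<psi> x - \<phi> x\<bar> powr p) \<le> (\<integral>\<^sup>+z. ennreal (\<rho> z * \<bar>\<phi> (x - z) - \<phi> x\<bar> powr p) \<partial>lborel)"
          using weighted_jensen[OF p _ _ \<rho>(2,4,3), of "\<lambda>z. \<phi> (x - z) - \<phi> x"] int1 \<rho>(4)
          by (simp add: right_diff_distrib)
        also have "\<dots> \<le> (\<integral>\<^sup>+z. ennreal (A * r powr (s * p)) * (ennreal (?k x (x - z)) * ennreal (\<bar>dq \<phi> (x, x - z)\<bar> powr p)) \<partial>lborel)"
        proof (rule nn_integral_mono)
          fix z
          have "\<rho> z * \<bar>\<phi> (x - z) - \<phi> x\<bar> powr p \<le> A * r powr (s * p) * (?k x (x - z) * \<bar>dq \<phi> (x, x - z)\<bar> powr p)"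
          proof (cases "z = 0")
            case False
            have "\<rho> z \<le> A * r powr (s * p) * (1 / norm z powr (real DIM('a) + s * p))"
            proof (cases "r < norm z")
              case True
              then show ?thesis using \<rho>_supp[OF True] A by simp
            next
              case le: False
              have "\<rho> z \<le> A / r powr real DIM('a)" by (rule \<rho>(5))
              also have "\<dots> = A * r powr (s * p) * (1 / r powr (real DIM('a) + s * p))"
                using r by (simp add: powr_add)
              also have "\<dots> \<le> A * r powr (s * p) * (1 / norm z powr (real DIM('a) + s * p))"
                using le r A s p False by (intro mult_left_mono divide_left_mono powr_mono2) auto
              finally show ?thesis .
            qed
            then have "\<rho> z * \<bar>\<phi> (x - z) - \<phi> x\<bar> powr p
              \<le> A * r powr (s * p) * (1 / norm z powr (real DIM('a) + s * p)) * \<bar>\<phi> (x - z) - \<phi> x\<bar> powr p"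
              by (intro mult_right_mono) auto
            then show ?thesis by (simp add: dq_def abs_minus_commute mult_ac)
          qed simp
          then show "ennreal (\<rho> z * \<bar>\<phi> (x - z) - \<phi> x\<bar> powr p)
            \<le> ennreal (A * r powr (s * p)) * (ennreal (?k x (x - z)) * ennreal (\<bar>dq \<phi> (x, x - z)\<bar> powr p))"
            using A by (simp add: ennreal_mult[symmetric] ennreal_leI)
        qed
        also have "\<dots> = (\<integral>\<^sup>+y. ennreal (A * r powr (s * p)) * (ennreal (?k x y) * ennreal (\<bar>dq \<phi> (x, y)\<bar> powr p)) \<partial>lborel)"
          by (rule nn_integral_lborel_reflect[where f = "\<lambda>y. ennreal (A * r powr (s * p)) * (ennreal (?k x y) * ennreal (\<bar>dq \<phi> (x, y)\<bar> powr p))"]) measurable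
        finally show "ennreal (\<bar>\<psi> x - \<phi> x\<bar> powr p) \<le> (\<integral>\<^sup>+y. ennreal (A * r powr (s * p)) * (ennreal (?k x y) * ennreal (\<bar>dq \<phi> (x, y)\<bar> powr p)) \<partial>lborel)" .
      qed
      also have "\<dots> = ennreal (A * r powr (s * p)) * gagliardo_pow s p UNIV \<phi>"
        by (subst nn_integral_cmult, measurable)+
           (simp add: gagliardo_pow_dq nn_integral_gagliardo_measure)
      finally show ?thesis .
    qed
    ultimately show ?thesis by blast
  qed
  then show ?thesis using A \<delta>(1) by (intro exI[of _ A] exI[of _ \<delta>]) simp
qed

lemma gagliardo_test_class_finite:
  assumes "\<phi> \<in> test_class s p \<Omega>"
  shows "gagliardo_pow s p UNIV \<phi> < \<infinity>"
  using test_classD[OF assms] by (intro gagliardo_pow_finite) auto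

section \<open>Fatou's lemma for real sequences and extension of the Hardy inequality\<close>

lemma nn_integral_le_of_tendsto:
  fixes f :: "nat \<Rightarrow> 'b \<Rightarrow> real"
  assumes [measurable]: "\<And>n. f n \<in> borel_measurable M"
    and lim: "AE x in M. (\<lambda>n. f n x) \<longlonglongrightarrow> g x"
  shows "(\<integral>\<^sup>+x. ennreal (g x) \<partial>M) \<le> liminf (\<lambda>n. \<integral>\<^sup>+x. ennreal (f n x) \<partial>M)"
proof -
  have "AE x in M. ennreal (g x) \<le> liminf (\<lambda>n. ennreal (f n x))"
    using lim
  proof eventually_elim
    fix x assume l: "(\<lambda>n. f n x) \<longlonglongrightarrow> g x"
    show "ennreal (g x) \<le> liminf (\<lambda>n. ennreal (f n x))"
      using lim_imp_Liminf[OF sequentially_bot tendsto_ennrealI[OF l]] by simp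
  qed
  then have "(\<integral>\<^sup>+x. ennreal (g x) \<partial>M) \<le> (\<integral>\<^sup>+x. liminf (\<lambda>n. ennreal (f n x)) \<partial>M)"
    by (rule nn_integral_mono_AE)
  also have "\<dots> \<le> liminf (\<lambda>n. \<integral>\<^sup>+x. ennreal (f n x) \<partial>M)"
    by (rule nn_integral_liminf) measurable
  finally show ?thesis .
qed

lemma nn_integral_le_bound_of_tendsto:
  fixes f :: "nat \<Rightarrow> 'b \<Rightarrow> real"
  assumes "\<And>n. f n \<in> borel_measurable M"
    and "AE x in M. (\<lambda>n. f n x) \<longlonglongrightarrow> g x"
    and C: "\<And>n. (\<integral>\<^sup>+x. ennreal (f n x) \<partial>M) \<le> C"
  shows "(\<integral>\<^sup>+x. ennreal (g x) \<partial>M) \<le> C"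
proof -
  have "liminf (\<lambda>n. \<integral>\<^sup>+x. ennreal (f n x) \<partial>M) \<le> liminf (\<lambda>n. C)"
    using C by (intro Liminf_mono always_eventually allI)
  also have "\<dots> = C" by (simp add: Liminf_const)
  finally show ?thesis using nn_integral_le_of_tendsto[OF assms(1,2)] by (rule order_trans[rotated])
qed

lemma AE_summable_of_suminf:
  fixes f :: "nat \<Rightarrow> 'b \<Rightarrow> real"
  assumes [measurable]: "\<And>n. f n \<in> borel_measurable M" and nn: "\<And>n x. 0 \<le> f n x"
    and fin: "(\<Sum>n. \<integral>\<^sup>+x. ennreal (f n x) \<partial>M) < \<infinity>"
  shows "AE x in M. summable (\<lambda>n. f n x)"
proof -
  have "(\<integral>\<^sup>+x. (\<Sum>n. ennreal (f n x)) \<partial>M) \<noteq> \<infinity>"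
    using fin by (subst nn_integral_suminf) auto
  then have "AE x in M. (\<Sum>n. ennreal (f n x)) \<noteq> \<infinity>"
    by (intro nn_integral_PInf_AE) auto
  then show ?thesis
    by eventually_elim (use nn in \<open>auto intro: summable_suminf_not_top\<close>)
qed

text \<open>The radii \<delta> 2^(-n) bound the p-th mean errors by a geometric series of ratio
  2^(-s p), so the whole sequence of mollifications converges almost everywhere. Fatou's lemma
  handles the Hardy side, while the energies never exceed that of \<phi>.\<close>

lemma hardy_test_class:
  fixes \<phi> :: "'a::euclidean_space \<Rightarrow> real"
  assumes p: "1 < p" and s: "0 < s" "s < 1" and om: "open \<Omega>"
    and hardy: "\<And>\<psi>. \<psi> \<in> smooth_compact \<Omega> \<Longrightarrow>
      (\<integral>\<^sup>+x. ennreal (l * \<bar>\<psi> x\<bar> powr p) \<partial>hardy_measure s p \<Omega>) \<le> gagliardo_pow s p UNIV \<psi>"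
    and \<phi>: "\<phi> \<in> test_class s p \<Omega>"
  shows "(\<integral>\<^sup>+x. ennreal (l * \<bar>\<phi> x\<bar> powr p) \<partial>hardy_measure s p \<Omega>) \<le> gagliardo_pow s p UNIV \<phi>"
proof -
  note [measurable] = test_classD(1)[OF \<phi>]
  have [measurable]: "\<Omega> \<in> sets borel" using om by (rule borel_open)
  let ?E = "gagliardo_pow s p UNIV \<phi>"
  have E: "?E < \<infinity>" by (rule gagliardo_test_class_finite[OF \<phi>])
  obtain A \<delta> where A: "0 \<le> A" "0 < \<delta>" and moll: "\<And>r. 0 < r \<Longrightarrow> r \<le> \<delta> \<Longrightarrow> \<exists>\<psi> \<in> smooth_compact \<Omega>.
       gagliardo_pow s p UNIV \<psi> \<le> ?E \<and>
       (\<integral>\<^sup>+x. ennreal (\<bar>\<psi> x - \<phi> x\<bar> powr p) \<partial>lborel) \<le> ennreal (A * r powr (s * p)) * ?E"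
    using mollification[OF p s(1) om \<phi>] by blast
  define r where "r n = \<delta> * (1 / 2) ^ n" for n :: nat
  have r: "0 < r n" "r n \<le> \<delta>" for n
    using A by (auto simp: r_def power_le_one mult_left_le)
  obtain \<psi> where \<psi>: "\<And>n. \<psi> n \<in> smooth_compact \<Omega>" "\<And>n. gagliardo_pow s p UNIV (\<psi> n) \<le> ?E"
    "\<And>n. (\<integral>\<^sup>+x. ennreal (\<bar>\<psi> n x - \<phi> x\<bar> powr p) \<partial>lborel) \<le> ennreal (A * r n powr (s * p)) * ?E"
    using moll[OF r] by metis
  have [measurable]: "\<psi> n \<in> borel_measurable borel" for n
  proof -
    have "C_k 0 (\<psi> n)" using \<psi>(1)[of n] unfolding smooth_compact_def by blast
    then show ?thesis by (simp add: borel_measurable_continuous_onI)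
  qed
  have "AE x in lborel. summable (\<lambda>n. \<bar>\<psi> n x - \<phi> x\<bar> powr p)"
  proof (rule AE_summable_of_suminf)
    let ?q = "(1 / 2) powr (s * p) :: real"
    have "(\<Sum>n. \<integral>\<^sup>+x. ennreal (\<bar>\<psi> n x - \<phi> x\<bar> powr p) \<partial>lborel) \<le> (\<Sum>n. ennreal (A * \<delta> powr (s * p) * ?q ^ n) * ?E)"
    proof (intro suminf_le allI)
      fix n
      have "((1 / 2) ^ n) powr (s * p) = ?q ^ n"
        by (induction n) (simp_all add: powr_mult powr_divide)
      then have "r n powr (s * p) = \<delta> powr (s * p) * ?q ^ n"
        using A by (simp add: r_def powr_mult)
      then show "(\<integral>\<^sup>+x. ennreal (\<bar>\<psi> n x - \<phi> x\<bar> powr p) \<partial>lborel) \<le> ennreal (A * \<delta> powr (s * p) * ?q ^ n) * ?E"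
        using \<psi>(3)[of n] by (simp add: mult.assoc)
    qed auto
    also have "\<dots> = (\<Sum>n. ennreal (A * \<delta> powr (s * p) * ?q ^ n)) * ?E"
      by (rule ennreal_suminf_multc)
    also have "\<dots> < \<infinity>"
    proof -
      have "?q < 1" using s p powr_less_mono'[of "1/2 :: real" 0 "s * p"] by simp
      then have "summable (\<lambda>n. A * \<delta> powr (s * p) * ?q ^ n)"
        by (intro summable_mult summable_geometric) simp
      then have "(\<Sum>n. ennreal (A * \<delta> powr (s * p) * ?q ^ n)) < \<infinity>"
        using A by (subst suminf_ennreal2) auto
      then show ?thesis using E by (simp add: ennreal_mult_less_top)
    qed
    finally show "(\<Sum>n. \<integral>\<^sup>+x. ennreal (\<bar>\<psi> n x - \<phi> x\<bar> powr p) \<partial>lborel) < \<infinity>" .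
  qed auto
  then have conv: "AE x in lborel. (\<lambda>n. \<psi> n x) \<longlonglongrightarrow> \<phi> x"
  proof eventually_elim
    fix x assume "summable (\<lambda>n. \<bar>\<psi> n x - \<phi> x\<bar> powr p)"
    then have "(\<lambda>n. \<bar>\<psi> n x - \<phi> x\<bar> powr p) \<longlonglongrightarrow> 0" by (rule summable_LIMSEQ_zero)
    then have "(\<lambda>n. (\<bar>\<psi> n x - \<phi> x\<bar> powr p) powr (1 / p)) \<longlonglongrightarrow> 0 powr (1 / p)"
      using p by (intro tendsto_powr' tendsto_const) auto
    then have "(\<lambda>n. \<bar>\<psi> n x - \<phi> x\<bar>) \<longlonglongrightarrow> 0" using p by (simp add: powr_powr)
    then show "(\<lambda>n. \<psi> n x) \<longlonglongrightarrow> \<phi> x"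
      by (simp add: tendsto_rabs_zero_iff LIM_zero_iff)
  qed
  have "AE x in hardy_measure s p \<Omega>. (\<lambda>n. \<psi> n x) \<longlonglongrightarrow> \<phi> x"
    unfolding hardy_measure_def using conv by (subst AE_density) (auto elim: eventually_mono)
  then have lim: "AE x in hardy_measure s p \<Omega>. (\<lambda>n. l * \<bar>\<psi> n x\<bar> powr p) \<longlonglongrightarrow> l * \<bar>\<phi> x\<bar> powr p"
    by eventually_elim (use p in \<open>auto intro!: tendsto_mult tendsto_powr' tendsto_rabs\<close>)
  show ?thesis
    by (rule nn_integral_le_bound_of_tendsto[OF _ lim])
      (measurable, rule order_trans[OF hardy[OF \<psi>(1)] \<psi>(2)])
qed

lemma smooth_compact_cmult:
  assumes "u \<in> smooth_compact \<Omega>" "c \<noteq> 0"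
  shows "(\<lambda>x. c * u x) \<in> smooth_compact \<Omega>"
proof -
  have "C_k k f \<Longrightarrow> C_k k (\<lambda>x. c * f x)" for k and f :: "'a \<Rightarrow> real"
  proof (induction k arbitrary: f)
    case 0
    then show ?case by (auto intro!: continuous_intros)
  next
    case (Suc k)
    have d: "((\<lambda>x. c * f x) has_derivative (\<lambda>v. c * frechet_derivative f (at x) v)) (at x)" for x
      using Suc.prems by (intro has_derivative_mult_right) (simp add: frechet_derivative_works)
    have "frechet_derivative (\<lambda>x. c * f x) (at x) v = c * frechet_derivative f (at x) v" for x v
      using frechet_derivative_at[OF d[of x]] by metis
    moreover have "(\<lambda>x. c * f x) differentiable (at x)" for x
      using d by (rule differentiableI)
    moreover have "C_k k (\<lambda>x. c * frechet_derivative f (at x) v)" for v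
      using Suc.prems by (intro Suc.IH) simp
    ultimately show ?case by simp
  qed
  then show ?thesis using assms by (simp add: smooth_compact_def)
qed

section \<open>Supersolutions imply the Hardy inequality\<close>

lemma nn_integral_hardy_measure:
  assumes [measurable]: "f \<in> borel_measurable borel" "\<Omega> \<in> sets borel" and nn: "\<And>x. 0 \<le> f x"
  shows "(\<integral>\<^sup>+x. ennreal (f x) \<partial>hardy_measure s p \<Omega>)
    = (\<integral>\<^sup>+x\<in>\<Omega>. ennreal (f x / dist_bdry \<Omega> x powr (s * p)) \<partial>lborel)"
  unfolding hardy_measure_def
  by (subst nn_integral_density)
     (auto intro!: nn_integral_cong simp: ennreal_mult[symmetric] nn split: split_indicator)

lemma integral_hardy_measure:
  assumes [measurable]: "f \<in> borel_measurable borel" "\<Omega> \<in> sets borel"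
  shows "(\<integral>x. f x \<partial>hardy_measure s p \<Omega>)
    = (LINT x:\<Omega>|lborel. f x / dist_bdry \<Omega> x powr (s * p))"
  unfolding hardy_measure_def set_lebesgue_integral_def
  by (subst integral_density) (auto intro!: Bochner_Integration.integral_cong)

lemma integrable_hardy_measure_indicator:
  assumes sp: "0 < s" "0 < p" and om: "open \<Omega>" "\<Omega> \<noteq> UNIV" and K: "compact K" "K \<subseteq> \<Omega>"
  shows "integrable (hardy_measure s p \<Omega>) (indicator K :: _ \<Rightarrow> real)"
proof -
  have [measurable]: "\<Omega> \<in> sets borel" "K \<in> sets borel" using om K by (auto intro: borel_open borel_compact)
  obtain c d where c: "0 < c" "\<And>x. x \<in> K \<Longrightarrow> c \<le> dist_bdry \<Omega> x"
    using dist_bdry_bounds[OF om K] by metis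
  have "(\<integral>\<^sup>+x. ennreal (indicator K x) \<partial>hardy_measure s p \<Omega>)
    = (\<integral>\<^sup>+x\<in>\<Omega>. ennreal (indicator K x / dist_bdry \<Omega> x powr (s * p)) \<partial>lborel)"
    by (rule nn_integral_hardy_measure) auto
  also have "\<dots> \<le> (\<integral>\<^sup>+x. ennreal (1 / c powr (s * p)) * indicator K x \<partial>lborel)"
  proof (rule nn_integral_mono)
    fix x
    have "1 / dist_bdry \<Omega> x powr (s * p) \<le> 1 / c powr (s * p)" if "x \<in> K"
      using c(1) c(2)[OF that] sp by (intro divide_left_mono powr_mono2 mult_pos_pos) auto
    then show "ennreal (indicator K x / dist_bdry \<Omega> x powr (s * p)) * indicator \<Omega> x
      \<le> ennreal (1 / c powr (s * p)) * indicator K x"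
      by (auto split: split_indicator intro: ennreal_leI)
  qed
  also have "\<dots> < \<infinity>"
    using emeasure_bounded_finite[OF compact_imp_bounded[OF K(1)]]
    by (simp add: nn_integral_cmult_indicator ennreal_mult_less_top)
  finally show ?thesis by (intro integrableI_nonneg) auto
qed

lemma integrable_hardy_measure_bounded:
  fixes f :: "'a::euclidean_space \<Rightarrow> real"
  assumes sp: "0 < s" "0 < p" and om: "open \<Omega>" "\<Omega> \<noteq> UNIV" and K: "compact K" "K \<subseteq> \<Omega>"
    and [measurable]: "f \<in> borel_measurable borel"
    and f: "\<And>x. \<bar>f x\<bar> \<le> B" "\<And>x. x \<notin> K \<Longrightarrow> f x = 0"
  shows "integrable (hardy_measure s p \<Omega>) f"
proof (rule Bochner_Integration.integrable_bound)
  show "integrable (hardy_measure s p \<Omega>) (\<lambda>x. B * indicator K x)"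
    using integrable_hardy_measure_indicator[OF sp om K] by (rule integrable_mult_right)
  show "AE x in hardy_measure s p \<Omega>. norm (f x) \<le> norm (B * indicator K x)"
    using f by (auto intro!: AE_I2 order_trans[OF f(1)] split: split_indicator)
qed measurable

lemma smooth_compact_properties:
  fixes \<phi> :: "'a::euclidean_space \<Rightarrow> real"
  assumes "\<phi> \<in> smooth_compact \<Omega>"
  obtains K B where "compact K" "K \<subseteq> \<Omega>" "\<And>x. x \<notin> K \<Longrightarrow> \<phi> x = 0" "\<And>x. \<bar>\<phi> x\<bar> \<le> B"
    "\<phi> \<in> borel_measurable borel"
proof -
  define K where "K = closure {x. \<phi> x \<noteq> 0}"
  have K: "compact K" "K \<subseteq> \<Omega>" using assms by (auto simp: smooth_compact_def K_def)
  have out: "\<phi> x = 0" if "x \<notin> K" for x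
    using that closure_subset[of "{x. \<phi> x \<noteq> 0}"] by (auto simp: K_def)
  have "C_k 0 \<phi>" using assms unfolding smooth_compact_def by blast
  then have cont: "continuous_on UNIV \<phi>" by simp
  then have "bounded (\<phi> ` K)"
    by (intro compact_imp_bounded compact_continuous_image K(1)) (auto intro: continuous_on_subset)
  then obtain B where "\<forall>x\<in>K. \<bar>\<phi> x\<bar> \<le> B" unfolding bounded_iff by auto
  then have "\<bar>\<phi> x\<bar> \<le> max B 0" for x using out[of x] by (cases "x \<in> K") auto
  then show ?thesis
    using that[of K "max B 0"] K out borel_measurable_continuous_onI[OF cont] by blast
qed

text \<open>Picone's inequality needs a non-negative function; passing to the absolute value keeps
  the Hardy integral and does not raise the seminorm.\<close>

lemma smooth_compact_abs_test_class:
  fixes \<phi> :: "'a::euclidean_space \<Rightarrow> real"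
  assumes p: "1 < p" and \<phi>: "\<phi> \<in> smooth_compact \<Omega>" and fin: "gagliardo_pow s p UNIV \<phi> < \<infinity>"
  shows "(\<lambda>x. \<bar>\<phi> x\<bar>) \<in> test_class s p \<Omega>"
    "gagliardo_pow s p UNIV (\<lambda>x. \<bar>\<phi> x\<bar>) \<le> gagliardo_pow s p UNIV \<phi>"
proof -
  obtain K B where K: "compact K" "K \<subseteq> \<Omega>" "\<And>x. x \<notin> K \<Longrightarrow> \<phi> x = 0" and B: "\<And>x. \<bar>\<phi> x\<bar> \<le> B"
    and [measurable]: "\<phi> \<in> borel_measurable borel"
    using smooth_compact_properties[OF \<phi>] by blast
  have le: "\<bar>dq (\<lambda>x. \<bar>\<phi> x\<bar>) z\<bar> powr p \<le> \<bar>dq \<phi> z\<bar> powr p" for z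
    using p by (intro powr_mono2) (auto simp: dq_def)
  then show E: "gagliardo_pow s p UNIV (\<lambda>x. \<bar>\<phi> x\<bar>) \<le> gagliardo_pow s p UNIV \<phi>"
    by (simp add: gagliardo_pow_dq) (intro nn_integral_mono ennreal_leI)
  have "integrable (gagliardo_measure s p) (\<lambda>z. \<bar>dq (\<lambda>x. \<bar>\<phi> x\<bar>) z\<bar> powr p)"
    using le_less_trans[OF E fin] by (subst integrable_powr_abs_iff) (simp_all add: gagliardo_pow_dq)
  moreover have "integrable lborel (\<lambda>x. \<bar>\<phi> x\<bar> powr p)"
    using p by (intro integrable_powr_bounded_support[OF _ K(1,3) B]) auto
  ultimately show "(\<lambda>x. \<bar>\<phi> x\<bar>) \<in> test_class s p \<Omega>"
    using K by (auto simp: test_class_def)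
qed

text \<open>Both sides are homogeneous of degree p, so the normalization in
  \<open>hardy_const\<close> is reached by the factor c with c^p = 1 / I, where I is the Hardy
  integral. It is finite because the weight is bounded on the support, and I = 0 is trivial.\<close>

lemma hardy_smooth_compact:
  fixes \<psi> :: "'a::euclidean_space \<Rightarrow> real"
  assumes p: "1 < p" and s: "0 < s" and om: "open \<Omega>" "\<Omega> \<noteq> UNIV"
    and l: "0 \<le> l" "ennreal l \<le> hardy_const s p \<Omega>" and \<psi>: "\<psi> \<in> smooth_compact \<Omega>"
  shows "(\<integral>\<^sup>+x. ennreal (l * \<bar>\<psi> x\<bar> powr p) \<partial>hardy_measure s p \<Omega>) \<le> gagliardo_pow s p UNIV \<psi>"
proof -
  have [measurable]: "\<Omega> \<in> sets borel" using om by (auto intro: borel_open)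
  obtain K B where K: "compact K" "K \<subseteq> \<Omega>" "\<And>x. x \<notin> K \<Longrightarrow> \<psi> x = 0" and B: "\<And>x. \<bar>\<psi> x\<bar> \<le> B"
    and [measurable]: "\<psi> \<in> borel_measurable borel"
    using smooth_compact_properties[OF \<psi>] by blast
  have int: "integrable (hardy_measure s p \<Omega>) (\<lambda>x. \<bar>\<psi> x\<bar> powr p)"
    using B K p s by (intro integrable_hardy_measure_bounded[OF s _ om K(1,2), where B = "B powr p"]) (auto intro!: powr_mono2)
  define I where "I = (\<integral>x. \<bar>\<psi> x\<bar> powr p \<partial>hardy_measure s p \<Omega>)"
  have I0: "0 \<le> I" by (simp add: I_def)
  have nnI: "(\<integral>\<^sup>+x. ennreal (\<bar>\<psi> x\<bar> powr p) \<partial>hardy_measure s p \<Omega>) = ennreal I"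
    unfolding I_def using int by (intro nn_integral_eq_integral) auto
  have lI: "(\<integral>\<^sup>+x. ennreal (l * \<bar>\<psi> x\<bar> powr p) \<partial>hardy_measure s p \<Omega>) = ennreal (l * I)"
    unfolding I_def using int l by (subst nn_integral_eq_integral) auto
  show ?thesis
  proof (cases "I = 0")
    case False
    define c where "c = (1 / I) powr (1 / p)"
    have c: "0 < c" "c powr p = 1 / I" using False I0 p by (auto simp: c_def powr_powr)
    have "(\<integral>\<^sup>+x\<in>\<Omega>. ennreal (\<bar>c * \<psi> x\<bar> powr p / dist_bdry \<Omega> x powr (s * p)) \<partial>lborel)
      = (\<integral>\<^sup>+x. ennreal (\<bar>c * \<psi> x\<bar> powr p) \<partial>hardy_measure s p \<Omega>)"
      by (rule nn_integral_hardy_measure[symmetric]) auto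
    also have "\<dots> = (\<integral>\<^sup>+x. ennreal (1 / I) * ennreal (\<bar>\<psi> x\<bar> powr p) \<partial>hardy_measure s p \<Omega>)"
      using c I0 by (intro nn_integral_cong) (simp add: abs_mult powr_mult ennreal_mult[symmetric])
    also have "\<dots> = ennreal (1 / I) * ennreal I"
      by (subst nn_integral_cmult) (simp_all add: nnI)
    also have "\<dots> = 1" using False I0 by (simp add: ennreal_mult[symmetric])
    finally have "hardy_const s p \<Omega> \<le> gagliardo_pow s p UNIV (\<lambda>x. c * \<psi> x)"
      unfolding hardy_const_def using smooth_compact_cmult[OF \<psi>, of c] c by (intro INF_lower) auto
    also have "\<dots> = ennreal (1 / I) * gagliardo_pow s p UNIV \<psi>"
    proof -
      have "\<bar>dq (\<lambda>x. c * \<psi> x) z\<bar> powr p = 1 / I * \<bar>dq \<psi> z\<bar> powr p" for z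
      proof -
        have "dq (\<lambda>x. c * \<psi> x) z = c * dq \<psi> z" by (simp add: dq_def right_diff_distrib)
        then show ?thesis using c by (simp add: abs_mult powr_mult)
      qed
      then show ?thesis
        using I0 by (simp add: gagliardo_pow_dq ennreal_mult nn_integral_cmult del: times_divide_eq_left)
    qed
    finally have "ennreal l \<le> ennreal (1 / I) * gagliardo_pow s p UNIV \<psi>" using l by simp
    then have "ennreal I * ennreal l \<le> ennreal I * (ennreal (1 / I) * gagliardo_pow s p UNIV \<psi>)"
      by (rule mult_left_mono) simp
    also have "\<dots> = (ennreal I * ennreal (1 / I)) * gagliardo_pow s p UNIV \<psi>"
      by (simp only: mult.assoc)
    also have "ennreal I * ennreal (1 / I) = 1" using False I0 by (simp add: ennreal_mult[symmetric])
    finally show ?thesis using I0 l by (simp add: lI ennreal_mult[symmetric] mult.commute)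
  qed (simp add: lI)
qed

text \<open>The degenerate cases agree with the bound: a non-integrable Bochner integral has the
  value 0, and \<open>ennreal\<close> sends negative numbers to 0.\<close>

lemma ennreal_integral_le_nn_integral:
  fixes f g :: "'b \<Rightarrow> real"
  assumes le: "AE x in M. f x \<le> g x"
  shows "ennreal (\<integral>x. f x \<partial>M) \<le> (\<integral>\<^sup>+x. ennreal (g x) \<partial>M)"
proof (cases "integrable M f")
  case True
  have "(\<integral>x. f x \<partial>M) \<le> (\<integral>x. max 0 (f x) \<partial>M)"
    using True by (intro integral_mono) auto
  then have "ennreal (\<integral>x. f x \<partial>M) \<le> ennreal (\<integral>x. max 0 (f x) \<partial>M)" by (rule ennreal_leI)
  also have "\<dots> = (\<integral>\<^sup>+x. ennreal (max 0 (f x)) \<partial>M)"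
    using True by (intro nn_integral_eq_integral[symmetric]) auto
  also have "\<dots> \<le> (\<integral>\<^sup>+x. ennreal (g x) \<partial>M)"
    using le by (intro nn_integral_mono_AE) (auto elim!: eventually_mono simp: max_def intro: ennreal_leI)
  finally show ?thesis .
qed (simp add: not_integrable_integral_eq)

text \<open>Shifting u by \<epsilon> leaves differences unchanged and makes it positive, so Picone's
  inequality applies at almost every pair.\<close>

lemma picone_form_le:
  fixes \<eta> u :: "'a::euclidean_space \<Rightarrow> real"
  assumes p: "1 < p" and e: "0 < \<epsilon>" and eta [measurable]: "\<eta> \<in> borel_measurable borel" and eta0: "\<And>x. 0 \<le> \<eta> x"
    and u [measurable]: "u \<in> borel_measurable borel" and u0: "AE x in lborel. 0 \<le> u x"
  shows "ennreal (frac_plap_form s p u (\<lambda>x. \<eta> x powr p / (max 0 (u x) + \<epsilon>) powr (p - 1)))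
    \<le> gagliardo_pow s p UNIV \<eta>"
proof -
  let ?\<psi> = "\<lambda>x. \<eta> x powr p / (max 0 (u x) + \<epsilon>) powr (p - 1)"
  have "AE z in gagliardo_measure s p. J p (dq u z) * dq ?\<psi> z \<le> \<bar>dq \<eta> z\<bar> powr p"
    using AE_gagliardo_measure[OF u0]
  proof eventually_elim
    fix z :: "'a \<times> 'a" assume z: "0 \<le> u (fst z) \<and> 0 \<le> u (snd z)"
    then have "dq u z = (u (fst z) + \<epsilon>) - (u (snd z) + \<epsilon>)" by (simp add: dq_def)
    then show "J p (dq u z) * dq ?\<psi> z \<le> \<bar>dq \<eta> z\<bar> powr p"
      using picone[OF p eta0[of "fst z"] eta0[of "snd z"], of "u (snd z) + \<epsilon>" "u (fst z) + \<epsilon>"] z e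
      by (simp add: dq_def)
  qed
  then have "ennreal (\<integral>z. J p (dq u z) * dq ?\<psi> z \<partial>gagliardo_measure s p)
      \<le> (\<integral>\<^sup>+z. ennreal (\<bar>dq \<eta> z\<bar> powr p) \<partial>gagliardo_measure s p)"
    by (rule ennreal_integral_le_nn_integral)
  then show ?thesis
    by (simp add: frac_plap_form_eq gagliardo_pow_dq dq_def case_prod_beta')
qed

text \<open>Measurability is given only after cutting off to compact sets; the function is the
  pointwise limit of its cut-offs to balls of radius n.\<close>

lemma borel_measurable_of_Leb_loc_UNIV:
  assumes "u \<in> Leb_loc \<beta> UNIV"
  shows "u \<in> borel_measurable borel"
proof -
  have [measurable]: "(\<lambda>x. indicator (cball 0 (real n)) x * u x) \<in> borel_measurable borel" for n
    using assms by (auto simp: Leb_loc_def Leb_def set_borel_measurable_def)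
  show ?thesis
  proof (rule borel_measurable_LIMSEQ_real)
    fix x :: 'a
    have "\<forall>\<^sub>F n in sequentially. indicator (cball 0 (real n)) x * u x = u x"
      using eventually_ge_at_top[of "nat \<lceil>norm x\<rceil>"]
      by eventually_elim (auto split: split_indicator simp: nat_ceiling_le_eq)
    then show "(\<lambda>n. indicator (cball 0 (real n)) x * u x) \<longlonglongrightarrow> u x"
      by (rule tendsto_eventually)
  qed measurable
qed

lemma local_weak_supersolution_test:
  assumes sup: "local_weak_supersolution s p \<Omega> \<mu> u" and [measurable]: "\<Omega> \<in> sets borel" "u \<in> borel_measurable borel"
    and \<phi>: "\<phi> \<in> test_class s p \<Omega>" "\<And>x. 0 \<le> \<phi> x"
  shows "\<mu> * (\<integral>x. J p (u x) * \<phi> x \<partial>hardy_measure s p \<Omega>) \<le> frac_plap_form s p u \<phi>"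
proof -
  note [measurable] = test_classD(1)[OF \<phi>(1)]
  have "\<mu> * (LINT x:\<Omega>|lborel. J p (u x) / dist_bdry \<Omega> x powr (s * p) * \<phi> x) \<le> frac_plap_form s p u \<phi>"
    using sup test_class_imp_admissible[OF \<phi>(1)] \<phi>(2) unfolding local_weak_supersolution_def by blast
  also have "(LINT x:\<Omega>|lborel. J p (u x) / dist_bdry \<Omega> x powr (s * p) * \<phi> x)
    = (\<integral>x. J p (u x) * \<phi> x \<partial>hardy_measure s p \<Omega>)"
    by (subst integral_hardy_measure) simp_all
  finally show ?thesis .
qed

text \<open>If the form happens not to be integrable then its value is 0, and the Picone bound
  survives, so no integrability has to be checked.\<close>

lemma supersolution_imp_hardy:
  fixes \<eta> u :: "'a::euclidean_space \<Rightarrow> real"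
  assumes p: "1 < p" and s: "0 < s" "s < 1" and om: "open \<Omega>" "\<Omega> \<noteq> UNIV" and mu: "0 \<le> \<mu>"
    and pos: "positive_in \<Omega> u" and sup: "local_weak_supersolution s p \<Omega> \<mu> u"
    and eta: "\<eta> \<in> test_class s p \<Omega>" "\<And>x. 0 \<le> \<eta> x" "\<And>x. \<eta> x \<le> B"
  shows "(\<integral>\<^sup>+x. ennreal (\<mu> * \<eta> x powr p) \<partial>hardy_measure s p \<Omega>) \<le> gagliardo_pow s p UNIV \<eta>"
proof -
  have [measurable]: "\<Omega> \<in> sets borel" using om by (auto intro: borel_open)
  note [measurable] = test_classD(1)[OF eta(1)]
  have "u \<in> Tail (p - 1) (s * p)" and loc: "u \<in> Sobolev_loc s p \<Omega>"
    using sup by (auto simp: local_weak_supersolution_def)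
  then have u [measurable]: "u \<in> borel_measurable borel"
    by (auto simp: Tail_def intro: borel_measurable_of_Leb_loc_UNIV)
  have u0: "AE x in lborel. 0 \<le> u x" and u_pos: "AE x in lborel. x \<in> \<Omega> \<longrightarrow> 0 < u x"
    using pos by (auto simp: positive_in_def)
  obtain K where K: "compact K" "K \<subseteq> \<Omega>" "\<And>x. x \<notin> K \<Longrightarrow> \<eta> x = 0"
    using eta by (metis test_class_support)
  let ?\<psi> = "\<lambda>\<epsilon> x. \<eta> x powr p / (max 0 (u x) + \<epsilon>) powr (p - 1)"
  let ?f = "\<lambda>\<epsilon> x. \<mu> * (max 0 (u x) powr (p - 1) * ?\<psi> \<epsilon> x)"
  \<comment> \<open>The left integrand is at most \<mu> \<eta>^p for every \<epsilon>, hence bounded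
    with compact support, and the right side does not depend on \<epsilon>.\<close>
  have bound: "(\<integral>\<^sup>+x. ennreal (?f \<epsilon> x) \<partial>hardy_measure s p \<Omega>) \<le> gagliardo_pow s p UNIV \<eta>"
    if e: "0 < \<epsilon>" for \<epsilon>
  proof -
    have \<psi>: "?\<psi> \<epsilon> \<in> test_class s p \<Omega>"
      by (rule test_class_picone[OF p s om(1) e eta u])
         (use loc in \<open>auto simp: Sobolev_loc_def Sobolev_def\<close>)
    have "\<mu> * (\<integral>x. J p (u x) * ?\<psi> \<epsilon> x \<partial>hardy_measure s p \<Omega>) \<le> frac_plap_form s p u (?\<psi> \<epsilon>)"
      by (rule local_weak_supersolution_test[OF sup _ _ \<psi>]) simp_all
    also have "\<mu> * (\<integral>x. J p (u x) * ?\<psi> \<epsilon> x \<partial>hardy_measure s p \<Omega>) = (\<integral>x. ?f \<epsilon> x \<partial>hardy_measure s p \<Omega>)"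
    proof -
      have "AE x in hardy_measure s p \<Omega>. J p (u x) * ?\<psi> \<epsilon> x = max 0 (u x) powr (p - 1) * ?\<psi> \<epsilon> x"
        unfolding AE_hardy_measure_iff[OF om] using u0 by eventually_elim (simp add: J_nonneg)
      then have "(\<integral>x. J p (u x) * ?\<psi> \<epsilon> x \<partial>hardy_measure s p \<Omega>)
        = (\<integral>x. max 0 (u x) powr (p - 1) * ?\<psi> \<epsilon> x \<partial>hardy_measure s p \<Omega>)"
        by (intro integral_cong_AE) measurable
      then show ?thesis by (simp only: integral_mult_right_zero)
    qed
    finally have le: "(\<integral>x. ?f \<epsilon> x \<partial>hardy_measure s p \<Omega>) \<le> frac_plap_form s p u (?\<psi> \<epsilon>)" .
    have "integrable (hardy_measure s p \<Omega>) (?f \<epsilon>)"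
    proof (rule integrable_hardy_measure_bounded[OF s(1) _ om K(1,2)])
      fix x
      have "max 0 (u x) powr (p - 1) \<le> (max 0 (u x) + \<epsilon>) powr (p - 1)"
        using p e by (intro powr_mono2) auto
      then have "max 0 (u x) powr (p - 1) * ?\<psi> \<epsilon> x \<le> \<eta> x powr p"
        using e by (simp add: divide_le_eq mult_left_mono mult.commute)
      also have "\<dots> \<le> B powr p" using eta p by (intro powr_mono2) auto
      finally have "?f \<epsilon> x \<le> \<mu> * B powr p"
        using mu by (rule mult_left_mono)
      moreover have "0 \<le> ?f \<epsilon> x" using mu by simp
      ultimately show "\<bar>?f \<epsilon> x\<bar> \<le> \<mu> * B powr p" by linarith
      show "?f \<epsilon> x = 0" if "x \<notin> K" using K(3)[OF that] by simp
    qed (use p in auto)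
    then have "(\<integral>\<^sup>+x. ennreal (?f \<epsilon> x) \<partial>hardy_measure s p \<Omega>) = ennreal (\<integral>x. ?f \<epsilon> x \<partial>hardy_measure s p \<Omega>)"
      using mu by (intro nn_integral_eq_integral) auto
    also have "\<dots> \<le> ennreal (frac_plap_form s p u (?\<psi> \<epsilon>))" using le by (rule ennreal_leI)
    also have "\<dots> \<le> gagliardo_pow s p UNIV \<eta>"
      by (rule picone_form_le[OF p e _ eta(2) u u0]) simp
    finally show ?thesis .
  qed
  define \<epsilon> where "\<epsilon> n = inverse (real (Suc n))" for n
  have \<epsilon>: "0 < \<epsilon> n" "\<epsilon> \<longlonglongrightarrow> 0" for n
    using LIMSEQ_inverse_real_of_nat unfolding \<epsilon>_def[abs_def] by (simp, blast)
  have lim: "AE x in hardy_measure s p \<Omega>. (\<lambda>n. ?f (\<epsilon> n) x) \<longlonglongrightarrow> \<mu> * \<eta> x powr p"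
    unfolding AE_hardy_measure_iff[OF om] using u_pos
  proof (eventually_elim, intro impI)
    fix x assume "x \<in> \<Omega> \<longrightarrow> 0 < u x" "x \<in> \<Omega>"
    then have x: "0 < u x" by simp
    \<comment> \<open>Strict positivity of u enters here: in the limit \<epsilon> = 0 the power u^(p
      - 1) cancels against the denominator.\<close>
    have "(\<lambda>n. ?f (\<epsilon> n) x) \<longlonglongrightarrow> \<mu> * (max 0 (u x) powr (p - 1) * (\<eta> x powr p / (max 0 (u x) + 0) powr (p - 1)))"
      using x p by (intro tendsto_intros \<epsilon>(2)) auto
    also have "\<mu> * (max 0 (u x) powr (p - 1) * (\<eta> x powr p / (max 0 (u x) + 0) powr (p - 1))) = \<mu> * \<eta> x powr p"
      using x by simp
    finally show "(\<lambda>n. ?f (\<epsilon> n) x) \<longlonglongrightarrow> \<mu> * \<eta> x powr p" .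
  qed
  show ?thesis
    by (rule nn_integral_le_bound_of_tendsto[OF _ lim]) (measurable, rule bound[OF \<epsilon>(1)])
qed

lemma supersolution_le_hardy_const:
  fixes u :: "'a::euclidean_space \<Rightarrow> real"
  assumes p: "1 < p" and s: "0 < s" "s < 1" and om: "open \<Omega>" "\<Omega> \<noteq> UNIV" and mu: "0 \<le> \<mu>"
    and pos: "positive_in \<Omega> u" and sup: "local_weak_supersolution s p \<Omega> \<mu> u"
  shows "ennreal \<mu> \<le> hardy_const s p \<Omega>"
  unfolding hardy_const_def
proof (rule INF_greatest)
  fix \<phi> :: "'a \<Rightarrow> real"
  assume "\<phi> \<in> {u \<in> smooth_compact \<Omega>.
    (\<integral>\<^sup>+x\<in>\<Omega>. ennreal (\<bar>u x\<bar> powr p / dist_bdry \<Omega> x powr (s * p)) \<partial>lborel) = 1}"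
  note \<phi>_both = CollectD[OF this]
  note \<phi> = conjunct1[OF \<phi>_both] and norm = conjunct2[OF \<phi>_both]
  have [measurable]: "\<Omega> \<in> sets borel" using om(1) by (rule borel_open)
  obtain B where B: "\<And>x. \<bar>\<phi> x\<bar> \<le> B" and [measurable]: "\<phi> \<in> borel_measurable borel"
    using smooth_compact_properties[OF \<phi>] by metis
  show "ennreal \<mu> \<le> gagliardo_pow s p UNIV \<phi>"
  \<comment> \<open>An infinite seminorm is trivial; finiteness is what puts |\<phi>| into the test
    class.\<close>
  proof (cases "gagliardo_pow s p UNIV \<phi> < \<infinity>")
    case True
    note abs = smooth_compact_abs_test_class[OF p \<phi> True]
    have "(\<integral>\<^sup>+x. ennreal (\<bar>\<phi> x\<bar> powr p) \<partial>hardy_measure s p \<Omega>) = 1"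
      by (subst nn_integral_hardy_measure) (simp_all add: norm)
    then have "ennreal \<mu> = ennreal \<mu> * (\<integral>\<^sup>+x. ennreal (\<bar>\<phi> x\<bar> powr p) \<partial>hardy_measure s p \<Omega>)" by simp
    also have "\<dots> = (\<integral>\<^sup>+x. ennreal (\<mu> * \<bar>\<phi> x\<bar> powr p) \<partial>hardy_measure s p \<Omega>)"
      using mu by (subst nn_integral_cmult[symmetric]) (simp_all add: ennreal_mult)
    also have "\<dots> \<le> gagliardo_pow s p UNIV (\<lambda>x. \<bar>\<phi> x\<bar>)"
      by (rule supersolution_imp_hardy[OF p s om mu pos sup abs(1) _ B]) simp
    also have "\<dots> \<le> gagliardo_pow s p UNIV \<phi>" by (rule abs(2))
    finally show ?thesis .
  qed (simp add: not_less top_unique)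
qed

section \<open>Minimization below the Hardy constant\<close>

lemma fatou_integrable:
  fixes f :: "nat \<Rightarrow> 'b \<Rightarrow> real"
  assumes f: "\<And>n. integrable M (f n)" "\<And>n x. 0 \<le> f n x" and [measurable]: "g \<in> borel_measurable M"
    and lim: "AE x in M. (\<lambda>n. f n x) \<longlonglongrightarrow> g x" and C: "\<And>n. (\<integral>x. f n x \<partial>M) \<le> C"
  shows "integrable M g"
proof -
  have "AE x in M. 0 \<le> g x"
    using lim by eventually_elim (use f(2) in \<open>auto intro: LIMSEQ_le_const\<close>)
  moreover have "(\<integral>\<^sup>+x. ennreal (g x) \<partial>M) \<le> ennreal C"
    by (rule nn_integral_le_bound_of_tendsto[OF _ lim])
      (use f C in \<open>auto simp: nn_integral_eq_integral ennreal_leI\<close>)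
  ultimately show ?thesis by (intro integrableI_nonneg) (auto intro: le_less_trans)
qed

text \<open>Fatou's lemma with a slack h, as a strict inequality valid from some index on, so that
  several such bounds can be used at one common index.\<close>

lemma fatou_eventually:
  fixes f :: "nat \<Rightarrow> 'b \<Rightarrow> real"
  assumes f: "\<And>n. integrable M (f n)" "\<And>n x. 0 \<le> f n x" and g: "integrable M g"
    and lim: "AE x in M. (\<lambda>n. f n x) \<longlonglongrightarrow> g x" and h: "0 < h"
  shows "\<forall>\<^sub>F n in sequentially. (\<integral>x. g x \<partial>M) - h < (\<integral>x. f n x \<partial>M)"
proof (cases "(\<integral>x. g x \<partial>M) - h < 0")
  \<comment> \<open>A negative lower bound is treated apart, since \<open>ennreal\<close> would clip
    it to 0.\<close>
  case True
  moreover have "0 \<le> (\<integral>x. f n x \<partial>M)" for n using f by simp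
  ultimately show ?thesis by (intro always_eventually allI) (meson less_le_trans)
next
  case False
  have [measurable]: "f n \<in> borel_measurable M" for n using f(1) by auto
  have g0: "AE x in M. 0 \<le> g x"
    using lim by eventually_elim (use f(2) in \<open>auto intro: LIMSEQ_le_const\<close>)
  have "ennreal ((\<integral>x. g x \<partial>M) - h) < ennreal (\<integral>x. g x \<partial>M)"
    using h False by (subst ennreal_less_iff) auto
  also have "\<dots> = (\<integral>\<^sup>+x. ennreal (g x) \<partial>M)"
    using g g0 by (rule nn_integral_eq_integral[symmetric])
  also have "\<dots> \<le> liminf (\<lambda>n. \<integral>\<^sup>+x. ennreal (f n x) \<partial>M)"
    by (rule nn_integral_le_of_tendsto[OF _ lim]) measurable
  also have "\<dots> = liminf (\<lambda>n. ennreal (\<integral>x. f n x \<partial>M))"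
    using f by (simp add: nn_integral_eq_integral)
  finally have "\<forall>\<^sub>F n in sequentially. ennreal ((\<integral>x. g x \<partial>M) - h) < ennreal (\<integral>x. f n x \<partial>M)"
    by (rule less_LiminfD)
  then show ?thesis
    by eventually_elim (use False in \<open>simp add: ennreal_less_iff\<close>)
qed

lemma le_of_forall_small:
  fixes X Y C :: real
  assumes "\<And>h. 0 < h \<Longrightarrow> X \<le> Y + h * C"
  shows "X \<le> Y"
proof (rule field_le_epsilon)
  fix e :: real assume e: "0 < e"
  define h where "h = e / (\<bar>C\<bar> + 1)"
  have h: "0 < h" using e by (simp add: h_def)
  have "h * C \<le> h * (\<bar>C\<bar> + 1)" using h by (intro mult_left_mono) auto
  also have "\<dots> = e" by (simp add: h_def add_nonneg_eq_0_iff)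
  finally show "X \<le> Y + e" using assms[OF h] by linarith
qed

text \<open>A limit g < 1 of the transformed sequence can be inverted by g / (1 - g). A limit 1
  would mean escape to infinity: a_n^p would eventually be at least L + 1, where L is the finite
  lower limit.\<close>

lemma sat_bounded_imp_convergent:
  fixes a :: "nat \<Rightarrow> real"
  assumes a: "\<And>n. 0 \<le> a n" and conv: "convergent (\<lambda>n. sat (a n))" and p: "0 < p"
    and fin: "liminf (\<lambda>n. ennreal (a n powr p)) < \<infinity>"
  shows "convergent a"
proof -
  obtain g where g: "(\<lambda>n. sat (a n)) \<longlonglongrightarrow> g" using conv by (auto simp: convergent_def)
  have "g < 1"
  proof (rule ccontr)
    assume "\<not> g < 1"
    obtain L where L: "0 \<le> L" "liminf (\<lambda>n. ennreal (a n powr p)) = ennreal L"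
      using fin by (cases "liminf (\<lambda>n. ennreal (a n powr p))") auto
    define R where "R = (L + 1) powr (1 / p)"
    have R: "0 \<le> R" "R powr p = L + 1" using L p by (auto simp: R_def powr_powr)
    have "sat R < g" using sat_less_1[OF R(1)] \<open>\<not> g < 1\<close> by simp
    then have "\<forall>\<^sub>F n in sequentially. sat R < sat (a n)" using g by (rule order_tendstoD(1)[rotated])
    then have "\<forall>\<^sub>F n in sequentially. ennreal (L + 1) \<le> ennreal (a n powr p)"
    proof eventually_elim
      fix n assume "sat R < sat (a n)"
      then have "R \<le> a n" using sat_mono[OF a, of n R] by (meson not_le less_imp_le)
      then show "ennreal (L + 1) \<le> ennreal (a n powr p)"
        unfolding R(2)[symmetric] using R p by (intro ennreal_leI powr_mono2) auto
    qed
    then have "ennreal (L + 1) \<le> ennreal L" using Liminf_bounded L(2) by metis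
    then show False using L(1) by (simp add: ennreal_le_iff)
  qed
  then have "(\<lambda>n. sat (a n) / (1 - sat (a n))) \<longlonglongrightarrow> g / (1 - g)"
    by (intro tendsto_intros g) auto
  moreover have "sat (a n) / (1 - sat (a n)) = a n" for n
  proof -
    have "1 + a n \<noteq> 0" using a[of n] by linarith
    then show ?thesis by (simp add: sat_def field_simps)
  qed
  ultimately show ?thesis by (auto simp: convergent_def)
qed

text \<open>One has |d| <= 2^(-n) + 2^n d^2, by comparing |d| with 2^(-n); so the weighted squares
  control the absolute increments.\<close>

lemma weighted_square_summable_imp_convergent:
  fixes a :: "nat \<Rightarrow> real"
  assumes "summable (\<lambda>n. 2 ^ n * (a (Suc n) - a n)\<^sup>2)"
  shows "convergent a"
proof -
  have le: "\<bar>d\<bar> \<le> (1 / 2) ^ n + 2 ^ n * d\<^sup>2" for d :: real and n :: nat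
  proof (cases "\<bar>d\<bar> \<le> (1 / 2) ^ n")
    case True
    then show ?thesis by (simp add: add_increasing2)
  next
    case False
    then have "1 \<le> 2 ^ n * \<bar>d\<bar>" by (simp add: power_divide field_simps)
    then have "\<bar>d\<bar> * 1 \<le> \<bar>d\<bar> * (2 ^ n * \<bar>d\<bar>)" by (intro mult_left_mono) auto
    also have "\<dots> = 2 ^ n * d\<^sup>2" by (simp add: power2_eq_square)
    finally show ?thesis by (simp add: add_increasing)
  qed
  have "summable (\<lambda>n. (1 / 2) ^ n + 2 ^ n * (a (Suc n) - a n)\<^sup>2)"
    using assms by (intro summable_add summable_geometric) auto
  then have "summable (\<lambda>n. a (Suc n) - a n)"
    by (rule summable_comparison_test[rotated]) (use le in auto)
  then have "convergent (\<lambda>n. \<Sum>i<n. a (Suc i) - a i)" by (simp add: summable_iff_convergent)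
  then have "convergent (\<lambda>n. a n - a 0)" by (simp add: sum_lessThan_telescope)
  then have "convergent (\<lambda>n. (a n - a 0) + a 0)" by (intro convergent_add convergent_const)
  then show ?thesis by simp
qed

text \<open>Finite and with strictly positive density: bounded functions are integrable, while its
  null sets are those of Lebesgue measure.\<close>

definition tail_measure :: "real \<Rightarrow> real \<Rightarrow> 'a::euclidean_space measure" where
  "tail_measure s p = density lborel (\<lambda>x. ennreal (tail_weight s p x))"

lemma sets_tail_measure [measurable_cong, simp]: "sets (tail_measure s p) = sets borel"
  by (simp add: tail_measure_def)

lemma AE_tail_measure_iff: "(AE x in tail_measure s p. P x) \<longleftrightarrow> (AE x in lborel. P x)"
  unfolding tail_measure_def by (subst AE_density) (simp_all add: tail_weight_pos)

lemma finite_tail_measure: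
  assumes "1 < p" "0 < s" "s < 1"
  shows "finite_measure (tail_measure s p :: 'a::euclidean_space measure)"
proof
  have "emeasure (tail_measure s p :: 'a measure) UNIV = (\<integral>\<^sup>+x. ennreal (tail_weight s p (x::'a)) \<partial>lborel)"
    by (simp add: tail_measure_def emeasure_density)
  then show "emeasure (tail_measure s p :: 'a measure) (space (tail_measure s p)) \<noteq> \<infinity>"
    using nn_integral_tail_weight_finite[OF assms, where 'a='a] by (simp add: tail_measure_def)
qed

lemma integrable_tail_measure:
  fixes f :: "'a::euclidean_space \<Rightarrow> real"
  assumes "0 < s" "0 < p" and f: "integrable lborel f"
  shows "integrable (tail_measure s p) f"
proof -
  have [measurable]: "f \<in> borel_measurable borel" using f by auto
  have "integrable lborel (\<lambda>x. tail_weight s p x *\<^sub>R f x)"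
  proof (rule Bochner_Integration.integrable_bound[OF f])
    have "norm (tail_weight s p x *\<^sub>R f x) \<le> norm (f x)" for x
      using tail_weight_le_1[OF assms(1,2), of x] tail_weight_pos[of s p x]
      by (simp add: abs_mult mult_left_le_one_le)
    then show "AE x in lborel. norm (tail_weight s p x *\<^sub>R f x) \<le> norm (f x)" by simp
  qed measurable
  then show ?thesis
    unfolding tail_measure_def by (subst integrable_density) (auto simp: tail_weight_pos less_imp_le)
qed

lemma integrable_tail_measure_bounded:
  fixes f :: "'a::euclidean_space \<Rightarrow> real"
  assumes "1 < p" "0 < s" "s < 1" and [measurable]: "f \<in> borel_measurable borel" and "\<And>x. \<bar>f x\<bar> \<le> B"
  shows "integrable (tail_measure s p) f"
  using finite_measure.integrable_const_bound[OF finite_tail_measure[OF assms(1-3)], of f B] assms(5)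
  by (auto simp: tail_measure_def)

text \<open>Here \<open>l'\<close> is a Hardy constant already valid for test functions and
  \<open>l\<close> the one for which a supersolution is built.\<close>

locale subcritical =
  fixes s p l l' :: real and \<Omega> :: "'a::euclidean_space set"
  assumes p: "1 < p" and s: "0 < s" "s < 1" and om: "open \<Omega>" "\<Omega> \<noteq> UNIV"
    and l: "0 \<le> l" "l < l'"
    and hardy: "\<And>\<phi>. \<phi> \<in> test_class s p \<Omega> \<Longrightarrow>
      (\<integral>\<^sup>+x. ennreal (l' * \<bar>\<phi> x\<bar> powr p) \<partial>hardy_measure s p \<Omega>) \<le> gagliardo_pow s p UNIV \<phi>"
begin

abbreviation "\<nu> \<equiv> gagliardo_measure s p :: ('a \<times> 'a) measure"
abbreviation "\<tau> \<equiv> hardy_measure s p \<Omega>"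
abbreviation "\<kappa> \<equiv> tail_measure s p :: 'a measure"

definition energy :: "('a \<Rightarrow> real) \<Rightarrow> real" where
  "energy u = (\<integral>z. \<bar>dq u z\<bar> powr p \<partial>\<nu>)"

definition hardy_term :: "('a \<Rightarrow> real) \<Rightarrow> real" where
  "hardy_term u = (\<integral>x. \<bar>u x\<bar> powr p \<partial>\<tau>)"

definition source :: "('a \<Rightarrow> real) \<Rightarrow> real" where
  "source u = (\<integral>x. sat (u x) \<partial>\<kappa>)"

definition functional :: "('a \<Rightarrow> real) \<Rightarrow> real" where
  "functional u = energy u - l * hardy_term u - source u"

definition cone :: "('a \<Rightarrow> real) set" where
  "cone = {u \<in> test_class s p \<Omega>. \<forall>x. 0 \<le> u x}"

lemma coneD:
  assumes "u \<in> cone"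
  shows "u \<in> test_class s p \<Omega>" "0 \<le> u x" "u \<in> borel_measurable borel"
    "integrable \<nu> (\<lambda>z. \<bar>dq u z\<bar> powr p)" "integrable lborel (\<lambda>x. \<bar>u x\<bar> powr p)"
proof -
  show "u \<in> test_class s p \<Omega>" "0 \<le> u x" using assms by (simp_all add: cone_def)
  then show "u \<in> borel_measurable borel" "integrable \<nu> (\<lambda>z. \<bar>dq u z\<bar> powr p)"
    "integrable lborel (\<lambda>x. \<bar>u x\<bar> powr p)"
    by (blast dest: test_classD)+
qed

lemma l'_pos: "0 < l'"
  using l by simp

text \<open>The Hardy inequality also supplies finiteness of the Hardy integral, so that all terms
  of the functional are genuine real integrals and may be subtracted.\<close>

lemma hardy_real:
  assumes "u \<in> test_class s p \<Omega>"
  shows "integrable \<tau> (\<lambda>x. \<bar>u x\<bar> powr p)" "l' * hardy_term u \<le> energy u"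
proof -
  note u = test_classD[OF assms]
  note [measurable] = u(1)
  have le: "(\<integral>\<^sup>+x. ennreal (l' * \<bar>u x\<bar> powr p) \<partial>\<tau>) \<le> ennreal (energy u)"
    using hardy[OF assms] u(3) unfolding energy_def
    by (subst nn_integral_eq_integral[symmetric]) (auto simp: gagliardo_pow_dq)
  then have "integrable \<tau> (\<lambda>x. l' * \<bar>u x\<bar> powr p)"
    using l'_pos by (intro integrableI_nonneg) (auto intro: le_less_trans)
  then show int: "integrable \<tau> (\<lambda>x. \<bar>u x\<bar> powr p)" using l'_pos by simp
  have "ennreal (l' * hardy_term u) = (\<integral>\<^sup>+x. ennreal (l' * \<bar>u x\<bar> powr p) \<partial>\<tau>)"
    unfolding hardy_term_def using int l'_pos by (subst nn_integral_eq_integral) auto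
  with le have "ennreal (l' * hardy_term u) \<le> ennreal (energy u)" by simp
  then show "l' * hardy_term u \<le> energy u"
    by (subst (asm) ennreal_le_iff) (auto simp: energy_def)
qed

lemma integrable_sat:
  assumes "u \<in> cone"
  shows "integrable \<kappa> (\<lambda>x. sat (u x))"
proof (rule integrable_tail_measure_bounded[OF p s])
  show "\<bar>sat (u x)\<bar> \<le> 1" for x
    using sat_nonneg[OF coneD(2)[OF assms]] sat_less_1[OF coneD(2)[OF assms]] by (simp add: less_imp_le)
qed (use coneD(3)[OF assms] in simp)

definition total :: real where
  "total = measure \<kappa> UNIV"

lemma source_le: "u \<in> cone \<Longrightarrow> source u \<le> total"
proof -
  assume u: "u \<in> cone"
  have "source u \<le> (\<integral>x. 1 \<partial>\<kappa>)"
    unfolding source_def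
  proof (rule integral_mono)
    show "integrable \<kappa> (\<lambda>x. 1 :: real)" by (rule integrable_tail_measure_bounded[OF p s]) auto
  qed (use integrable_sat[OF u] sat_less_1[OF coneD(2)[OF u]] in \<open>auto intro: less_imp_le\<close>)
  then show ?thesis by (simp add: total_def tail_measure_def)
qed

text \<open>The Hardy inequality with \<open>l'\<close> gives l H <= (l / l') E, and the source
  costs at most the total mass of \<kappa>.\<close>

lemma coercive:
  assumes "u \<in> cone"
  shows "(1 - l / l') * energy u \<le> functional u + total"
proof -
  have "hardy_term u \<le> energy u / l'"
    using hardy_real(2)[OF coneD(1)[OF assms]] l'_pos by (simp add: field_simps)
  then have "l * hardy_term u \<le> l * (energy u / l')" using l by (intro mult_left_mono) auto
  then show ?thesis
    using source_le[OF assms] by (simp add: functional_def algebra_simps)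
qed

lemma ratio_pos: "0 < 1 - l / l'"
  using l by simp

lemma energy_nonneg: "0 \<le> energy u"
  by (simp add: energy_def)

lemma functional_bdd_below: "bdd_below (functional ` cone)"
proof (rule bdd_belowI2)
  fix u assume "u \<in> cone"
  then show "- total \<le> functional u"
    using coercive[of u] mult_nonneg_nonneg[OF less_imp_le[OF ratio_pos] energy_nonneg[of u]] by linarith
qed

lemma zero_in_cone: "(\<lambda>x. 0) \<in> cone"
  by (simp add: cone_def test_class_zero)

definition inf_value :: real where
  "inf_value = Inf (functional ` cone)"

lemma inf_value_le: "u \<in> cone \<Longrightarrow> inf_value \<le> functional u"
  unfolding inf_value_def by (intro cInf_lower functional_bdd_below) auto

lemma inf_value_nonpos: "inf_value \<le> 0"
  using inf_value_le[OF zero_in_cone]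
  by (simp add: functional_def energy_def hardy_term_def source_def dq_def)

lemma integrable_sat_diff_square:
  assumes u: "u \<in> cone" and w: "w \<in> cone"
  shows "integrable \<kappa> (\<lambda>x. (sat (u x) - sat (w x))\<^sup>2 / 4)"
proof (rule integrable_tail_measure_bounded[OF p s])
  note [measurable] = coneD(3)[OF u] coneD(3)[OF w]
  show "(\<lambda>x. (sat (u x) - sat (w x))\<^sup>2 / 4) \<in> borel_measurable borel" by measurable
  fix x
  have "\<bar>sat (u x) - sat (w x)\<bar> \<le> 1"
    using sat_nonneg[OF coneD(2)[OF u], of x] sat_nonneg[OF coneD(2)[OF w], of x]
      sat_less_1[OF coneD(2)[OF u], of x] sat_less_1[OF coneD(2)[OF w], of x] by linarith
  then have "(sat (u x) - sat (w x))\<^sup>2 \<le> 1" by (simp add: abs_square_le_1)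
  then show "\<bar>(sat (u x) - sat (w x))\<^sup>2 / 4\<bar> \<le> 1" by simp
qed

text \<open>The power mean v of u and w competes for the infimum. Its energy is at most the average,
  its Hardy integral equals the average, and its source exceeds the average by at least the
  quadratic gap; so the \<open>sat\<close> values of two almost minimizers are close in L^2 of
  \<kappa>.\<close>

lemma midpoint_convexity:
  assumes u: "u \<in> cone" and w: "w \<in> cone"
  shows "(\<integral>x. (sat (u x) - sat (w x))\<^sup>2 / 4 \<partial>\<kappa>) \<le> (functional u + functional w) / 2 - inf_value"
proof -
  define v where "v x = pmean p (u x) (w x)" for x
  note nn = coneD(2)[OF u] coneD(2)[OF w]
  have v: "v \<in> cone"
    unfolding cone_def v_def using test_class_pmean[OF p coneD(1)[OF u] coneD(1)[OF w]] nn by simp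
  note [measurable] = coneD(3)[OF u] coneD(3)[OF w] coneD(3)[OF v]
  have E: "energy v \<le> (energy u + energy w) / 2"
  proof -
    have "energy v \<le> (\<integral>z. (\<bar>dq u z\<bar> powr p + \<bar>dq w z\<bar> powr p) / 2 \<partial>\<nu>)"
      unfolding energy_def v_def
      by (rule integral_mono)
        (use coneD(4)[OF v] coneD(4)[OF u] coneD(4)[OF w] dq_pmean_le[OF p nn] in \<open>auto simp: v_def[abs_def]\<close>)
    then show ?thesis using coneD(4)[OF u] coneD(4)[OF w] by (simp add: energy_def)
  qed
  have H: "hardy_term v = (hardy_term u + hardy_term w) / 2"
    unfolding hardy_term_def v_def
    using hardy_real(1)[OF coneD(1)[OF u]] hardy_real(1)[OF coneD(1)[OF w]] nn p by (simp add: pmean_powr)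
  have "(\<integral>x. (sat (u x) - sat (w x))\<^sup>2 / 4 \<partial>\<kappa>) \<le> (\<integral>x. sat (v x) - (sat (u x) + sat (w x)) / 2 \<partial>\<kappa>)"
  proof (rule integral_mono[OF integrable_sat_diff_square[OF u w]])
    show "integrable \<kappa> (\<lambda>x. sat (v x) - (sat (u x) + sat (w x)) / 2)"
      using integrable_sat[OF u] integrable_sat[OF v] integrable_sat[OF w] by simp
    fix x
    have "sat ((u x + w x) / 2) \<le> sat (v x)"
      unfolding v_def using nn by (intro sat_mono pmean_ge[OF p]) auto
    then show "(sat (u x) - sat (w x))\<^sup>2 / 4 \<le> sat (v x) - (sat (u x) + sat (w x)) / 2"
      using sat_midpoint_gap[OF nn(1)[of x] nn(2)[of x]] by linarith
  qed
  also have "\<dots> = source v - (source u + source w) / 2"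
    using integrable_sat[OF u] integrable_sat[OF v] integrable_sat[OF w] by (simp add: source_def)
  also have "\<dots> \<le> (functional u + functional w) / 2 - functional v"
  proof -
    have "functional v = energy v - (l * hardy_term u + l * hardy_term w) / 2 - source v"
      unfolding functional_def H by (simp add: distrib_left)
    then show ?thesis using E by (simp add: functional_def field_simps)
  qed
  also have "\<dots> \<le> (functional u + functional w) / 2 - inf_value"
    using inf_value_le[OF v] by simp
  finally show ?thesis .
qed

text \<open>Only an upper bound of the increment is wanted, so each supporting line is taken at the
  convenient end: at the new point w for the energy, at the old point u for the Hardy term, which
  enters with a minus sign. The source increment is exact by \<open>sat_add\<close>.\<close>

lemma first_variation:
  assumes u: "u \<in> cone" and \<phi>: "\<phi> \<in> cone" and t: "0 < t"
  defines "w \<equiv> \<lambda>x. u x + t * \<phi> x"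
  shows "w \<in> cone" "integrable \<nu> (\<lambda>z. J p (dq w z) * dq \<phi> z)" "integrable \<tau> (\<lambda>x. J p (u x) * \<phi> x)"
    "integrable \<kappa> (\<lambda>x. \<phi> x / ((1 + u x) * (1 + w x)))"
    "functional w - functional u \<le> t * (p * (\<integral>z. J p (dq w z) * dq \<phi> z \<partial>\<nu>)
       - l * p * (\<integral>x. J p (u x) * \<phi> x \<partial>\<tau>) - (\<integral>x. \<phi> x / ((1 + u x) * (1 + w x)) \<partial>\<kappa>))"
proof -
  note nn = coneD(2)[OF u] coneD(2)[OF \<phi>]
  show w: "w \<in> cone"
    unfolding cone_def w_def
    using test_class_add[OF _ coneD(1)[OF u] test_class_cmult[OF coneD(1)[OF \<phi>]], of t] p nn t by simp
  note [measurable] = coneD(3)[OF u] coneD(3)[OF w] coneD(3)[OF \<phi>]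
  show int1: "integrable \<nu> (\<lambda>z. J p (dq w z) * dq \<phi> z)"
    using coneD(4)[OF w] coneD(4)[OF \<phi>] by (intro integrable_J_mult[OF p]) auto
  show int2: "integrable \<tau> (\<lambda>x. J p (u x) * \<phi> x)"
    using hardy_real(1)[OF coneD(1)[OF u]] hardy_real(1)[OF coneD(1)[OF \<phi>]]
    by (intro integrable_J_mult[OF p]) auto
  have wu: "w x = u x + t * \<phi> x" for x by (simp add: w_def)
  have sat_diff: "sat (w x) - sat (u x) = t * (\<phi> x / ((1 + u x) * (1 + w x)))" for x
    unfolding wu using sat_add[OF nn(1)[of x], of "t * \<phi> x"] nn t by (simp add: add.assoc)
  have "integrable \<kappa> (\<lambda>x. (sat (w x) - sat (u x)) / t)"
    using integrable_sat[OF u] integrable_sat[OF w] by simp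
  then show int3: "integrable \<kappa> (\<lambda>x. \<phi> x / ((1 + u x) * (1 + w x)))"
    using t by (simp add: sat_diff)
  have "energy w - energy u = (\<integral>z. \<bar>dq w z\<bar> powr p - \<bar>dq u z\<bar> powr p \<partial>\<nu>)"
    using coneD(4)[OF u] coneD(4)[OF w] by (simp add: energy_def)
  also have "\<dots> \<le> (\<integral>z. t * p * (J p (dq w z) * dq \<phi> z) \<partial>\<nu>)"
  proof (rule integral_mono)
    fix z
    have "dq u z - dq w z = - t * dq \<phi> z" by (simp add: dq_def wu algebra_simps)
    then show "\<bar>dq w z\<bar> powr p - \<bar>dq u z\<bar> powr p \<le> t * p * (J p (dq w z) * dq \<phi> z)"
      using J_tangent[OF p, of "dq w z" "dq u z"] by (simp add: mult_ac)
  qed (use coneD(4)[OF u] coneD(4)[OF w] int1 in auto)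
  also have "\<dots> = t * p * (\<integral>z. J p (dq w z) * dq \<phi> z \<partial>\<nu>)" by simp
  finally have E: "energy w - energy u \<le> t * p * (\<integral>z. J p (dq w z) * dq \<phi> z \<partial>\<nu>)" .
  have "t * p * (\<integral>x. J p (u x) * \<phi> x \<partial>\<tau>) = (\<integral>x. t * p * (J p (u x) * \<phi> x) \<partial>\<tau>)" by simp
  also have "\<dots> \<le> (\<integral>x. \<bar>w x\<bar> powr p - \<bar>u x\<bar> powr p \<partial>\<tau>)"
  proof (rule integral_mono)
    fix x
    show "t * p * (J p (u x) * \<phi> x) \<le> \<bar>w x\<bar> powr p - \<bar>u x\<bar> powr p"
      using J_tangent[OF p, of "u x" "w x"] by (simp add: wu mult_ac)
  qed (use hardy_real(1)[OF coneD(1)[OF u]] hardy_real(1)[OF coneD(1)[OF w]] int2 in auto)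
  also have "\<dots> = hardy_term w - hardy_term u"
    using hardy_real(1)[OF coneD(1)[OF u]] hardy_real(1)[OF coneD(1)[OF w]] by (simp add: hardy_term_def)
  finally have "l * (t * p * (\<integral>x. J p (u x) * \<phi> x \<partial>\<tau>)) \<le> l * (hardy_term w - hardy_term u)"
    using l by (intro mult_left_mono)
  moreover have "source w - source u = t * (\<integral>x. \<phi> x / ((1 + u x) * (1 + w x)) \<partial>\<kappa>)"
  proof -
    have "source w - source u = (\<integral>x. sat (w x) - sat (u x) \<partial>\<kappa>)"
      using integrable_sat[OF u] integrable_sat[OF w] by (simp add: source_def)
    then show ?thesis by (simp add: sat_diff del: times_divide_eq_right)
  qed
  ultimately show "functional w - functional u \<le> t * (p * (\<integral>z. J p (dq w z) * dq \<phi> z \<partial>\<nu>)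
       - l * p * (\<integral>x. J p (u x) * \<phi> x \<partial>\<tau>) - (\<integral>x. \<phi> x / ((1 + u x) * (1 + w x)) \<partial>\<kappa>))"
    using E by (simp add: functional_def algebra_simps)
qed

text \<open>The rate 8^(-n) survives both later losses: the weight 2^n needed for almost everywhere
  convergence and the division by the variation step 2^(-n).\<close>

lemma minimizing_sequence:
  obtains u where "\<And>n. u n \<in> cone" "\<And>n. functional (u n) \<le> inf_value + (1 / 8) ^ n"
proof -
  have "\<exists>u\<in>cone. functional u < inf_value + (1 / 8) ^ n" for n
  proof -
    have "Inf (functional ` cone) < inf_value + (1 / 8) ^ n" by (simp add: inf_value_def)
    then show ?thesis
      using zero_in_cone functional_bdd_below by (subst (asm) cInf_less_iff) auto
  qed
  then show ?thesis using that by (metis less_imp_le)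
qed

text \<open>The infimum is at most 0, the value at the zero function, and the excess 8^(-n) is at
  most 1; coercivity turns this into an energy bound.\<close>

definition bound :: real where
  "bound = (1 + total) / (1 - l / l')"

lemma energy_bound:
  assumes "u \<in> cone" "functional u \<le> inf_value + (1 / 8) ^ n"
  shows "energy u \<le> bound" "hardy_term u \<le> bound / l'"
proof -
  have "(1 / 8 :: real) ^ n \<le> 1" by (intro power_le_one) auto
  then have "(1 - l / l') * energy u \<le> 1 + total"
    using coercive[OF assms(1)] assms(2) inf_value_nonpos by linarith
  then show E: "energy u \<le> bound"
    using ratio_pos by (simp add: bound_def pos_le_divide_eq mult.commute)
  show "hardy_term u \<le> bound / l'"
    using hardy_real(2)[OF coneD(1)[OF assms(1)]] E l'_pos by (simp add: pos_le_divide_eq mult.commute)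
qed

text \<open>\<open>midpoint_convexity\<close> on consecutive terms bounds the squared L^2 increments
  of \<open>sat\<close> by a multiple of 8^(-n), still summable with weight 2^n. So
  \<open>sat (u n x)\<close> converges almost everywhere; its limit 1 is excluded in \<Omega> by
  Fatou's lemma and the bounded Hardy terms, and off \<Omega> all terms are 0.\<close>

lemma minimizing_sequence_converges:
  assumes u: "\<And>n. u n \<in> cone" and min: "\<And>n. functional (u n) \<le> inf_value + (1 / 8) ^ n"
  shows "AE x in lborel. convergent (\<lambda>n. u n x)"
proof -
  note [measurable] = coneD(3)[OF u]
  have [measurable]: "\<Omega> \<in> sets borel" using om by (auto intro: borel_open)
  have "AE x in \<kappa>. summable (\<lambda>n. 2 ^ n * (sat (u (Suc n) x) - sat (u n x))\<^sup>2)"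
  proof (rule AE_summable_of_suminf)
    have "(\<integral>\<^sup>+x. ennreal (2 ^ n * (sat (u (Suc n) x) - sat (u n x))\<^sup>2) \<partial>\<kappa>) \<le> ennreal (4 * (1 / 4) ^ n)" for n
    proof -
      let ?q = "\<lambda>x. (sat (u (Suc n) x) - sat (u n x))\<^sup>2 / 4"
      have int: "integrable \<kappa> ?q" by (rule integrable_sat_diff_square[OF u u])
      have "(\<integral>x. ?q x \<partial>\<kappa>) \<le> (functional (u (Suc n)) + functional (u n)) / 2 - inf_value"
        by (rule midpoint_convexity[OF u u])
      also have "\<dots> \<le> (1 / 8) ^ n"
      proof -
        have "functional (u (Suc n)) \<le> inf_value + (1 / 8) ^ n"
          by (rule order_trans[OF min[of "Suc n"]]) simp
        then show ?thesis using min[of n] by (simp add: field_simps)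
      qed
      finally have q: "(\<integral>x. ?q x \<partial>\<kappa>) \<le> (1 / 8) ^ n" .
      have "(\<integral>\<^sup>+x. ennreal (2 ^ n * (sat (u (Suc n) x) - sat (u n x))\<^sup>2) \<partial>\<kappa>)
        = (\<integral>\<^sup>+x. ennreal (2 ^ n * 4 * ?q x) \<partial>\<kappa>)"
        by simp
      also have "\<dots> = ennreal (2 ^ n * 4 * (\<integral>x. ?q x \<partial>\<kappa>))"
        by (subst nn_integral_eq_integral[OF integrable_mult_right[OF int]])
          (simp_all only: integral_mult_right_zero, simp)
      also have "\<dots> \<le> ennreal (2 ^ n * 4 * (1 / 8) ^ n)"
        using q by (intro ennreal_leI mult_left_mono) auto
      also have "2 ^ n * 4 * (1 / 8) ^ n = 4 * (1 / 4 :: real) ^ n"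
        by (simp add: power_mult_distrib[symmetric])
      finally show ?thesis .
    qed
    then have "(\<Sum>n. \<integral>\<^sup>+x. ennreal (2 ^ n * (sat (u (Suc n) x) - sat (u n x))\<^sup>2) \<partial>\<kappa>)
      \<le> (\<Sum>n. ennreal (4 * (1 / 4) ^ n))"
      by (intro suminf_le allI) auto
    also have "\<dots> < \<infinity>"
    proof -
      have "summable (\<lambda>n. 4 * (1 / 4 :: real) ^ n)" by (intro summable_mult summable_geometric) simp
      then show ?thesis by (subst suminf_ennreal2) auto
    qed
    finally show "(\<Sum>n. \<integral>\<^sup>+x. ennreal (2 ^ n * (sat (u (Suc n) x) - sat (u n x))\<^sup>2) \<partial>\<kappa>) < \<infinity>" .
  qed auto
  then have conv: "AE x in lborel. convergent (\<lambda>n. sat (u n x))"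
    unfolding AE_tail_measure_iff by eventually_elim (rule weighted_square_summable_imp_convergent)
  have "(\<integral>\<^sup>+x. liminf (\<lambda>n. ennreal (u n x powr p)) \<partial>\<tau>) \<le> liminf (\<lambda>n. \<integral>\<^sup>+x. ennreal (u n x powr p) \<partial>\<tau>)"
    by (rule nn_integral_liminf) measurable
  also have "\<dots> \<le> liminf (\<lambda>n. ennreal (bound / l'))"
  proof (intro Liminf_mono always_eventually allI)
    fix n
    have "(\<integral>\<^sup>+x. ennreal (u n x powr p) \<partial>\<tau>) = ennreal (hardy_term (u n))"
      unfolding hardy_term_def using hardy_real(1)[OF coneD(1)[OF u[of n]]] coneD(2)[OF u[of n]]
      by (subst nn_integral_eq_integral[symmetric]) auto
    then show "(\<integral>\<^sup>+x. ennreal (u n x powr p) \<partial>\<tau>) \<le> ennreal (bound / l')"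
      using energy_bound(2)[OF u min] by (simp add: ennreal_leI)
  qed
  also have "\<dots> < \<infinity>" by (simp add: Liminf_const)
  finally have "(\<integral>\<^sup>+x. liminf (\<lambda>n. ennreal (u n x powr p)) \<partial>\<tau>) \<noteq> \<infinity>" by simp
  then have "AE x in \<tau>. liminf (\<lambda>n. ennreal (u n x powr p)) \<noteq> \<infinity>"
    by (intro nn_integral_PInf_AE) auto
  then have fin: "AE x in lborel. x \<in> \<Omega> \<longrightarrow> liminf (\<lambda>n. ennreal (u n x powr p)) \<noteq> \<infinity>"
    by (simp add: AE_hardy_measure_iff[OF om])
  have out: "u n x = 0" if "x \<notin> \<Omega>" for n x
    using test_class_support[OF coneD(1)[OF u[of n]]] that by (metis subsetD)
  show ?thesis
    using conv fin
  proof eventually_elim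
    fix x assume c: "convergent (\<lambda>n. sat (u n x))" and f: "x \<in> \<Omega> \<longrightarrow> liminf (\<lambda>n. ennreal (u n x powr p)) \<noteq> \<infinity>"
    show "convergent (\<lambda>n. u n x)"
    proof (cases "x \<in> \<Omega>")
      case True
      then show ?thesis
        using sat_bounded_imp_convergent[OF coneD(2)[OF u] c, of p] f p by (simp add: less_top)
    qed (simp add: out convergent_const)
  qed
qed

end

section \<open>Passage to the limit\<close>

text \<open>By Fubini some point a has a finite inner integral. With a frozen, |u(y)|^(p - 1) <= 1 +
  |u(y)|^p is controlled by |u(a)|^p and |u(a) - u(y)|^p. The tail weight is integrable, and it is
  also at most C / |a - y|^(N + s p) because |a - y| <= (1 + |a|) (1 + |y|).\<close>

lemma Tail_of_gagliardo:
  fixes u :: "'a::euclidean_space \<Rightarrow> real"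
  assumes p: "1 < p" and s: "0 < s" "s < 1" and u [measurable]: "u \<in> borel_measurable borel"
    and E: "integrable (gagliardo_measure s p) (\<lambda>z. \<bar>dq u z\<bar> powr p)"
  shows "u \<in> Tail (p - 1) (s * p)"
proof -
  let ?N = "real DIM('a) + s * p"
  let ?k = "\<lambda>x y :: 'a. ennreal (1 / norm (x - y) powr ?N) * ennreal (\<bar>dq u (x, y)\<bar> powr p)"
  have N: "0 < ?N" using p s by (simp add: add_pos_pos)
  have "(\<integral>\<^sup>+x. \<integral>\<^sup>+y. ?k x y \<partial>lborel \<partial>lborel) = (\<integral>\<^sup>+z. ennreal (\<bar>dq u z\<bar> powr p) \<partial>gagliardo_measure s p)"
    by (rule nn_integral_gagliardo_measure[symmetric]) measurable
  also have "\<dots> < \<infinity>" using E by (subst (asm) integrable_powr_abs_iff) auto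
  finally have "(\<integral>\<^sup>+x. \<integral>\<^sup>+y. ?k x y \<partial>lborel \<partial>lborel) \<noteq> \<infinity>" by simp
  then have "AE x in lborel. (\<integral>\<^sup>+y. ?k x y \<partial>lborel) \<noteq> \<infinity>"
    by (intro nn_integral_PInf_AE) measurable
  moreover have "ae_filter (lborel :: 'a measure) \<noteq> bot"
    by (simp add: ae_filter_eq_bot_iff)
  ultimately obtain a :: 'a where a: "(\<integral>\<^sup>+y. ?k a y \<partial>lborel) \<noteq> \<infinity>"
    using eventually_happens' by blast
  define C where "C = (1 + norm a) powr ?N"
  have weight: "tail_weight s p y \<le> C * (1 / norm (a - y) powr ?N)" if "y \<noteq> a" for y
  proof -
    have "norm (a - y) \<le> norm a + norm y" by (rule norm_triangle_ineq4)
    also have "\<dots> \<le> (1 + norm a) * (1 + norm y)" by (simp add: algebra_simps)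
    finally have "norm (a - y) powr ?N \<le> ((1 + norm a) * (1 + norm y)) powr ?N"
      using N by (intro powr_mono2) auto
    also have "\<dots> = C * (1 + norm y) powr ?N" by (simp add: C_def powr_mult)
    finally have le: "norm (a - y) powr ?N \<le> C * (1 + norm y) powr ?N" .
    have "0 < (1 + norm y) powr ?N" using tail_weight_pos[of s p y] by (simp add: tail_weight_def)
    moreover have "0 < norm (a - y) powr ?N" using that by simp
    ultimately show ?thesis using le by (simp add: tail_weight_def field_simps)
  qed
  let ?T = "\<lambda>y. \<bar>u y\<bar> powr (p - 1) / (1 + norm y) powr ?N"
  define D where "D = 1 + 2 powr p * \<bar>u a\<bar> powr p"
  have D: "0 \<le> D" by (simp add: D_def)
  have pt: "ennreal (?T y) \<le> ennreal D * ennreal (tail_weight s p y) + ennreal (2 powr p * C) * ?k a y" for y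
  proof -
    have pw: "\<bar>u y\<bar> powr (p - 1) \<le> 1 + \<bar>u y\<bar> powr p"
    proof (cases "\<bar>u y\<bar> \<le> 1")
      case True
      then have "\<bar>u y\<bar> powr (p - 1) \<le> 1" using p by (intro powr_le1) auto
      then show ?thesis by (simp add: add_increasing2)
    next
      case False
      then have "\<bar>u y\<bar> powr (p - 1) \<le> \<bar>u y\<bar> powr p" by (intro powr_mono) auto
      then show ?thesis by simp
    qed
    also have "\<dots> \<le> 1 + 2 powr p * (\<bar>u a\<bar> powr p + \<bar>dq u (a, y)\<bar> powr p)"
      using abs_add_powr_le[of p "u a" "- dq u (a, y)"] p by (simp add: dq_def abs_minus_commute)
    finally have "\<bar>u y\<bar> powr (p - 1) * tail_weight s p y
      \<le> (1 + 2 powr p * (\<bar>u a\<bar> powr p + \<bar>dq u (a, y)\<bar> powr p)) * tail_weight s p y"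
      using tail_weight_pos[of s p y] by (intro mult_right_mono) auto
    also have "\<dots> = (1 + 2 powr p * \<bar>u a\<bar> powr p) * tail_weight s p y + 2 powr p * \<bar>dq u (a, y)\<bar> powr p * tail_weight s p y"
      by (simp add: algebra_simps)
    also have "2 powr p * \<bar>dq u (a, y)\<bar> powr p * tail_weight s p y
      \<le> 2 powr p * \<bar>dq u (a, y)\<bar> powr p * (C * (1 / norm (a - y) powr ?N))"
    proof (cases "y = a")
      case False
      then show ?thesis using weight by (intro mult_left_mono) auto
    qed (simp add: dq_def)
    finally have "?T y \<le> (1 + 2 powr p * \<bar>u a\<bar> powr p) * tail_weight s p y
      + 2 powr p * C * (1 / norm (a - y) powr ?N * \<bar>dq u (a, y)\<bar> powr p)"
      by (simp add: tail_weight_def mult_ac)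
    then have "ennreal (?T y) \<le> ennreal ((1 + 2 powr p * \<bar>u a\<bar> powr p) * tail_weight s p y
      + 2 powr p * C * (1 / norm (a - y) powr ?N * \<bar>dq u (a, y)\<bar> powr p))"
      by (rule ennreal_leI)
    also have "\<dots> = ennreal D * ennreal (tail_weight s p y) + ennreal (2 powr p * C) * ?k a y"
      unfolding D_def[symmetric] using tail_weight_pos[of s p y, THEN less_imp_le] D
      by (simp add: C_def ennreal_plus ennreal_mult del: times_divide_eq_left)
    finally show ?thesis .
  qed
  have tail: "(\<integral>\<^sup>+y. ennreal (?T y) \<partial>lborel) < \<infinity>"
  proof -
    have "(\<integral>\<^sup>+y. ennreal (?T y) \<partial>lborel)
      \<le> (\<integral>\<^sup>+y. ennreal D * ennreal (tail_weight s p y) + ennreal (2 powr p * C) * ?k a y \<partial>lborel)"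
      by (intro nn_integral_mono pt)
    also have "\<dots> = (\<integral>\<^sup>+y. ennreal D * ennreal (tail_weight s p (y :: 'a)) \<partial>lborel)
      + (\<integral>\<^sup>+y. ennreal (2 powr p * C) * ?k a y \<partial>lborel)"
      by (rule nn_integral_add) measurable
    also have "(\<integral>\<^sup>+y. ennreal D * ennreal (tail_weight s p (y :: 'a)) \<partial>lborel)
      = ennreal D * (\<integral>\<^sup>+y. ennreal (tail_weight s p (y :: 'a)) \<partial>lborel)"
      by (rule nn_integral_cmult) measurable
    also have "(\<integral>\<^sup>+y. ennreal (2 powr p * C) * ?k a y \<partial>lborel) = ennreal (2 powr p * C) * (\<integral>\<^sup>+y. ?k a y \<partial>lborel)"
      by (rule nn_integral_cmult) measurable
    also have "ennreal D * (\<integral>\<^sup>+y. ennreal (tail_weight s p (y :: 'a)) \<partial>lborel)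
      + ennreal (2 powr p * C) * (\<integral>\<^sup>+y. ?k a y \<partial>lborel) < \<infinity>"
    proof -
      have "(\<integral>\<^sup>+y. ?k a y \<partial>lborel) < \<infinity>" using a by (simp add: top.not_eq_extremum)
      then show ?thesis
        using nn_integral_tail_weight_finite[OF p s, where 'a='a] by (simp add: ennreal_mult_less_top)
    qed
    finally show ?thesis .
  qed
  \<comment> \<open>On K the weight is bounded below by (1 + R)^(-N - s p), so the weighted integral
    controls the local one.\<close>
  have "u \<in> Leb (p - 1) K" if K: "compact K" for K
  proof -
    have [measurable]: "K \<in> sets borel" using K by (rule borel_compact)
    obtain R where R: "0 < R" "\<And>x. x \<in> K \<Longrightarrow> norm x \<le> R"
      using compact_imp_bounded[OF K] by (auto simp: bounded_pos)
    have "(\<integral>\<^sup>+x\<in>K. ennreal (\<bar>u x\<bar> powr (p - 1)) \<partial>lborel) \<le> (\<integral>\<^sup>+x. ennreal ((1 + R) powr ?N) * ennreal (?T x) \<partial>lborel)"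
    proof (rule nn_integral_mono)
      fix x
      show "ennreal (\<bar>u x\<bar> powr (p - 1)) * indicator K x \<le> ennreal ((1 + R) powr ?N) * ennreal (?T x)"
      proof (cases "x \<in> K")
        case True
        have pos: "0 < (1 + norm x) powr ?N" using tail_weight_pos[of s p x] by (simp add: tail_weight_def)
        have "(1 + norm x) powr ?N \<le> (1 + R) powr ?N"
          using R(2)[OF True] N by (intro powr_mono2) auto
        then have "\<bar>u x\<bar> powr (p - 1) * (1 + norm x) powr ?N \<le> \<bar>u x\<bar> powr (p - 1) * (1 + R) powr ?N"
          by (rule mult_left_mono) simp
        then have "\<bar>u x\<bar> powr (p - 1) \<le> (1 + R) powr ?N * ?T x"
          using pos by (simp add: le_divide_eq mult.commute)
        then show ?thesis using True by (simp add: ennreal_mult[symmetric] ennreal_leI)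
      qed simp
    qed
    also have "\<dots> = ennreal ((1 + R) powr ?N) * (\<integral>\<^sup>+x. ennreal (?T x) \<partial>lborel)"
      by (rule nn_integral_cmult) measurable
    also have "\<dots> < \<infinity>" using tail by (simp add: ennreal_mult_less_top)
    finally show ?thesis by (simp add: Leb_def set_borel_measurable_def)
  qed
  then show ?thesis using tail by (simp add: Tail_def Leb_loc_def)
qed

text \<open>The energy speaks of differences only, so local p-integrability must come from the Hardy
  integral: on a compact subset of \<Omega> the distance to the boundary is bounded above, hence the
  Hardy weight is bounded below.\<close>

lemma Sobolev_loc_of_integrable:
  fixes u :: "'a::euclidean_space \<Rightarrow> real"
  assumes p: "1 < p" and s: "0 < s" and om: "open \<Omega>" "\<Omega> \<noteq> UNIV" and u [measurable]: "u \<in> borel_measurable borel"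
    and E: "integrable (gagliardo_measure s p) (\<lambda>z. \<bar>dq u z\<bar> powr p)"
    and H: "integrable (hardy_measure s p \<Omega>) (\<lambda>x. \<bar>u x\<bar> powr p)"
  shows "u \<in> Sobolev_loc s p \<Omega>"
proof -
  have [measurable]: "\<Omega> \<in> sets borel" using om(1) by (rule borel_open)
  have Leb: "u \<in> Leb p A" if A [measurable]: "A \<in> sets borel" and K: "compact K" "K \<subseteq> \<Omega>" "A \<subseteq> K" for A K
  proof -
    obtain c d where d: "0 < d" "\<And>x. x \<in> K \<Longrightarrow> dist_bdry \<Omega> x \<le> d"
      using dist_bdry_bounds[OF om K(1,2)] by metis
    have "(\<integral>\<^sup>+x\<in>A. ennreal (\<bar>u x\<bar> powr p) \<partial>lborel)
      \<le> (\<integral>\<^sup>+x. ennreal (d powr (s * p)) * (ennreal (\<bar>u x\<bar> powr p / dist_bdry \<Omega> x powr (s * p)) * indicator \<Omega> x) \<partial>lborel)"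
    proof (rule nn_integral_mono)
      fix x
      show "ennreal (\<bar>u x\<bar> powr p) * indicator A x
        \<le> ennreal (d powr (s * p)) * (ennreal (\<bar>u x\<bar> powr p / dist_bdry \<Omega> x powr (s * p)) * indicator \<Omega> x)"
      proof (cases "x \<in> A")
        case True
        then have x: "x \<in> K" "x \<in> \<Omega>" using K by auto
        have pos: "0 < dist_bdry \<Omega> x" by (rule dist_bdry_pos[OF om x(2)])
        then have "dist_bdry \<Omega> x powr (s * p) \<le> d powr (s * p)"
          using d(2)[OF x(1)] p s by (intro powr_mono2) auto
        then have "\<bar>u x\<bar> powr p * dist_bdry \<Omega> x powr (s * p) \<le> \<bar>u x\<bar> powr p * d powr (s * p)"
          by (rule mult_left_mono) simp
        then have "\<bar>u x\<bar> powr p \<le> d powr (s * p) * (\<bar>u x\<bar> powr p / dist_bdry \<Omega> x powr (s * p))"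
          using pos by (simp add: le_divide_eq mult.commute)
        then show ?thesis using True x by (simp add: ennreal_mult[symmetric] ennreal_leI)
      qed simp
    qed
    also have "\<dots> = ennreal (d powr (s * p)) * (\<integral>\<^sup>+x. ennreal (\<bar>u x\<bar> powr p) \<partial>hardy_measure s p \<Omega>)"
      by (subst nn_integral_cmult, measurable) (simp add: nn_integral_hardy_measure)
    also have "\<dots> < \<infinity>"
    proof -
      have "(\<integral>\<^sup>+x. ennreal (\<bar>u x\<bar> powr p) \<partial>hardy_measure s p \<Omega>) < \<infinity>"
        using H by (subst (asm) integrable_powr_abs_iff) auto
      then show ?thesis by (simp add: ennreal_mult_less_top)
    qed
    finally show ?thesis by (simp add: Leb_def set_borel_measurable_def)
  qed
  have "u \<in> Sobolev s p A" if A: "open A" "compactly_inside A \<Omega>" for A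
  proof -
    have "gagliardo_pow s p A u < \<infinity>"
      using A(1) by (intro gagliardo_pow_finite u E borel_open)
    then show ?thesis
      using Leb[of A "closure A"] A closure_subset[of A]
      by (auto simp: Sobolev_def compactly_inside_def intro: borel_open)
  qed
  moreover have "u \<in> Leb_loc p \<Omega>"
    unfolding Leb_loc_def using Leb by (auto intro: borel_compact)
  ultimately show ?thesis by (auto simp: Sobolev_loc_def)
qed

text \<open>Take the minimum of n - |x| and the distance to the complement lowered by 1 / (n + 1),
  cut at 0. It is 1-Lipschitz, vanishes off a bounded closed set at positive distance from the
  complement, and is positive at any given point of \<Omega> for large n.\<close>

lemma exhausting_cutoffs:
  fixes \<Omega> :: "'a::euclidean_space set"
  assumes p: "1 < p" and s: "0 < s" "s < 1" and om: "open \<Omega>" "\<Omega> \<noteq> UNIV"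
  obtains \<eta> :: "nat \<Rightarrow> 'a \<Rightarrow> real"
  where "\<And>n. \<eta> n \<in> test_class s p \<Omega>" "\<And>n x. 0 \<le> \<eta> n x" "\<And>n x. \<eta> n x \<le> n"
    "\<And>x. x \<in> \<Omega> \<Longrightarrow> \<exists>n. 0 < \<eta> n x"
proof -
  define \<eta> where "\<eta> n x = max 0 (min (real n - norm x) (infdist x (- \<Omega>) - 1 / real (Suc n)))" for n and x :: 'a
  have ne: "- \<Omega> \<noteq> {}" and cl: "closed (- \<Omega>)" using om by auto
  have "\<eta> n \<in> test_class s p \<Omega>" for n
  proof (rule test_class_lipschitz[OF p s])
    let ?K = "cball 0 (real n) \<inter> {x. 1 / real (Suc n) \<le> infdist x (- \<Omega>)}"
    have "closed {x. 1 / real (Suc n) \<le> infdist x (- \<Omega>)}"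
      by (intro closed_Collect_le continuous_intros)
    then show "compact ?K" by (intro compact_Int_closed compact_cball)
    have "x \<in> \<Omega>" if "1 / real (Suc n) \<le> infdist x (- \<Omega>)" for x
    proof (rule ccontr)
      assume "x \<notin> \<Omega>"
      then have "infdist x (- \<Omega>) = 0" by simp
      then show False using that by simp
    qed
    then show "?K \<subseteq> \<Omega>" by auto
    show "\<eta> n x = 0" if "x \<notin> ?K" for x using that by (auto simp: \<eta>_def)
    show "\<bar>\<eta> n x - \<eta> n y\<bar> \<le> 1 * norm (x - y)" for x y
    proof -
      have "\<bar>norm x - norm y\<bar> \<le> norm (x - y)" by (rule norm_triangle_ineq3)
      moreover have "\<bar>infdist x (- \<Omega>) - infdist y (- \<Omega>)\<bar> \<le> norm (x - y)"
        using infdist_triangle_abs[of x "- \<Omega>" y] by (simp add: dist_norm)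
      ultimately show ?thesis unfolding \<eta>_def by (simp only: max_def min_def) (smt (verit))
    qed
    show "\<bar>\<eta> n x\<bar> \<le> real n" for x by (auto simp: \<eta>_def intro: min.coboundedI1)
  qed
  moreover have "\<exists>n. 0 < \<eta> n x" if "x \<in> \<Omega>" for x
  proof -
    have d: "0 < infdist x (- \<Omega>)"
      using that by (intro infdist_pos_not_in_closed cl ne) auto
    obtain m where m: "inverse (real (Suc m)) < infdist x (- \<Omega>)" using reals_Archimedean[OF d] by auto
    obtain k where k: "norm x < real k" using reals_Archimedean2 by auto
    define n where "n = max m k"
    have "1 / real (Suc n) \<le> inverse (real (Suc m))" by (simp add: n_def inverse_eq_divide frac_le)
    then have "0 < \<eta> n x" using m k unfolding \<eta>_def by (auto simp: n_def)
    then show ?thesis by blast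
  qed
  moreover have "\<eta> n x \<le> n" "0 \<le> \<eta> n x" for n x by (auto simp: \<eta>_def intro: min.coboundedI1)
  ultimately show ?thesis using that by blast
qed

context subcritical
begin

text \<open>The variation step t_n = 2^(-n) is tied to the sequence index: dividing the
  almost-minimality error 8^(-n) by it leaves 4^(-n), so the error and the step vanish together and
  a single limit suffices.\<close>

lemma limit_inequality:
  assumes U: "\<And>n. U n \<in> cone" and min: "\<And>n. functional (U n) \<le> inf_value + (1 / 8) ^ n"
    and lim: "AE x in lborel. (\<lambda>n. U n x) \<longlonglongrightarrow> u x"
    and u [measurable]: "u \<in> borel_measurable borel" and u0: "\<And>x. 0 \<le> u x"
  shows "integrable \<nu> (\<lambda>z. \<bar>dq u z\<bar> powr p)" (is ?E) and "integrable \<tau> (\<lambda>x. \<bar>u x\<bar> powr p)" (is ?H)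
    and "\<And>\<phi>. \<phi> \<in> cone \<Longrightarrow> l * p * (\<integral>x. J p (u x) * \<phi> x \<partial>\<tau>) + (\<integral>x. \<phi> x / (1 + u x)\<^sup>2 \<partial>\<kappa>)
      \<le> p * (\<integral>z. J p (dq u z) * dq \<phi> z \<partial>\<nu>)"
proof -
  note [measurable] = coneD(3)[OF U]
  have limE: "AE z in \<nu>. (\<lambda>n. dq (U n) z) \<longlonglongrightarrow> dq u z"
    using AE_gagliardo_measure[OF lim] by eventually_elim (auto simp: dq_def intro: tendsto_diff)
  have limH: "AE x in \<tau>. (\<lambda>n. U n x) \<longlonglongrightarrow> u x"
    using lim unfolding AE_hardy_measure_iff[OF om] by eventually_elim simp
  have tendsto_powr_abs: "(\<lambda>n. \<bar>a n\<bar> powr p) \<longlonglongrightarrow> \<bar>b\<bar> powr p" if "a \<longlonglongrightarrow> b" for a :: "nat \<Rightarrow> real" and b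
    using that p by (intro tendsto_powr' tendsto_rabs tendsto_const) auto
  have tendsto_J: "(\<lambda>n. J p (a n)) \<longlonglongrightarrow> J p b" if "a \<longlonglongrightarrow> b" for a :: "nat \<Rightarrow> real" and b
    by (rule isCont_tendsto_compose[OF isCont_J[OF p] that])
  show E: ?E
  proof (rule fatou_integrable)
    show "integrable \<nu> (\<lambda>z. \<bar>dq (U n) z\<bar> powr p)" for n by (rule coneD(4)[OF U])
    show "(\<integral>z. \<bar>dq (U n) z\<bar> powr p \<partial>\<nu>) \<le> bound" for n
      using energy_bound(1)[OF U min] by (simp add: energy_def)
    show "AE z in \<nu>. (\<lambda>n. \<bar>dq (U n) z\<bar> powr p) \<longlonglongrightarrow> \<bar>dq u z\<bar> powr p"
      using limE by eventually_elim (rule tendsto_powr_abs)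
  qed auto
  show H: ?H
  proof (rule fatou_integrable)
    show "integrable \<tau> (\<lambda>x. \<bar>U n x\<bar> powr p)" for n by (rule hardy_real(1)[OF coneD(1)[OF U]])
    show "(\<integral>x. \<bar>U n x\<bar> powr p \<partial>\<tau>) \<le> bound / l'" for n
      using energy_bound(2)[OF U min] by (simp add: hardy_term_def)
    show "AE x in \<tau>. (\<lambda>n. \<bar>U n x\<bar> powr p) \<longlonglongrightarrow> \<bar>u x\<bar> powr p"
      using limH by eventually_elim (rule tendsto_powr_abs)
  qed auto
  fix \<phi> assume \<phi>: "\<phi> \<in> cone"
  note [measurable] = coneD(3)[OF \<phi>]
  note nn = coneD(2)[OF \<phi>]
  define t where "t n = (1 / 2 :: real) ^ n" for n
  have t: "0 < t n" "t n \<le> 1" for n by (auto simp: t_def power_le_one)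
  have t_lim: "t \<longlonglongrightarrow> 0" unfolding t_def[abs_def] by (rule LIMSEQ_power_zero) simp
  define w where "w n x = U n x + t n * \<phi> x" for n x
  have fv: "w n \<in> cone" "integrable \<nu> (\<lambda>z. J p (dq (w n) z) * dq \<phi> z)" "integrable \<tau> (\<lambda>x. J p (U n x) * \<phi> x)"
    "integrable \<kappa> (\<lambda>x. \<phi> x / ((1 + U n x) * (1 + w n x)))"
    "functional (w n) - functional (U n) \<le> t n * (p * (\<integral>z. J p (dq (w n) z) * dq \<phi> z \<partial>\<nu>)
       - l * p * (\<integral>x. J p (U n x) * \<phi> x \<partial>\<tau>) - (\<integral>x. \<phi> x / ((1 + U n x) * (1 + w n x)) \<partial>\<kappa>))" for n
    using first_variation[where u = "U n" and t = "t n", OF U \<phi> t(1)] unfolding w_def[abs_def] by blast+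
  note [measurable] = coneD(3)[OF fv(1)]
  define A where "A n = (\<integral>z. J p (dq (w n) z) * dq \<phi> z \<partial>\<nu>)" for n
  define B where "B n = (\<integral>x. J p (U n x) * \<phi> x \<partial>\<tau>)" for n
  define C where "C n = (\<integral>x. \<phi> x / ((1 + U n x) * (1 + w n x)) \<partial>\<kappa>)" for n
  have EL: "l * p * B n + C n - (1 / 4) ^ n \<le> p * A n" for n
  proof -
    have "- ((1 / 8) ^ n) \<le> t n * (p * A n - l * p * B n - C n)"
      using fv(5)[of n] inf_value_le[OF fv(1)[of n]] min[of n] unfolding A_def B_def C_def by linarith
    moreover have "(1 / 8 :: real) ^ n = t n * (1 / 4) ^ n"
      by (simp add: t_def power_mult_distrib[symmetric])
    ultimately have "t n * (- ((1 / 4) ^ n)) \<le> t n * (p * A n - l * p * B n - C n)" by simp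
    then have "- ((1 / 4) ^ n) \<le> p * A n - l * p * B n - C n"
      using t(1)[of n] by (simp only: mult_le_cancel_left_pos)
    then show ?thesis by linarith
  qed
  have w_lim: "AE x in lborel. (\<lambda>n. w n x) \<longlonglongrightarrow> u x"
    using lim
  proof eventually_elim
    fix x assume "(\<lambda>n. U n x) \<longlonglongrightarrow> u x"
    from tendsto_add[OF this tendsto_mult[OF t_lim tendsto_const[of "\<phi> x"]]]
    show "(\<lambda>n. w n x) \<longlonglongrightarrow> u x" by (simp add: w_def)
  qed
  have w_limE: "AE z in \<nu>. (\<lambda>n. dq (w n) z) \<longlonglongrightarrow> dq u z"
    using AE_gagliardo_measure[OF w_lim] by eventually_elim (auto simp: dq_def intro: tendsto_diff)
  define A' where "A' = (\<integral>z. J p (dq u z) * dq \<phi> z \<partial>\<nu>)"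
  define B' where "B' = (\<integral>x. J p (u x) * \<phi> x \<partial>\<tau>)"
  define C' where "C' = (\<integral>x. \<phi> x / (1 + u x)\<^sup>2 \<partial>\<kappa>)"
  have intA: "integrable \<nu> (\<lambda>z. J p (dq u z) * dq \<phi> z)"
    using E coneD(4)[OF \<phi>] by (intro integrable_J_mult[OF p]) auto
  have intB: "integrable \<tau> (\<lambda>x. J p (u x) * \<phi> x)"
    using H hardy_real(1)[OF coneD(1)[OF \<phi>]] by (intro integrable_J_mult[OF p]) auto
  have intC: "integrable \<kappa> (\<lambda>x. \<phi> x / (1 + u x)\<^sup>2)"
  proof (rule Bochner_Integration.integrable_bound)
    show "integrable \<kappa> \<phi>"
      using test_class_integrable[OF p coneD(1)[OF \<phi>]] p s by (intro integrable_tail_measure) auto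
    have "\<phi> x / (1 + u x)\<^sup>2 \<le> \<phi> x" for x
    proof -
      have "1 \<le> (1 + u x)\<^sup>2" using u0[of x] by (simp add: one_le_power)
      then show ?thesis using nn[of x] by (simp add: divide_le_eq mult_left_le mult_le_cancel_left1 not_less)
    qed
    then show "AE x in \<kappa>. norm (\<phi> x / (1 + u x)\<^sup>2) \<le> norm (\<phi> x)" using nn by simp
  qed measurable
  \<comment> \<open>A common energy bound for all \<open>w n\<close>, from
    \<open>abs_add_powr_le\<close> and t_n <= 1.\<close>
  define M where "M = 2 powr p * (bound + energy \<phi>)"
  have wE: "energy (w n) \<le> M" for n
  proof -
    have "energy (w n) \<le> (\<integral>z. 2 powr p * (\<bar>dq (U n) z\<bar> powr p + \<bar>dq \<phi> z\<bar> powr p) \<partial>\<nu>)"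
      unfolding energy_def
    proof (rule integral_mono)
      fix z
      have "dq (w n) z = dq (U n) z + t n * dq \<phi> z" by (simp add: dq_def w_def algebra_simps)
      then have "\<bar>dq (w n) z\<bar> powr p \<le> 2 powr p * (\<bar>dq (U n) z\<bar> powr p + \<bar>t n * dq \<phi> z\<bar> powr p)"
        using abs_add_powr_le[of p "dq (U n) z" "t n * dq \<phi> z"] p by simp
      also have "\<bar>t n * dq \<phi> z\<bar> powr p \<le> \<bar>dq \<phi> z\<bar> powr p"
        using t[of n] p by (intro powr_mono2) (auto simp: abs_mult mult_left_le_one_le)
      finally show "\<bar>dq (w n) z\<bar> powr p \<le> 2 powr p * (\<bar>dq (U n) z\<bar> powr p + \<bar>dq \<phi> z\<bar> powr p)"
        by simp
    qed (use coneD(4)[OF fv(1)] coneD(4)[OF U] coneD(4)[OF \<phi>] in auto)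
    also have "\<dots> = 2 powr p * (energy (U n) + energy \<phi>)"
      using coneD(4)[OF U] coneD(4)[OF \<phi>] by (simp add: energy_def)
    also have "\<dots> \<le> M"
      unfolding M_def using energy_bound(1)[OF U min] by (intro mult_left_mono add_right_mono) auto
    finally show ?thesis .
  qed
  \<comment> \<open>The form needs an upper bound, against the direction of Fatou.
    \<open>J_young\<close> with parameter h makes \<open>?f\<close> non-negative; the pure test
    function part cancels between both sides, and the energy of \<open>w n\<close> costs at most h
    M.\<close>
  have A_ev: "\<forall>\<^sub>F n in sequentially. A n < A' + h + h * M" if h: "0 < h" for h
  proof -
    let ?f = "\<lambda>v z. h * \<bar>dq v z\<bar> powr p + h powr (1 - p) * \<bar>dq \<phi> z\<bar> powr p - J p (dq v z) * dq \<phi> z"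
    have "\<forall>\<^sub>F n in sequentially. (\<integral>z. ?f u z \<partial>\<nu>) - h < (\<integral>z. ?f (w n) z \<partial>\<nu>)"
    proof (rule fatou_eventually)
      show "integrable \<nu> (?f (w n))" for n
        using coneD(4)[OF fv(1)] coneD(4)[OF \<phi>] fv(2) by simp
      show "0 \<le> ?f (w n) z" for n z
        using J_young[OF p h, of "dq (w n) z" "dq \<phi> z"] by linarith
      show "integrable \<nu> (?f u)" using E coneD(4)[OF \<phi>] intA by simp
      show "AE z in \<nu>. (\<lambda>n. ?f (w n) z) \<longlonglongrightarrow> ?f u z"
        using w_limE by eventually_elim (intro tendsto_intros tendsto_powr_abs tendsto_J)
    qed (rule h)
    then show ?thesis
    proof eventually_elim
      fix n assume *: "(\<integral>z. ?f u z \<partial>\<nu>) - h < (\<integral>z. ?f (w n) z \<partial>\<nu>)"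
      have "(\<integral>z. ?f u z \<partial>\<nu>) = h * energy u + h powr (1 - p) * energy \<phi> - A'"
        using E coneD(4)[OF \<phi>] intA by (simp add: energy_def A'_def)
      moreover have "(\<integral>z. ?f (w n) z \<partial>\<nu>) = h * energy (w n) + h powr (1 - p) * energy \<phi> - A n"
        using coneD(4)[OF fv(1)] coneD(4)[OF \<phi>] fv(2) by (simp add: energy_def A_def)
      moreover have "h * energy (w n) \<le> h * M" using wE h by (intro mult_left_mono) auto
      moreover have "0 \<le> h * energy u" using h by (simp add: energy_nonneg)
      ultimately show "A n < A' + h + h * M" using * by linarith
    qed
  qed
  have B_ev: "\<forall>\<^sub>F n in sequentially. B' - h < B n" if h: "0 < h" for h
    unfolding B_def B'_def
  proof (rule fatou_eventually[OF fv(3) _ intB _ h])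
    show "0 \<le> J p (U n x) * \<phi> x" for n x
      using coneD(2)[OF U] nn by (simp add: J_nonneg)
    show "AE x in \<tau>. (\<lambda>n. J p (U n x) * \<phi> x) \<longlonglongrightarrow> J p (u x) * \<phi> x"
      using limH by eventually_elim (intro tendsto_intros tendsto_J)
  qed
  have C_ev: "\<forall>\<^sub>F n in sequentially. C' - h < C n" if h: "0 < h" for h
    unfolding C_def C'_def
  proof (rule fatou_eventually[OF fv(4) _ intC _ h])
    show "0 \<le> \<phi> x / ((1 + U n x) * (1 + w n x))" for n x
      using coneD(2)[OF U] coneD(2)[OF fv(1)] nn by (simp add: add_nonneg_nonneg)
    show "AE x in \<kappa>. (\<lambda>n. \<phi> x / ((1 + U n x) * (1 + w n x))) \<longlonglongrightarrow> \<phi> x / (1 + u x)\<^sup>2"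
      unfolding AE_tail_measure_iff using lim w_lim
    proof eventually_elim
      fix x assume x: "(\<lambda>n. U n x) \<longlonglongrightarrow> u x" "(\<lambda>n. w n x) \<longlonglongrightarrow> u x"
      have "1 + u x \<noteq> 0" using u0[of x] by linarith
      then have "(\<lambda>n. \<phi> x / ((1 + U n x) * (1 + w n x))) \<longlonglongrightarrow> \<phi> x / ((1 + u x) * (1 + u x))"
        by (intro tendsto_intros x) auto
      then show "(\<lambda>n. \<phi> x / ((1 + U n x) * (1 + w n x))) \<longlonglongrightarrow> \<phi> x / (1 + u x)\<^sup>2"
        by (simp add: power2_eq_square)
    qed
  qed
  have "l * p * B' + C' \<le> p * A'"
  proof (rule le_of_forall_small)
    fix h :: real assume h: "0 < h"
    have "(\<lambda>n. (1 / 4 :: real) ^ n) \<longlonglongrightarrow> 0" by (rule LIMSEQ_power_zero) simp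
    then have "\<forall>\<^sub>F n in sequentially. (1 / 4 :: real) ^ n < h" using h by (rule order_tendstoD(2))
    then have "\<forall>\<^sub>F n in sequentially. l * p * B' + C' \<le> p * A' + h * (p * (1 + M) + l * p + 2)"
      using A_ev[OF h] B_ev[OF h] C_ev[OF h]
    proof eventually_elim
      fix n assume *: "(1 / 4 :: real) ^ n < h" "A n < A' + h + h * M" "B' - h < B n" "C' - h < C n"
      have "p * A n \<le> p * (A' + h + h * M)" using *(2) p by (intro mult_left_mono) auto
      moreover have "(l * p) * (B' - h) \<le> (l * p) * B n" using *(3) p l by (intro mult_left_mono) auto
      ultimately show "l * p * B' + C' \<le> p * A' + h * (p * (1 + M) + l * p + 2)"
        using EL[of n] *(1,4) by (simp add: algebra_simps)
    qed
    then show "l * p * B' + C' \<le> p * A' + h * (p * (1 + M) + l * p + 2)"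
      by (simp add: eventually_sequentially) (meson order_refl)
  qed
  then show "l * p * (\<integral>x. J p (u x) * \<phi> x \<partial>\<tau>) + (\<integral>x. \<phi> x / (1 + u x)\<^sup>2 \<partial>\<kappa>)
      \<le> p * (\<integral>z. J p (dq u z) * dq \<phi> z \<partial>\<nu>)"
    by (simp add: A'_def B'_def C'_def)
qed

lemma form_dq:
  "u \<in> borel_measurable borel \<Longrightarrow> \<phi> \<in> borel_measurable borel \<Longrightarrow>
    frac_plap_form s p u \<phi> = (\<integral>z. J p (dq u z) * dq \<phi> z \<partial>\<nu>)"
  by (simp add: frac_plap_form_eq dq_def case_prod_beta')

text \<open>The Picone test functions blow up like \<^term>\<open>\<epsilon> powr (1 - p)\<close> on the zero set of
  \<^term>\<open>u\<close> while the form stays bounded, so the source term forces that set to be null.\<close>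

lemma positivity:
  assumes u [measurable]: "u \<in> borel_measurable borel" and u0: "\<And>x. 0 \<le> u x"
    and E: "integrable \<nu> (\<lambda>z. \<bar>dq u z\<bar> powr p)"
    and ineq: "\<And>\<phi>. \<phi> \<in> cone \<Longrightarrow> l * p * (\<integral>x. J p (u x) * \<phi> x \<partial>\<tau>) + (\<integral>x. \<phi> x / (1 + u x)\<^sup>2 \<partial>\<kappa>)
      \<le> p * (\<integral>z. J p (dq u z) * dq \<phi> z \<partial>\<nu>)"
  shows "AE x in lborel. x \<in> \<Omega> \<longrightarrow> 0 < u x"
proof -
  have loc: "gagliardo_pow s p A u < \<infinity>" if "open A" for A
    using that by (intro gagliardo_pow_finite u E borel_open)
  obtain \<eta> where \<eta>: "\<And>n. \<eta> n \<in> test_class s p \<Omega>" "\<And>n x. 0 \<le> \<eta> n x" "\<And>n x. \<eta> n x \<le> real n"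
    "\<And>x. x \<in> \<Omega> \<Longrightarrow> \<exists>n. 0 < \<eta> n x"
    using exhausting_cutoffs[OF p s om] by metis
  have null: "AE x in lborel. u x = 0 \<longrightarrow> \<eta> n x = 0" for n
  proof -
    note [measurable] = test_classD(1)[OF \<eta>(1)[of n]]
    \<comment> \<open>On the zero set of u the quotient is \<eta>^p / \<epsilon>^(p - 1) and (1 +
      u)^2 = 1, so \<open>g\<close> is the source integrand there after removing the blow-up
      factor.\<close>
    define g where "g x = (if u x = 0 then \<eta> n x powr p else 0)" for x
    have [measurable]: "g \<in> borel_measurable borel" unfolding g_def by measurable
    have g0: "0 \<le> g x" for x by (simp add: g_def)
    have int_g: "integrable \<kappa> g"
    proof (rule integrable_tail_measure_bounded[OF p s])
      show "\<bar>g x\<bar> \<le> real n powr p" for x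
        using \<eta>(2,3)[of n x] p by (auto simp: g_def intro: powr_mono2)
    qed measurable
    define G where "G = (\<integral>x. g x \<partial>\<kappa>)"
    have "ennreal (energy (\<eta> n)) = gagliardo_pow s p UNIV (\<eta> n)"
      unfolding energy_def using test_classD(3)[OF \<eta>(1)[of n]]
      by (subst gagliardo_pow_dq, simp, subst nn_integral_eq_integral) auto
    note en = this
    have "G \<le> h * (p * energy (\<eta> n))" if h: "0 < h" for h
    proof -
      \<comment> \<open>The choice \<epsilon>^(p - 1) = h makes the bound linear in h, the shape
        expected by \<open>le_of_forall_small\<close>.\<close>
      define \<epsilon> where "\<epsilon> = h powr (1 / (p - 1))"
      have \<epsilon>: "0 < \<epsilon>" "\<epsilon> powr (p - 1) = h" using h p by (auto simp: \<epsilon>_def powr_powr)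
      let ?\<psi> = "\<lambda>x. \<eta> n x powr p / (max 0 (u x) + \<epsilon>) powr (p - 1)"
      have "?\<psi> \<in> test_class s p \<Omega>"
        by (rule test_class_picone[OF p s om(1) \<epsilon>(1) \<eta>(1-3) u]) (rule loc)
      then have \<psi>: "?\<psi> \<in> cone" by (simp add: cone_def)
      have B: "0 \<le> l * p * (\<integral>x. J p (u x) * ?\<psi> x \<partial>\<tau>)"
        using l p u0 by (intro mult_nonneg_nonneg integral_nonneg_AE AE_I2) (auto simp: J_nonneg)
      have int_C: "integrable \<kappa> (\<lambda>x. ?\<psi> x / (1 + u x)\<^sup>2)"
      proof (rule integrable_tail_measure_bounded[OF p s])
        fix x
        have a: "?\<psi> x \<le> real n powr p / \<epsilon> powr (p - 1)"
          using \<eta>(2,3)[of n x] p \<epsilon>(1) by (intro frac_le powr_mono2) auto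
        have b: "1 \<le> (1 + u x)\<^sup>2" using u0[of x] by (simp add: one_le_power)
        have "?\<psi> x / (1 + u x)\<^sup>2 \<le> real n powr p / \<epsilon> powr (p - 1) / 1"
          by (rule frac_le[OF _ a zero_less_one b]) simp
        then show "\<bar>?\<psi> x / (1 + u x)\<^sup>2\<bar> \<le> real n powr p / \<epsilon> powr (p - 1)" by simp
      qed measurable
      have "G / h = (\<integral>x. g x / h \<partial>\<kappa>)" by (simp add: G_def)
      also have "\<dots> \<le> (\<integral>x. ?\<psi> x / (1 + u x)\<^sup>2 \<partial>\<kappa>)"
      proof (rule integral_mono)
        show "integrable \<kappa> (\<lambda>x. g x / h)" using int_g by simp
        show "g x / h \<le> ?\<psi> x / (1 + u x)\<^sup>2" for x
          using \<epsilon> by (auto simp: g_def)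
      qed (rule int_C)
      also have "\<dots> \<le> p * (\<integral>z. J p (dq u z) * dq ?\<psi> z \<partial>\<nu>)"
        using ineq[OF \<psi>] B by linarith
      also have "\<dots> \<le> p * energy (\<eta> n)"
      proof -
        have "ennreal (\<integral>z. J p (dq u z) * dq ?\<psi> z \<partial>\<nu>) \<le> ennreal (energy (\<eta> n))"
          using picone_form_le[OF p \<epsilon>(1) _ \<eta>(2)[of n] u, where s = s] u0 en by (simp add: form_dq)
        then have "(\<integral>z. J p (dq u z) * dq ?\<psi> z \<partial>\<nu>) \<le> energy (\<eta> n)"
          using energy_nonneg by (simp add: ennreal_le_iff)
        then show ?thesis using p by (intro mult_left_mono) auto
      qed
      finally show ?thesis using h by (simp add: divide_le_eq mult.commute)
    qed
    then have "G \<le> 0" using le_of_forall_small[of G 0 "p * energy (\<eta> n)"] by simp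
    then have "G = 0" using g0 by (simp add: G_def antisym)
    then have "AE x in \<kappa>. g x = 0"
      unfolding G_def using int_g g0 by (subst (asm) integral_nonneg_eq_0_iff_AE) auto
    then show ?thesis
      unfolding AE_tail_measure_iff by eventually_elim (auto simp: g_def)
  qed
  then have "AE x in lborel. \<forall>n. u x = 0 \<longrightarrow> \<eta> n x = 0" unfolding AE_all_countable by blast
  then show ?thesis
  proof eventually_elim
    fix x assume "\<forall>n. u x = 0 \<longrightarrow> \<eta> n x = 0"
    then show "x \<in> \<Omega> \<longrightarrow> 0 < u x" using \<eta>(4)[of x] u0[of x] by (metis less_le)
  qed
qed

lemma positive_supersolution_exists:
  "\<exists>u. positive_in \<Omega> u \<and> local_weak_supersolution s p \<Omega> l u"
proof -
  have [measurable]: "\<Omega> \<in> sets borel" using om(1) by (rule borel_open)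
  obtain U where U: "\<And>n. U n \<in> cone" and min: "\<And>n. functional (U n) \<le> inf_value + (1 / 8) ^ n"
    using minimizing_sequence by metis
  note [measurable] = coneD(3)[OF U]
  \<comment> \<open>Where the sequence diverges \<open>lim\<close> is an unspecified number; the
    maximum with 0 makes u non-negative everywhere and changes nothing where the sequence
    converges.\<close>
  define u where "u x = max 0 (lim (\<lambda>n. U n x))" for x
  have u [measurable]: "u \<in> borel_measurable borel"
    unfolding u_def by (intro borel_measurable_max borel_measurable_const borel_measurable_lim_metric) measurable
  have u0: "0 \<le> u x" for x by (simp add: u_def)
  have lim: "AE x in lborel. (\<lambda>n. U n x) \<longlonglongrightarrow> u x"
    using minimizing_sequence_converges[OF U min]
  proof eventually_elim
    fix x assume "convergent (\<lambda>n. U n x)"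
    then have c: "(\<lambda>n. U n x) \<longlonglongrightarrow> lim (\<lambda>n. U n x)" by (simp add: convergent_LIMSEQ_iff)
    then have "0 \<le> lim (\<lambda>n. U n x)" using coneD(2)[OF U] by (intro LIMSEQ_le_const) auto
    then show "(\<lambda>n. U n x) \<longlonglongrightarrow> u x" using c by (simp add: u_def)
  qed
  note L = limit_inequality[OF U min lim u u0]
  have "positive_in \<Omega> u"
    unfolding positive_in_def using positivity[OF u u0 L(1,3)] u0 by simp
  moreover have "local_weak_supersolution s p \<Omega> l u"
    unfolding local_weak_supersolution_def
  proof (intro conjI ballI impI)
    show "u \<in> Sobolev_loc s p \<Omega> \<inter> Tail (p - 1) (s * p)"
      using Sobolev_loc_of_integrable[OF p s(1) om u L(1,2)] Tail_of_gagliardo[OF p s u L(1)] by simp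
    fix \<phi> assume \<phi>: "\<phi> \<in> Sobolev s p UNIV"
      and adm: "(AE x in lborel. 0 \<le> \<phi> x) \<and> compact (ess_support \<phi>) \<and> ess_support \<phi> \<subseteq> \<Omega>"
    obtain \<psi> where \<psi>: "\<psi> \<in> test_class s p \<Omega>" "AE x in lborel. \<phi> x = \<psi> x" "\<And>x. 0 \<le> \<psi> x"
      using admissible_AE_test_class[OF \<phi>] adm by metis
    have [measurable]: "\<phi> \<in> borel_measurable borel" using \<phi> by (simp add: Sobolev_UNIV_iff)
    have cone: "\<psi> \<in> cone" using \<psi> by (simp add: cone_def)
    note [measurable] = coneD(3)[OF cone]
    have AE2: "AE z in \<nu>. J p (dq u z) * dq \<phi> z = J p (dq u z) * dq \<psi> z"
      using AE_gagliardo_measure[OF \<psi>(2)] by eventually_elim (simp add: dq_def)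
    have form: "frac_plap_form s p u \<phi> = (\<integral>z. J p (dq u z) * dq \<psi> z \<partial>\<nu>)"
      unfolding form_dq[OF u \<open>\<phi> \<in> borel_measurable borel\<close>] by (rule integral_cong_AE[OF _ _ AE2]) measurable
    have AE1: "AE x in \<tau>. J p (u x) * \<phi> x = J p (u x) * \<psi> x"
      unfolding AE_hardy_measure_iff[OF om] using \<psi>(2) by eventually_elim simp
    have "(LINT x:\<Omega>|lborel. J p (u x) / dist_bdry \<Omega> x powr (s * p) * \<phi> x) = (\<integral>x. J p (u x) * \<phi> x \<partial>\<tau>)"
      by (subst integral_hardy_measure) simp_all
    also have "\<dots> = (\<integral>x. J p (u x) * \<psi> x \<partial>\<tau>)"
      by (rule integral_cong_AE[OF _ _ AE1]) measurable
    finally have rhs: "(LINT x:\<Omega>|lborel. J p (u x) / dist_bdry \<Omega> x powr (s * p) * \<phi> x) = (\<integral>x. J p (u x) * \<psi> x \<partial>\<tau>)" .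
    \<comment> \<open>The source integral is non-negative and is dropped; this is why a
      supersolution results.\<close>
    have "0 \<le> (\<integral>x. \<psi> x / (1 + u x)\<^sup>2 \<partial>\<kappa>)" using \<psi>(3) by simp
    then have "p * (l * (\<integral>x. J p (u x) * \<psi> x \<partial>\<tau>)) \<le> p * (\<integral>z. J p (dq u z) * dq \<psi> z \<partial>\<nu>)"
      using L(3)[OF cone] by (simp add: mult_ac)
    then show "l * (LINT x:\<Omega>|lborel. J p (u x) / dist_bdry \<Omega> x powr (s * p) * \<phi> x) \<le> frac_plap_form s p u \<phi>"
      unfolding rhs form using p by simp
  qed
  ultimately show ?thesis by blast
qed

end

theorem theorem1p1:
  fixes s p :: real and \<Omega> :: "'a::euclidean_space set"
  assumes "1 < p" and "0 < s" and "s < 1" and "open \<Omega>" and "\<Omega> \<noteq> UNIV"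
  shows "hardy_const s p \<Omega> =
    (SUP \<mu> \<in> {\<mu>::real. 0 \<le> \<mu> \<and>
        (\<exists>u. positive_in \<Omega> u \<and> local_weak_supersolution s p \<Omega> \<mu> u)}. ennreal \<mu>)"
proof (rule antisym)
  let ?S = "{\<mu>::real. 0 \<le> \<mu> \<and> (\<exists>u. positive_in \<Omega> u \<and> local_weak_supersolution s p \<Omega> \<mu> u)}"
  show "(SUP \<mu> \<in> ?S. ennreal \<mu>) \<le> hardy_const s p \<Omega>"
    using supersolution_le_hardy_const[OF assms] by (intro SUP_least) auto
  show "hardy_const s p \<Omega> \<le> (SUP \<mu> \<in> ?S. ennreal \<mu>)"
  proof (rule dense_le)
    \<comment> \<open>The constant is approached from below by y, and the intermediate z provides
      the strictly larger Hardy constant that coercivity needs. Lying strictly below the constant, y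
      and z are finite even if it is infinite.\<close>
    fix y assume "y < hardy_const s p \<Omega>"
    then obtain z where z: "y < z" "z < hardy_const s p \<Omega>" using dense by blast
    obtain l' where l': "0 \<le> l'" "z = ennreal l'" using z(2) by (cases z) auto
    obtain l where y: "0 \<le> l" "y = ennreal l" using z(1) l'(2) by (cases y) auto
    interpret subcritical s p l l' \<Omega>
    proof
      show "l < l'" using z(1) y l' by (simp add: ennreal_less_iff)
      fix \<phi> assume \<phi>: "\<phi> \<in> test_class s p \<Omega>"
      have "ennreal l' \<le> hardy_const s p \<Omega>" using z(2) l'(2) by simp
      then show "(\<integral>\<^sup>+x. ennreal (l' * \<bar>\<phi> x\<bar> powr p) \<partial>hardy_measure s p \<Omega>) \<le> gagliardo_pow s p UNIV \<phi>"
        by (rule hardy_test_class[OF assms(1-4) hardy_smooth_compact[OF assms(1,2,4,5) l'(1)] \<phi>])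
    qed (use assms y in auto)
    have "l \<in> ?S" using positive_supersolution_exists y(1) by blast
    then show "y \<le> (SUP \<mu> \<in> ?S. ennreal \<mu>)" unfolding y(2) by (rule SUP_upper)
  qed
qed

end
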